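(* Assume (B1)-(B3) (with $\mathbb{I}=\mathbb{R}$), and let $f:\mathbb{R}\times\mathscr{X}\to\mathscr{X}$ be Perron integrable with $f(t,0)=0$. Suppose that the linear impulsive differential equation $$\dot x(t)=\widetilde A(t)x(t),\ t\ne t_i;\qquad x(t_i^+)-x(t_i)=B_ix(t_i),\ i\in\mathbb{Z},$$ has an exponential dichotomy on $\mathbb{R}$ with projection $P$ and constants $K,\alpha>0$, and that: (a) there is a constant $C_b>0$ with $\sum_{i\in\mathbb{Z}}\|B_i\|\le C_b$ and $\|(I+B_i)^{-1}\|\le C_b$ for all $i\in\mathbb{Z}$; (b) there is a Lebesgue measurable $m:\mathbb{R}\to\mathbb{R}$ with $\int_{\mathbb{R}}m(s)ds$ finite and $\left\|\int_{\mathbb{R}}\widetilde A(s)ds\right\|\le\int_{\mathbb{R}}m(s)ds$; (c) there is a Lebesgue measurable $\gamma:\mathbb{R}\to\mathbb{R}$ with $\int_{\mathbb{R}}\gamma(s)ds$ finite, $\|f(t,x)\|\le\gamma(t)$ and $\|f(t,x)-f(t,y)\|\le\gamma(t)\|x-y\|$ for all $t\in\mathbb{R}$, $x,y\in\mathscr{X}$. If $\int_{\mathbb{R}}\gamma(s)ds$ is sufficiently small (smaller than some positive constant depending only on the linear equation and on $P,K,\alpha,C_b$), then the linear equation is topologically conjugated to the nonlinear impulsive equation $$\dot x(t)=\widetilde A(t)x(t)+f(t,x(t)),\ t\ne t_i;\qquad x(t_i^+)-x(t_i)=B_ix(t_i),\ i\in\mathbb{Z}.$$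
   Context: $\mathscr{X}$ is a Banach space, $\mathscr{B}(\mathscr{X})$ its bounded linear operators, $I$ the identity. $\widetilde A:\mathbb{R}\to\mathscr{B}(\mathscr{X})$, $B_i\in\mathscr{B}(\mathscr{X})$ for $i\in\mathbb{Z}$; the impulse times satisfy $\cdots<t_{-1}<t_0=0<t_1<\cdots$ with $\lim_{k\to\pm\infty}t_k=\pm\infty$. Perron integrals are gauge (Kurzweil-Henstock) integrals. (B1) $\widetilde A$ is (locally) Perron integrable. (B2) There is a Lebesgue measurable $m:\mathbb{R}\to\mathbb{R}$ such that for all $c<d$, $\int_c^d m(s)ds$ is finite and $\|\int_c^d\widetilde A(s)ds\|\le\int_c^d m(s)ds$. (B3) $(I+B_i)^{-1}\in\mathscr{B}(\mathscr{X})$ for all $i$. A solution of the nonlinear impulsive equation is a function $x$ with $x(t)=x(s)+\int_s^t[\widetilde A(r)x(r)+f(r,x(r))]dr+\sum_{i:\,s\le t_i<t}B_ix(t_i)$ for all $s<t$; the linear equation is the case $f=0$. $W(t,s)$ denotes the evolution operator of the linear impulsive equation, i.e. $t\mapsto W(t,s)x_0$ is its solution with value $x_0$ at time $s$; $\mathscr{W}(t)=W(t,t_0)$, $\mathscr{W}^{-1}(t)=W(t_0,t)$ with $t_0=0$. Exponential dichotomy on $\mathbb{R}$: there are a projection $P:\mathscr{X}\to\mathscr{X}$ and constants $K,\alpha>0$ with $\|\mathscr{W}(t)P\mathscr{W}^{-1}(s)\|\le Ke^{-\alpha(t-s)}$ for $t\ge s$ and $\|\mathscr{W}(t)(I-P)\mathscr{W}^{-1}(s)\|\le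 Ke^{\alpha(t-s)}$ for $t<s$. Topological conjugacy (in Palmer's sense for nonautonomous systems): there are maps $\Phi,\Psi:\mathbb{R}\times\mathscr{X}\to\mathscr{X}$ such that (i) for each $t$, $\Phi(t,\cdot)$ is a homeomorphism of $\mathscr{X}$ with inverse $\Psi(t,\cdot)$; (ii) $\sup_{t,x}\|\Phi(t,x)-x\|<\infty$ and $\sup_{t,x}\|\Psi(t,x)-x\|<\infty$; (iii) if $x(t)$ is a solution of the linear equation then $\Phi(t,x(t))$ is a solution of the nonlinear equation; (iv) if $x(t)$ is a solution of the nonlinear equation then $\Psi(t,x(t))$ is a solution of the linear equation. *)

theory Defs
  imports "HOL-Analysis.Analysis"
begin

text \<open>
  Integrals of vector- and operator-valued functions are the Henstock--Kurzweil (gauge) integrals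
  of the library. Functions with values in the bounded operators are integrated with respect
  to the operator norm.
\<close>

definition impulse_times :: "(int \<Rightarrow> real) \<Rightarrow> bool" where
  "impulse_times \<tau> \<longleftrightarrow>
     strict_mono \<tau> \<and> \<tau> 0 = 0 \<and> filterlim \<tau> at_top at_top \<and> filterlim \<tau> at_bot at_bot"

text \<open>
  Integrability is demanded explicitly because \<^const>\<open>integral\<close> is total. For impulse times
  as above the index set of the sum is finite.
\<close>
definition impulsive_solution ::
  "(real \<Rightarrow> 'a::banach \<Rightarrow>\<^sub>L 'a) \<Rightarrow> (int \<Rightarrow> 'a \<Rightarrow>\<^sub>L 'a) \<Rightarrow> (int \<Rightarrow> real) \<Rightarrow> (real \<Rightarrow> 'a \<Rightarrow> 'a)
     \<Rightarrow> (real \<Rightarrow> 'a) \<Rightarrow> bool" where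
  "impulsive_solution A B \<tau> f x \<longleftrightarrow>
     (\<forall>s t. s < t \<longrightarrow>
        (\<lambda>r. blinfun_apply (A r) (x r) + f r (x r)) integrable_on {s..t} \<and>
        x t = x s + integral {s..t} (\<lambda>r. blinfun_apply (A r) (x r) + f r (x r))
                  + (\<Sum>i | s \<le> \<tau> i \<and> \<tau> i < t. blinfun_apply (B i) (x (\<tau> i))))"

abbreviation linear_impulsive_solution ::
  "(real \<Rightarrow> 'a::banach \<Rightarrow>\<^sub>L 'a) \<Rightarrow> (int \<Rightarrow> 'a \<Rightarrow>\<^sub>L 'a) \<Rightarrow> (int \<Rightarrow> real) \<Rightarrow> (real \<Rightarrow> 'a) \<Rightarrow> bool" where
  "linear_impulsive_solution A B \<tau> x \<equiv> impulsive_solution A B \<tau> (\<lambda>_ _. 0) x"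

text \<open>
  The operator \<open>W(t,s)\<close> sends \<open>x\<^sub>0\<close> to the value at time \<open>t\<close> of the solution, on the whole real line,
  that equals \<open>x\<^sub>0\<close> at time \<open>s\<close> (so \<open>t < s\<close> is allowed).
\<close>
definition evolution_operator ::
  "(real \<Rightarrow> 'a::banach \<Rightarrow>\<^sub>L 'a) \<Rightarrow> (int \<Rightarrow> 'a \<Rightarrow>\<^sub>L 'a) \<Rightarrow> (int \<Rightarrow> real) \<Rightarrow> real \<Rightarrow> real \<Rightarrow> 'a \<Rightarrow>\<^sub>L 'a" where
  "evolution_operator A B \<tau> t s =
     Blinfun (\<lambda>x\<^sub>0. (THE x. linear_impulsive_solution A B \<tau> x \<and> x s = x\<^sub>0) t)"

definition exponential_dichotomy ::
  "(real \<Rightarrow> 'a::banach \<Rightarrow>\<^sub>L 'a) \<Rightarrow> (int \<Rightarrow> 'a \<Rightarrow>\<^sub>L 'a) \<Rightarrow> (int \<Rightarrow> real) \<Rightarrow> 'a \<Rightarrow>\<^sub>L 'a \<Rightarrow> real \<Rightarrow> real \<Rightarrow> bool" where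
  "exponential_dichotomy A B \<tau> P K \<alpha> \<longleftrightarrow>
     P o\<^sub>L P = P \<and> K > 0 \<and> \<alpha> > 0 \<and>
     (\<forall>t s. t \<ge> s \<longrightarrow>
        norm (evolution_operator A B \<tau> t (\<tau> 0) o\<^sub>L P o\<^sub>L evolution_operator A B \<tau> (\<tau> 0) s)
          \<le> K * exp (- \<alpha> * (t - s))) \<and>
     (\<forall>t s. t < s \<longrightarrow>
        norm (evolution_operator A B \<tau> t (\<tau> 0) o\<^sub>L (id_blinfun - P) o\<^sub>L evolution_operator A B \<tau> (\<tau> 0) s)
          \<le> K * exp (\<alpha> * (t - s)))"

text \<open>
  Palmer's notion, for two equations given by their sets of solutions on the real line.
\<close>
definition topologically_conjugated ::
  "((real \<Rightarrow> 'a::real_normed_vector) \<Rightarrow> bool) \<Rightarrow> ((real \<Rightarrow> 'a) \<Rightarrow> bool) \<Rightarrow> bool" where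
  "topologically_conjugated sol\<^sub>1 sol\<^sub>2 \<longleftrightarrow>
     (\<exists>\<Phi> \<Psi> :: real \<Rightarrow> 'a \<Rightarrow> 'a.
        (\<forall>t. homeomorphism UNIV UNIV (\<Phi> t) (\<Psi> t)) \<and>
        bdd_above (range (\<lambda>(t, x). norm (\<Phi> t x - x))) \<and>
        bdd_above (range (\<lambda>(t, x). norm (\<Psi> t x - x))) \<and>
        (\<forall>x. sol\<^sub>1 x \<longrightarrow> sol\<^sub>2 (\<lambda>t. \<Phi> t (x t))) \<and>
        (\<forall>x. sol\<^sub>2 x \<longrightarrow> sol\<^sub>1 (\<lambda>t. \<Psi> t (x t))))"

end

theory Submission
  imports Defs
begin

text \<open>
The linear impulsive equation is solved by invertible operators \<open>W(t)\<close>, so that its solutions are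
exactly \<open>t \<mapsto> W(t)c\<close>. In the coordinates \<open>y = W(t)\<^sup>-\<^sup>1 x\<close> the impulses and the linear part
disappear: linear solutions become constants, and \<open>x\<close> solves the nonlinear equation iff \<open>y\<close> is continuous
and \<open>y(v) - y(u)\<close> is the integral of \<open>W(r)\<^sup>-\<^sup>1 f(r, x(r))\<close> over \<open>[u,v]\<close>.

The conjugacy is Palmer's. The dichotomy bounds the Green operators \<open>W(t)PW(s)\<^sup>-\<^sup>1\<close> (\<open>s \<le> t\<close>) and
\<open>-W(t)(I-P)W(s)\<^sup>-\<^sup>1\<close> (\<open>t < s\<close>) by \<open>K\<close>, and since \<open>\<parallel>f(s,x)\<parallel> \<le> \<gamma>(s)\<close> with \<open>\<gamma>\<close> integrable on the line, the
Green integral of \<open>f(s, x(s))\<close> is a bounded particular solution of the equation forced by \<open>f(s, x(s))\<close>. If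
\<open>K\<integral>\<gamma> \<le> 1/2\<close>, then for each \<open>c\<close> the map \<open>z \<mapsto> Green integral of f(s, W(s)c + z(s))\<close> is a contraction in the supremum
norm; its fixed point \<open>z\<^sub>c\<close> makes \<open>W(t)c + z\<^sub>c(t)\<close> a nonlinear solution. So
\<open>\<Phi>(t, \<xi>) = \<xi> + z\<^sub>c(t)\<close> with \<open>c = W(t)\<^sup>-\<^sup>1\<xi>\<close>, and \<open>\<Psi>(t, \<xi>)\<close> subtracts from \<open>\<xi>\<close> the value at \<open>t\<close> of the Green
integral along the nonlinear solution through \<open>(t, \<xi>)\<close>. That they are inverse to each other is
uniqueness: of nonlinear solutions on one side, of the fixed point on the other. They are
continuous although solutions may diverge from each other as \<open>t \<rightarrow> \<plusminus>\<infinity>\<close>, because the part of the Green integral outside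
\<open>[-S,S]\<close> is controlled by the tail of \<open>\<integral>\<gamma>\<close>.

The analytic obstacle is that \<open>A\<close> is only gauge integrable in the operator norm: it need not have an integrable
pointwise majorant, its primitive need not be differentiable anywhere, and the strong form of
Henstock's lemma fails in infinite dimension. What is available is \<open>\<parallel>\<integral>\<^bsub>[u,v]\<^esub> A\<parallel> \<le> N(v) - N(u)\<close> with \<open>N\<close>
increasing and continuous. Lemma \<open>riemann_sum_product_error\<close> shows that this already makes \<open>A(r)x(r)\<close>
integrable for every continuous \<open>x\<close>, with integral at most \<open>sup \<parallel>x\<parallel> \<sqdot> (N(v) - N(u))\<close>. With this
estimate the linear equation behaves as if \<open>A\<close> were bounded by the measure \<open>dN\<close>: \<open>N\<close> takes over the role of
time, derivatives are replaced by increments that are \<open>o(dN)\<close>, and Gronwall's inequality and Picard iteration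
follow with the weight \<open>exp(4|N(t) - N(s)|)\<close>.
\<close>

section \<open>Gauge integrals of products in Banach spaces\<close>

text \<open>
Only sums over arbitrary sub-collections of a fine division are small (\<open>Henstock_lemma_part1\<close>), not sums of
norms, and \<open>A\<close> need not have an integrable majorant. So the tags are sorted into levels \<open>n\<close> with \<open>\<parallel>A(r)\<parallel> \<le> n\<close>. On level
\<open>n\<close> the function \<open>e\<close> is replaced, up to an error of order \<open>1/(n+1)\<close> that beats the size of \<open>A\<close>, by finitely
many values; each value selects one sub-collection of tags, and the gauge on level \<open>n\<close> is so fine that the
error of each sub-collection is negligible even after summing over all values and all levels. The
tags carrying one value can be any set of points, hence total boundedness of the range of \<open>e\<close> suffices.
\<close>
lemma riemann_sum_product_error:
  fixes A :: "real \<Rightarrow> 'p::banach" and e :: "real \<Rightarrow> 'q::real_normed_vector"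
    and prod :: "'p \<Rightarrow> 'q \<Rightarrow> 'r::real_normed_vector" and N :: "real \<Rightarrow> real"
  assumes bilinear: "bounded_bilinear prod"
    and contractive: "\<And>p q. norm (prod p q) \<le> norm p * norm q"
    and A: "A integrable_on {a..b}" and "a \<le> b"
    and N: "\<And>u v. a \<le> u \<Longrightarrow> u \<le> v \<Longrightarrow> v \<le> b \<Longrightarrow> norm (integral {u..v} A) \<le> N v - N u"
    and totally_bounded: "\<And>\<eta>. \<eta> > 0 \<Longrightarrow> \<exists>F. finite F \<and> (\<forall>r\<in>{a..b}. \<exists>z\<in>F. norm (e r - z) < \<eta>)"
    and "\<epsilon> > 0"
  shows "\<forall>\<^sub>F D in division_filter {a..b}.
           norm (\<Sum>(r,J)\<in>D. prod (measure lborel J *\<^sub>R A r - integral J A) (e r)) \<le> \<epsilon>"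
proof -
  interpret bounded_bilinear prod by (rule bilinear)
  have Nab: "N b - N a \<ge> 0" using N[of a b] \<open>a \<le> b\<close> norm_ge_zero order_trans by blast
  define w where "w = b - a + (N b - N a) + 1"
  define \<epsilon>1 where "\<epsilon>1 = \<epsilon> / (2 * w)"
  have \<epsilon>1: "\<epsilon>1 > 0" and \<epsilon>1_le: "\<epsilon>1 * (b - a + (N b - N a)) \<le> \<epsilon> / 2"
  proof -
    have "w > 0" using Nab \<open>a \<le> b\<close> by (simp add: w_def)
    then show "\<epsilon>1 > 0" using \<open>\<epsilon> > 0\<close> by (simp add: \<epsilon>1_def)
    then have "\<epsilon>1 * (b - a + (N b - N a)) \<le> \<epsilon>1 * w"
      by (intro mult_left_mono) (auto simp: w_def)
    also have "\<dots> = \<epsilon> / 2" using \<open>w > 0\<close> by (simp add: \<epsilon>1_def)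
    finally show "\<epsilon>1 * (b - a + (N b - N a)) \<le> \<epsilon> / 2" .
  qed
  \<comment> \<open>The level of a tag, an integer not below the norm of \<open>A\<close> there.\<close>
  define lev where "lev r = nat \<lceil>norm (A r)\<rceil>" for r
  have lev: "norm (A r) \<le> real (lev r)" for r unfolding lev_def by linarith
  have "\<forall>n. \<exists>F. finite F \<and> (\<forall>r\<in>{a..b}. \<exists>z\<in>F. norm (e r - z) < \<epsilon>1 / (real n + 1))"
    using \<epsilon>1 by (intro allI totally_bounded divide_pos_pos) auto
  from choice[OF this] obtain F where F: "\<And>n. finite (F n)"
      "\<And>n r. r \<in> {a..b} \<Longrightarrow> \<exists>z\<in>F n. norm (e r - z) < \<epsilon>1 / (real n + 1)"
    by metis
  define q where "q n r = (SOME z. z \<in> F n \<and> norm (e r - z) < \<epsilon>1 / (real n + 1))" for n r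
  have q: "q n r \<in> F n \<and> norm (e r - q n r) < \<epsilon>1 / (real n + 1)" if "r \<in> {a..b}" for n r
    using someI_ex[OF F(2)[OF that, of n, unfolded Bex_def]] unfolding q_def .
  \<comment> \<open>Tolerance for one sub-collection on level \<open>n\<close>: weighted with all values in \<open>F n\<close> it stays below \<open>\<epsilon> / 2 ^ (n + 2)\<close>.\<close>
  define \<delta> where "\<delta> n = \<epsilon> / (2 ^ (n + 2) * (1 + (\<Sum>z\<in>F n. norm z)))" for n
  have Fpos: "0 < 1 + (\<Sum>z\<in>F n. norm z)" for n
    by (simp add: add_pos_nonneg sum_nonneg)
  have \<delta>: "\<delta> n > 0" for n
    unfolding \<delta>_def using \<open>\<epsilon> > 0\<close> Fpos by simp
  have \<delta>_sum: "\<delta> n * (\<Sum>z\<in>F n. norm z) \<le> \<epsilon> / 2 ^ (n + 2)" for n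
  proof -
    have "\<delta> n * (\<Sum>z\<in>F n. norm z) \<le> \<delta> n * (1 + (\<Sum>z\<in>F n. norm z))"
      using \<delta>[of n] by (intro mult_left_mono) auto
    also have "\<dots> = \<epsilon> / 2 ^ (n + 2)" using Fpos[of n] by (simp add: \<delta>_def)
    finally show ?thesis .
  qed
  have "\<forall>n. \<exists>\<gamma>. gauge \<gamma> \<and> (\<forall>D. D tagged_division_of cbox a b \<and> \<gamma> fine D \<longrightarrow>
        norm ((\<Sum>(r,J)\<in>D. measure lborel J *\<^sub>R A r) - integral (cbox a b) A) < \<delta> n)"
    using integrable_integral[OF A[folded box_real(2)], unfolded has_integral, rule_format, OF \<delta>] ..
  from choice[OF this] obtain g where g: "\<And>n. gauge (g n)"
     "\<And>n D. D tagged_division_of cbox a b \<Longrightarrow> g n fine D \<Longrightarrow>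
        norm ((\<Sum>(r,J)\<in>D. measure lborel J *\<^sub>R A r) - integral (cbox a b) A) < \<delta> n"
    by blast
  have partial: "norm (\<Sum>(r,J)\<in>D. measure lborel J *\<^sub>R A r - integral J A) \<le> \<delta> n"
    if "D tagged_partial_division_of {a..b}" "g n fine D" for D n
    using Henstock_lemma_part1[of A a b "\<delta> n" "g n" D] A \<delta>[of n] g that by simp
  define \<gamma> where "\<gamma> r = g (lev r) r" for r
  have "gauge \<gamma>" using g(1) by (simp add: gauge_def \<gamma>_def)
  moreover have "norm (\<Sum>(r,J)\<in>D. prod (measure lborel J *\<^sub>R A r - integral J A) (e r)) \<le> \<epsilon>"
    if D: "D tagged_division_of {a..b}" and fine: "\<gamma> fine D" for D
  proof -
    define E where "E = (\<lambda>(r,J). measure lborel J *\<^sub>R A r - integral J A)"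
    define z where "z = (\<lambda>(r::real,J::real set). q (lev r) r)"
    have finD: "finite D" using D by auto
    have rJ: "r \<in> {a..b} \<and> r \<in> J \<and> J = {Inf J..Sup J} \<and> Inf J \<le> Sup J \<and> a \<le> Inf J \<and> Sup J \<le> b"
      if "(r,J) \<in> D" for r J
    proof -
      obtain u v where J: "J = cbox u v" using tagged_division_ofD(4)[OF D \<open>(r,J) \<in> D\<close>] by blast
      have "r \<in> J" "J \<subseteq> {a..b}" using tagged_division_ofD(2,3)[OF D \<open>(r,J) \<in> D\<close>] by auto
      then show ?thesis using J by auto
    qed
    have "(\<Sum>(r,J)\<in>D. prod (measure lborel J *\<^sub>R A r - integral J A) (e r))
        = (\<Sum>x\<in>D. prod (E x) (z x)) + (\<Sum>x\<in>D. prod (E x) (e (fst x) - z x))"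
      by (simp add: E_def case_prod_unfold diff_right flip: sum.distrib)
    moreover have "norm (\<Sum>x\<in>D. prod (E x) (e (fst x) - z x)) \<le> \<epsilon> / 2"
    proof -
      have "norm (prod (E x) (e (fst x) - z x)) \<le> \<epsilon>1 * measure lborel (snd x) + \<epsilon>1 * (N (Sup (snd x)) - N (Inf (snd x)))"
        if "x \<in> D" for x
      proof -
        obtain r J where x: "x = (r,J)" by (cases x)
        note J = rJ[OF \<open>x \<in> D\<close>[unfolded x]]
        have "norm (integral J A) \<le> N (Sup J) - N (Inf J)"
          using N[of "Inf J" "Sup J"] J by metis
        moreover have "norm (measure lborel J *\<^sub>R A r) \<le> measure lborel J * (real (lev r))"
          using lev[of r] by (simp add: mult_left_mono)
        ultimately have nE: "norm (E x) \<le> measure lborel J * real (lev r) + (N (Sup J) - N (Inf J))"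
          unfolding E_def x using norm_triangle_ineq4[of "measure lborel J *\<^sub>R A r" "integral J A"] by simp
        have Npos: "0 \<le> N (Sup J) - N (Inf J)" using \<open>norm (integral J A) \<le> _\<close> norm_ge_zero order_trans by blast
        have d: "norm (e r - z x) \<le> \<epsilon>1 / (real (lev r) + 1)"
          using q[of r "lev r"] J by (simp add: z_def x)
        have "norm (prod (E x) (e (fst x) - z x)) \<le> norm (E x) * norm (e r - z x)"
          using contractive x by simp
        also have "\<dots> \<le> (measure lborel J * real (lev r) + (N (Sup J) - N (Inf J))) * (\<epsilon>1 / (real (lev r) + 1))"
          using nE d Npos by (intro mult_mono) auto
        also have "\<dots> = \<epsilon>1 * measure lborel J * (real (lev r) / (real (lev r) + 1))
             + \<epsilon>1 * (N (Sup J) - N (Inf J)) * (1 / (real (lev r) + 1))"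
          by (simp add: distrib_left mult_ac add_divide_distrib)
        also have "\<dots> \<le> \<epsilon>1 * measure lborel J * 1 + \<epsilon>1 * (N (Sup J) - N (Inf J)) * 1"
          using \<epsilon>1 Npos by (intro add_mono mult_left_mono) auto
        finally show ?thesis by (simp add: x)
      qed
      then have "norm (\<Sum>x\<in>D. prod (E x) (e (fst x) - z x))
          \<le> (\<Sum>x\<in>D. \<epsilon>1 * measure lborel (snd x) + \<epsilon>1 * (N (Sup (snd x)) - N (Inf (snd x))))"
        by (rule sum_norm_le)
      also have "\<dots> = \<epsilon>1 * (\<Sum>(r,J)\<in>D. measure lborel J) + \<epsilon>1 * (\<Sum>(r,J)\<in>D. N (Sup J) - N (Inf J))"
        by (simp add: sum.distrib sum_distrib_left case_prod_unfold)
      also have "\<dots> = \<epsilon>1 * (b - a + (N b - N a))"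
      proof -
        have "(\<Sum>(r,J)\<in>D. measure lborel J) = b - a"
          using additive_content_tagged_division[of D a b] D \<open>a \<le> b\<close> by simp
        then show ?thesis
          using additive_tagged_division_1[OF \<open>a \<le> b\<close> D, of N] by (simp add: distrib_left)
      qed
      finally show ?thesis using \<epsilon>1_le by linarith
    qed
    moreover have "norm (\<Sum>x\<in>D. prod (E x) (z x)) \<le> \<epsilon> / 2"
    proof -
      define c where "c = (\<lambda>x::real \<times> real set. (lev (fst x), z x))"
      define M where "M = Max (insert 0 (fst ` c ` D))"
      have group: "norm (\<Sum>x\<in>{x\<in>D. c x = y}. prod (E x) (z x)) \<le> \<delta> (fst y) * norm (snd y)" for y
      proof -
        let ?S = "{x\<in>D. c x = y}"
        have "(\<Sum>x\<in>?S. prod (E x) (z x)) = prod (\<Sum>x\<in>?S. E x) (snd y)"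
          unfolding sum_left by (intro sum.cong) (auto simp: c_def)
        moreover have "norm (\<Sum>x\<in>?S. E x) \<le> \<delta> (fst y)"
          unfolding E_def
        proof (rule partial)
          show "?S tagged_partial_division_of {a..b}"
            by (rule tagged_partial_division_subset[of D]) (use D tagged_division_of_def in blast)+
          show "g (fst y) fine ?S"
            using fine unfolding fine_def \<gamma>_def c_def by fastforce
        qed
        ultimately show ?thesis
          using order_trans[OF contractive[of "\<Sum>x\<in>?S. E x" "snd y"] mult_right_mono] by simp
      qed
      have sub: "c ` D \<subseteq> Sigma {..M} F"
      proof
        fix y assume "y \<in> c ` D"
        then obtain r J where rj: "(r,J) \<in> D" "y = c (r,J)" by auto
        have "fst y \<le> M" unfolding M_def using \<open>y \<in> c ` D\<close> finD by (intro Max_ge) auto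
        then show "y \<in> Sigma {..M} F"
          using q[of r "lev r"] rJ[OF rj(1)] rj by (auto simp: c_def z_def)
      qed
      have "(\<Sum>x\<in>D. prod (E x) (z x)) = (\<Sum>y\<in>c ` D. \<Sum>x\<in>{x\<in>D. c x = y}. prod (E x) (z x))"
        by (rule sum.image_gen[OF finD])
      also have "norm \<dots> \<le> (\<Sum>y\<in>c ` D. \<delta> (fst y) * norm (snd y))"
        by (rule sum_norm_le) (rule group)
      also have "\<dots> \<le> (\<Sum>y\<in>Sigma {..M} F. \<delta> (fst y) * norm (snd y))"
        using sub F(1) \<delta> by (intro sum_mono2) (auto simp: less_imp_le)
      also have "\<dots> = (\<Sum>n\<le>M. \<delta> n * (\<Sum>z\<in>F n. norm z))"
        using F(1) by (simp add: sum.Sigma sum_distrib_left case_prod_unfold)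
      also have "\<dots> \<le> (\<Sum>n\<le>M. \<epsilon> / 2 ^ (n + 2))"
        by (intro sum_mono \<delta>_sum)
      also have "\<dots> = \<epsilon> / 2 - \<epsilon> / 2 ^ (M + 2)"
        by (induction M) (simp_all add: field_simps)
      also have "\<dots> \<le> \<epsilon> / 2" using \<open>\<epsilon> > 0\<close> by simp
      finally show ?thesis .
    qed
    ultimately show ?thesis by (smt (verit) norm_triangle_ineq field_sum_of_halves)
  qed
  ultimately show ?thesis unfolding eventually_division_filter by (intro exI[of _ \<gamma>]) simp
qed

text \<open>
After replacing \<open>A(r)|J|\<close> by \<open>\<integral>\<^bsub>J\<^esub> A\<close> the sum is a Stieltjes sum, which is bounded termwise by the increments of \<open>N\<close>.
\<close>
lemma riemann_sum_product_bound:
  fixes A :: "real \<Rightarrow> 'p::banach" and e :: "real \<Rightarrow> 'q::real_normed_vector"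
    and prod :: "'p \<Rightarrow> 'q \<Rightarrow> 'r::real_normed_vector" and N :: "real \<Rightarrow> real"
  assumes bilinear: "bounded_bilinear prod"
    and contractive: "\<And>p q. norm (prod p q) \<le> norm p * norm q"
    and A: "A integrable_on {a..b}" and "a \<le> b"
    and N: "\<And>u v. a \<le> u \<Longrightarrow> u \<le> v \<Longrightarrow> v \<le> b \<Longrightarrow> norm (integral {u..v} A) \<le> N v - N u"
    and totally_bounded: "\<And>\<eta>. \<eta> > 0 \<Longrightarrow> \<exists>F. finite F \<and> (\<forall>r\<in>{a..b}. \<exists>z\<in>F. norm (e r - z) < \<eta>)"
    and C: "\<And>r. r \<in> {a..b} \<Longrightarrow> norm (e r) \<le> C"
    and "\<epsilon> > 0"
  shows "\<forall>\<^sub>F D in division_filter {a..b}.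
           norm (\<Sum>(r,J)\<in>D. measure lborel J *\<^sub>R prod (A r) (e r)) \<le> C * (N b - N a) + \<epsilon>"
proof -
  interpret bounded_bilinear prod by (rule bilinear)
  have "norm (\<Sum>(r,J)\<in>D. measure lborel J *\<^sub>R prod (A r) (e r)) \<le> C * (N b - N a) + \<epsilon>"
    if D: "D tagged_division_of {a..b}"
      and err: "norm (\<Sum>(r,J)\<in>D. prod (measure lborel J *\<^sub>R A r - integral J A) (e r)) \<le> \<epsilon>" for D
  proof -
    have "norm (prod (integral J A) (e r)) \<le> C * (N (Sup J) - N (Inf J))" if rD: "(r,J) \<in> D" for r J
    proof -
      obtain u v where J: "J = cbox u v" using tagged_division_ofD(4)[OF D rD] by blast
      have rJ: "r \<in> J" "J \<subseteq> {a..b}" using tagged_division_ofD(2,3)[OF D rD] by auto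
      then have uv: "u \<le> v" "a \<le> u" "v \<le> b" "Inf J = u" "Sup J = v" using J by auto
      have "norm (prod (integral J A) (e r)) \<le> norm (integral J A) * norm (e r)" by (rule contractive)
      also have "\<dots> \<le> (N v - N u) * C"
        using N[of u v] C[of r] uv rJ J order_trans[OF norm_ge_zero N[of u v]] by (intro mult_mono) auto
      finally show ?thesis using uv by (simp add: mult.commute)
    qed
    then have "norm (\<Sum>(r,J)\<in>D. prod (integral J A) (e r)) \<le> (\<Sum>(r,J)\<in>D. C * (N (Sup J) - N (Inf J)))"
      by (intro sum_norm_le) auto
    also have "\<dots> = C * (N b - N a)"
      using additive_tagged_division_1[OF \<open>a \<le> b\<close> D, of N]
      by (simp add: case_prod_unfold flip: sum_distrib_left)
    finally have 1: "norm (\<Sum>(r,J)\<in>D. prod (integral J A) (e r)) \<le> C * (N b - N a)" .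
    have "(\<Sum>(r,J)\<in>D. measure lborel J *\<^sub>R prod (A r) (e r))
      = (\<Sum>(r,J)\<in>D. prod (measure lborel J *\<^sub>R A r - integral J A) (e r)) + (\<Sum>(r,J)\<in>D. prod (integral J A) (e r))"
      by (simp add: case_prod_unfold diff_left scaleR_left flip: sum.distrib)
    then show ?thesis using 1 err by (smt (verit) norm_triangle_ineq)
  qed
  with riemann_sum_product_error[OF bilinear contractive A \<open>a \<le> b\<close> N totally_bounded \<open>\<epsilon> > 0\<close>]
    eventually_division_filter_tagged_division[of "{a..b}"]
  show ?thesis by (auto elim: eventually_elim2)
qed

lemma has_integral_division_filter:
  fixes f :: "real \<Rightarrow> 'r::real_normed_vector"
  shows "(f has_integral I) {a..b} \<longleftrightarrow>
    ((\<lambda>D. \<Sum>(r,J)\<in>D. measure lborel J *\<^sub>R f r) \<longlongrightarrow> I) (division_filter {a..b})"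
  using has_integral_cbox[of f I a b] by simp

lemma integrable_by_approximation:
  fixes h :: "real \<Rightarrow> 'r::banach"
  assumes approx: "\<And>\<epsilon>. \<epsilon> > 0 \<Longrightarrow> \<exists>g. g integrable_on {a..b} \<and>
      (\<forall>\<^sub>F D in division_filter {a..b}. norm (\<Sum>(r,J)\<in>D. measure lborel J *\<^sub>R (h r - g r)) \<le> \<epsilon>)"
  shows "h integrable_on {a..b}"
  unfolding box_real(2)[symmetric] integrable_Cauchy
proof (intro allI impI)
  let ?R = "\<lambda>f D. \<Sum>(r,J)\<in>D. measure lborel J *\<^sub>R f r"
  fix \<epsilon> :: real assume "\<epsilon> > 0"
  then have "\<epsilon> / 4 > 0" by simp
  from approx[OF this] obtain g where g: "g integrable_on {a..b}"
    and g1: "\<forall>\<^sub>F D in division_filter {a..b}. norm (?R (\<lambda>r. h r - g r) D) \<le> \<epsilon> / 4"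
    by auto
  define I where "I = integral {a..b} g"
  have "\<forall>\<^sub>F D in division_filter {a..b}. dist (?R g D) I < \<epsilon> / 4"
    using integrable_integral[OF g] \<open>\<epsilon> / 4 > 0\<close> unfolding has_integral_division_filter I_def by (rule tendstoD)
  with g1 have "\<forall>\<^sub>F D in division_filter {a..b}. norm (?R h D - I) < \<epsilon> / 2"
  proof eventually_elim
    case (elim D)
    have "?R (\<lambda>r. h r - g r) D = ?R h D - ?R g D"
      by (simp add: case_prod_unfold scaleR_diff_right sum_subtractf)
    then show ?case
      using elim norm_triangle_ineq[of "?R h D - ?R g D" "?R g D - I"] by (simp add: dist_norm)
  qed
  then obtain \<gamma> where \<gamma>: "gauge \<gamma>"
      "\<And>D. D tagged_division_of cbox a b \<Longrightarrow> \<gamma> fine D \<Longrightarrow> norm (?R h D - I) < \<epsilon> / 2"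
    unfolding eventually_division_filter box_real(2) by auto
  have "norm (?R h D - ?R h E) < \<epsilon>"
    if "D tagged_division_of cbox a b \<and> \<gamma> fine D \<and> E tagged_division_of cbox a b \<and> \<gamma> fine E" for D E
    using \<gamma>(2)[of D] \<gamma>(2)[of E] that norm_triangle_ineq4[of "?R h D - I" "?R h E - I"] by simp
  with \<gamma>(1) show "\<exists>\<gamma>. gauge \<gamma> \<and> (\<forall>D E. D tagged_division_of cbox a b \<and> \<gamma> fine D \<and>
            E tagged_division_of cbox a b \<and> \<gamma> fine E \<longrightarrow> norm (?R h D - ?R h E) < \<epsilon>)"
    by (intro exI[of _ \<gamma>] conjI allI impI)
qed

lemma integral_norm_le_riemann_sums:
  fixes h :: "real \<Rightarrow> 'r::banach"
  assumes h: "h integrable_on {a..b}" and "a \<le> b"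
    and bound: "\<And>\<epsilon>. \<epsilon> > 0 \<Longrightarrow>
      \<forall>\<^sub>F D in division_filter {a..b}. norm (\<Sum>(r,J)\<in>D. measure lborel J *\<^sub>R h r) \<le> c + \<epsilon>"
  shows "norm (integral {a..b} h) \<le> c"
proof (rule field_le_epsilon)
  fix \<epsilon> :: real assume "\<epsilon> > 0"
  have "((\<lambda>D. norm (\<Sum>(r,J)\<in>D. measure lborel J *\<^sub>R h r)) \<longlongrightarrow> norm (integral {a..b} h)) (division_filter {a..b})"
    using integrable_integral[OF h] unfolding has_integral_division_filter by (rule tendsto_norm)
  then show "norm (integral {a..b} h) \<le> c + \<epsilon>"
    using bound[OF \<open>\<epsilon> > 0\<close>] division_filter_not_empty[of a b] by (auto intro: tendsto_upperbound)
qed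

text \<open>
For properties of intervals that hold locally and survive concatenation; every local estimate and every local
construction below is glued in this way.
\<close>
lemma interval_bisection[consumes 1, case_names trans local]:
  fixes P :: "real \<Rightarrow> real \<Rightarrow> bool"
  assumes "a \<le> b"
    and trans: "\<And>u v w. a \<le> u \<Longrightarrow> u \<le> v \<Longrightarrow> v \<le> w \<Longrightarrow> w \<le> b \<Longrightarrow> P u v \<Longrightarrow> P v w \<Longrightarrow> P u w"
    and local: "\<And>x. a \<le> x \<Longrightarrow> x \<le> b \<Longrightarrow>
       \<exists>\<delta>>0. \<forall>u v. a \<le> u \<longrightarrow> u \<le> x \<longrightarrow> x \<le> v \<longrightarrow> v \<le> b \<longrightarrow> v - u < \<delta> \<longrightarrow> P u v"
  shows "P a b"
proof -
  let ?Q = "\<lambda>u v. a \<le> u \<longrightarrow> v \<le> b \<longrightarrow> P u v"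
  have "?Q a b"
  proof (rule Bolzano[where P = ?Q])
    show "a \<le> b" by fact
    show "?Q u w" if "?Q u v" "?Q v w" "u \<le> v" "v \<le> w" for u v w
      using that trans[of u v w] by auto
    show "\<exists>d>0. \<forall>u v. u \<le> x \<and> x \<le> v \<and> v - u < d \<longrightarrow> ?Q u v" if "a \<le> x" "x \<le> b" for x
      using local[OF that] by blast
  qed
  then show ?thesis by simp
qed

text \<open>
On short intervals \<open>g\<close> is constant, and bisection glues. The second conjunct is what the integrability
proofs need: inserting \<open>g\<close> into \<open>F\<close> keeps integrability, because \<open>g\<close> is piecewise constant.
\<close>
lemma finite_valued_approximation:
  fixes d :: "real \<Rightarrow> 'q::metric_space" and F :: "real \<Rightarrow> 'q \<Rightarrow> 'r::banach"
  assumes "a \<le> b" and d: "continuous_on {a..b} d"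
    and F: "\<And>z. (\<lambda>r. F r z) integrable_on {a..b}" and "e > 0"
  shows "\<exists>g. finite (g ` {a..b}) \<and> (\<lambda>r. F r (g r)) integrable_on {a..b} \<and> (\<forall>r\<in>{a..b}. dist (d r) (g r) < e)"
proof -
  let ?P = "\<lambda>u v. \<exists>g. finite (g ` {u..v}) \<and> (\<lambda>r. F r (g r)) integrable_on {u..v} \<and>
     (\<forall>r\<in>{u..v}. dist (d r) (g r) < e)"
  have "?P a b"
    using \<open>a \<le> b\<close>
  proof (rule interval_bisection[where P = ?P])
    fix u v w assume uvw: "a \<le> u" "u \<le> v" "v \<le> w" "w \<le> b" and "?P u v" "?P v w"
    show "?P u w"
    proof -
      from \<open>?P u v\<close> \<open>?P v w\<close> obtain g h where
        g: "finite (g ` {u..v})" "(\<lambda>r. F r (g r)) integrable_on {u..v}" "\<forall>r\<in>{u..v}. dist (d r) (g r) < e" and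
        h: "finite (h ` {v..w})" "(\<lambda>r. F r (h r)) integrable_on {v..w}" "\<forall>r\<in>{v..w}. dist (d r) (h r) < e"
        by auto
      define k where "k r = (if r \<le> v then g r else h r)" for r
      have "k ` {u..w} \<subseteq> g ` {u..v} \<union> h ` {v..w}" by (auto simp: k_def)
      then have "finite (k ` {u..w})" using g h by (meson finite_Un finite_subset)
      moreover have "(\<lambda>r. F r (k r)) integrable_on {u..w}"
      proof (rule Henstock_Kurzweil_Integration.integrable_combine[OF uvw(2,3)])
        show "(\<lambda>r. F r (k r)) integrable_on {u..v}"
          using g(2) by (rule integrable_eq) (auto simp: k_def)
        show "(\<lambda>r. F r (k r)) integrable_on {v..w}"
          by (rule integrable_spike_finite[of "{v}" _ _ "\<lambda>r. F r (h r)"]) (use h(2) in \<open>auto simp: k_def\<close>)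
      qed
      moreover have "\<forall>r\<in>{u..w}. dist (d r) (k r) < e" using g(3) h(3) by (auto simp: k_def)
      ultimately show ?thesis by blast
    qed
  next
    fix x assume "a \<le> x" "x \<le> b"
    then obtain \<delta> where \<delta>: "\<delta> > 0" "\<And>y. y \<in> {a..b} \<Longrightarrow> dist y x < \<delta> \<Longrightarrow> dist (d y) (d x) < e"
      using d \<open>e > 0\<close> unfolding continuous_on_iff by (metis atLeastAtMost_iff)
    show "\<exists>\<delta>>0. \<forall>u v. a \<le> u \<longrightarrow> u \<le> x \<longrightarrow> x \<le> v \<longrightarrow> v \<le> b \<longrightarrow> v - u < \<delta> \<longrightarrow> ?P u v"
    proof (intro exI conjI allI impI)
      fix u v assume uv: "a \<le> u" "u \<le> x" "x \<le> v" "v \<le> b" "v - u < \<delta>"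
      show "finite ((\<lambda>_. d x) ` {u..v})" by (rule finite_subset[of _ "{d x}"]) auto
      show "(\<lambda>r. F r (d x)) integrable_on {u..v}"
        by (rule integrable_subinterval_real[OF F]) (use uv in auto)
      show "\<forall>r\<in>{u..v}. dist (d r) (d x) < e"
        using uv by (auto intro!: \<delta>(2) simp: dist_real_def)
    qed (rule \<delta>(1))
  qed
  then show ?thesis .
qed

text \<open>
Stated for a general product since it is used both for operators acting on vectors and for the composition of
operators. If \<open>g\<close> is a step function close to \<open>d\<close>, the range of \<open>d - g\<close> is totally bounded and
\<open>riemann_sum_product_bound\<close> makes all fine Riemann sums of \<open>A(d - g)\<close> small.
\<close>
lemma product_integral:
  fixes A :: "real \<Rightarrow> 'p::banach" and d :: "real \<Rightarrow> 'q::real_normed_vector"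
    and prod :: "'p \<Rightarrow> 'q \<Rightarrow> 'r::banach" and N :: "real \<Rightarrow> real"
  assumes bilinear: "bounded_bilinear prod"
    and contractive: "\<And>p q. norm (prod p q) \<le> norm p * norm q"
    and A: "A integrable_on {a..b}" and "a \<le> b"
    and N: "\<And>u v. a \<le> u \<Longrightarrow> u \<le> v \<Longrightarrow> v \<le> b \<Longrightarrow> norm (integral {u..v} A) \<le> N v - N u"
    and d: "continuous_on {a..b} d"
  shows "(\<lambda>r. prod (A r) (d r)) integrable_on {a..b}" (is ?int)
    and "(\<And>r. r \<in> {a..b} \<Longrightarrow> norm (d r) \<le> C) \<Longrightarrow>
           norm (integral {a..b} (\<lambda>r. prod (A r) (d r))) \<le> C * (N b - N a)"
proof -
  interpret bounded_bilinear prod by (rule bilinear)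
  have Nab: "N b - N a \<ge> 0" using N[of a b] \<open>a \<le> b\<close> norm_ge_zero order_trans by blast
  have tb: "\<exists>F. finite F \<and> (\<forall>r\<in>{a..b}. \<exists>z\<in>F. norm (d r - z) < \<eta>)" if "\<eta> > 0" for \<eta>
  proof -
    obtain g where "finite (g ` {a..b})" "\<forall>r\<in>{a..b}. dist (d r) (g r) < \<eta>"
      using finite_valued_approximation[OF \<open>a \<le> b\<close> d, of "\<lambda>_ _. 0 :: real" \<eta>] \<open>\<eta> > 0\<close> by auto
    then show ?thesis by (intro exI[of _ "g ` {a..b}"]) (auto simp: dist_norm)
  qed
  show int: ?int
  proof (rule integrable_by_approximation)
    fix \<epsilon> :: real assume "\<epsilon> > 0"
    define \<epsilon>1 where "\<epsilon>1 = \<epsilon> / (2 * (N b - N a + 1))"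
    have "\<epsilon>1 > 0" and le: "\<epsilon>1 * (N b - N a) \<le> \<epsilon> / 2"
      using Nab \<open>\<epsilon> > 0\<close> by (auto simp: \<epsilon>1_def field_simps)
    have Az: "(\<lambda>r. prod (A r) z) integrable_on {a..b}" for z
      using integrable_linear[OF A bounded_linear_left] by (simp add: o_def)
    obtain g where g: "finite (g ` {a..b})" "(\<lambda>r. prod (A r) (g r)) integrable_on {a..b}"
        "\<forall>r\<in>{a..b}. dist (d r) (g r) < \<epsilon>1"
      using finite_valued_approximation[OF \<open>a \<le> b\<close> d, of "\<lambda>r z. prod (A r) z" \<epsilon>1] Az \<open>\<epsilon>1 > 0\<close> by blast
    have "\<exists>F. finite F \<and> (\<forall>r\<in>{a..b}. \<exists>z\<in>F. norm (d r - g r - z) < \<eta>)" if "\<eta> > 0" for \<eta>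
    proof -
      obtain F where "finite F" "\<forall>r\<in>{a..b}. \<exists>z\<in>F. norm (d r - z) < \<eta>" using tb[OF \<open>\<eta> > 0\<close>] by blast
      moreover have "\<exists>y\<in>F. \<exists>w\<in>g ` {a..b}. norm (d r - g r - (y - w)) < \<eta>" if "r \<in> {a..b}" for r
        using \<open>\<forall>r\<in>{a..b}. \<exists>z\<in>F. norm (d r - z) < \<eta>\<close> that by (force simp: algebra_simps)
      ultimately show ?thesis using g(1)
        by (intro exI[of _ "(\<lambda>(y,w). y - w) ` (F \<times> g ` {a..b})"]) force+
    qed
    from riemann_sum_product_bound[OF bilinear contractive A \<open>a \<le> b\<close> N this, of \<epsilon>1 "\<epsilon>/2"]
    have "\<forall>\<^sub>F D in division_filter {a..b}.
       norm (\<Sum>(r,J)\<in>D. measure lborel J *\<^sub>R prod (A r) (d r - g r)) \<le> \<epsilon>1 * (N b - N a) + \<epsilon> / 2"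
      using g(3) \<open>\<epsilon> > 0\<close> by (simp add: dist_norm less_imp_le)
    then have "\<forall>\<^sub>F D in division_filter {a..b}.
       norm (\<Sum>(r,J)\<in>D. measure lborel J *\<^sub>R (prod (A r) (d r) - prod (A r) (g r))) \<le> \<epsilon>"
      using le unfolding diff_right by (auto elim!: eventually_mono)
    with g(2) show "\<exists>g. g integrable_on {a..b} \<and> (\<forall>\<^sub>F D in division_filter {a..b}.
        norm (\<Sum>(r,J)\<in>D. measure lborel J *\<^sub>R (prod (A r) (d r) - g r)) \<le> \<epsilon>)"
      by (intro exI[of _ "\<lambda>r. prod (A r) (g r)"]) simp
  qed
  show "norm (integral {a..b} (\<lambda>r. prod (A r) (d r))) \<le> C * (N b - N a)"
    if "\<And>r. r \<in> {a..b} \<Longrightarrow> norm (d r) \<le> C"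
    by (rule integral_norm_le_riemann_sums[OF int \<open>a \<le> b\<close>])
       (rule riemann_sum_product_bound[OF bilinear contractive A \<open>a \<le> b\<close> N tb that])
qed

text \<open>
Here the error of replacing \<open>d\<close> by a step function is at most \<open>\<epsilon>\<gamma>(r)\<close> pointwise, so Riemann sums of \<open>\<gamma>\<close> control it.
\<close>
lemma integrable_lipschitz_superposition:
  fixes F :: "real \<Rightarrow> 'q::real_normed_vector \<Rightarrow> 'r::banach" and \<gamma> :: "real \<Rightarrow> real"
  assumes "a \<le> b" and d: "continuous_on {a..b} d"
    and F: "\<And>z. (\<lambda>r. F r z) integrable_on {a..b}"
    and lipschitz: "\<And>r x y. r \<in> {a..b} \<Longrightarrow> norm (F r x - F r y) \<le> \<gamma> r * norm (x - y)"
    and \<gamma>: "\<gamma> integrable_on {a..b}" "\<And>r. \<gamma> r \<ge> 0"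
  shows "(\<lambda>r. F r (d r)) integrable_on {a..b}"
proof (rule integrable_by_approximation)
  fix \<epsilon> :: real assume "\<epsilon> > 0"
  define I where "I = integral {a..b} \<gamma> + 1"
  have "I > 0" using integral_nonneg[OF \<gamma>(1)] \<gamma>(2) by (simp add: I_def add_nonneg_pos)
  obtain g where g: "(\<lambda>r. F r (g r)) integrable_on {a..b}" "\<And>r. r \<in> {a..b} \<Longrightarrow> dist (d r) (g r) < \<epsilon> / I"
    using finite_valued_approximation[OF \<open>a \<le> b\<close> d, of F "\<epsilon> / I"] F \<open>\<epsilon> > 0\<close> \<open>I > 0\<close> by auto
  have "norm (\<Sum>(r,J)\<in>D. measure lborel J *\<^sub>R (F r (d r) - F r (g r))) \<le> \<epsilon>"
    if D: "D tagged_division_of {a..b}"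
      and G: "dist (\<Sum>(r,J)\<in>D. measure lborel J *\<^sub>R \<gamma> r) (integral {a..b} \<gamma>) < 1" for D
  proof -
    have "norm (measure lborel J *\<^sub>R (F r (d r) - F r (g r))) \<le> \<epsilon> / I * (measure lborel J *\<^sub>R \<gamma> r)" if "(r,J) \<in> D" for r J
    proof -
      have r: "r \<in> {a..b}" using tagged_division_ofD(2,3)[OF D that] by auto
      have "norm (F r (d r) - F r (g r)) \<le> \<gamma> r * norm (d r - g r)" by (rule lipschitz[OF r])
      also have "\<dots> \<le> \<gamma> r * (\<epsilon> / I)"
        using g(2)[OF r] \<gamma>(2)[of r] by (intro mult_left_mono) (auto simp: dist_norm)
      finally have "measure lborel J * norm (F r (d r) - F r (g r)) \<le> measure lborel J * (\<gamma> r * (\<epsilon> / I))"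
        by (rule mult_left_mono) simp
      then show ?thesis by (simp add: mult_ac)
    qed
    then have "norm (\<Sum>(r,J)\<in>D. measure lborel J *\<^sub>R (F r (d r) - F r (g r))) \<le> (\<Sum>(r,J)\<in>D. \<epsilon> / I * (measure lborel J *\<^sub>R \<gamma> r))"
      by (intro sum_norm_le) auto
    also have "\<dots> = \<epsilon> / I * (\<Sum>(r,J)\<in>D. measure lborel J *\<^sub>R \<gamma> r)"
      by (simp add: sum_distrib_left case_prod_unfold)
    also have "\<dots> \<le> \<epsilon> / I * I"
      using G \<open>\<epsilon> > 0\<close> \<open>I > 0\<close> by (intro mult_left_mono) (auto simp: I_def dist_real_def)
    also have "\<dots> = \<epsilon>" using \<open>I > 0\<close> by simp
    finally show ?thesis .
  qed
  with tendstoD[OF integrable_integral[OF \<gamma>(1), unfolded has_integral_division_filter] zero_less_one]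
    eventually_division_filter_tagged_division[of "{a..b}"]
  have "\<forall>\<^sub>F D in division_filter {a..b}.
      norm (\<Sum>(r,J)\<in>D. measure lborel J *\<^sub>R (F r (d r) - F r (g r))) \<le> \<epsilon>"
    by (auto elim: eventually_elim2)
  with g(1) show "\<exists>g. g integrable_on {a..b} \<and> (\<forall>\<^sub>F D in division_filter {a..b}.
        norm (\<Sum>(r,J)\<in>D. measure lborel J *\<^sub>R (F r (d r) - g r)) \<le> \<epsilon>)"
    by (intro exI[of _ "\<lambda>r. F r (g r)"]) simp
qed

section \<open>Estimates relative to an increasing function\<close>

text \<open>
The substitute for ``zero derivative implies constant'': increments that are \<open>o(dN)\<close> near every point.
\<close>
lemma constant_if_small_increments:
  fixes D :: "real \<Rightarrow> 'e::real_normed_vector"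
  assumes "a \<le> b"
    and small: "\<And>\<epsilon> x. \<epsilon> > 0 \<Longrightarrow> a \<le> x \<Longrightarrow> x \<le> b \<Longrightarrow> \<exists>\<delta>>0. \<forall>u v. a \<le> u \<longrightarrow> u \<le> x \<longrightarrow> x \<le> v \<longrightarrow> v \<le> b \<longrightarrow>
        v - u < \<delta> \<longrightarrow> norm (D v - D u) \<le> \<epsilon> * (N v - N u)"
  shows "D b = D a"
proof -
  have le: "norm (D b - D a) \<le> \<epsilon> * (N b - N a)" if "\<epsilon> > 0" for \<epsilon>
    using \<open>a \<le> b\<close>
  proof (rule interval_bisection[where P = "\<lambda>u v. norm (D v - D u) \<le> \<epsilon> * (N v - N u)"])
    fix u v w assume "norm (D v - D u) \<le> \<epsilon> * (N v - N u)" "norm (D w - D v) \<le> \<epsilon> * (N w - N v)"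
    then show "norm (D w - D u) \<le> \<epsilon> * (N w - N u)"
      using norm_triangle_ineq[of "D w - D v" "D v - D u"] by (simp add: algebra_simps)
  qed (rule small[OF that])
  have "norm (D b - D a) \<le> 0 + e" if "e > 0" for e
  proof -
    define \<epsilon> where "\<epsilon> = e / (\<bar>N b - N a\<bar> + 1)"
    have "\<epsilon> > 0" using that by (simp add: \<epsilon>_def)
    have "norm (D b - D a) \<le> \<epsilon> * (N b - N a)" by (rule le) fact
    also have "\<dots> \<le> \<epsilon> * (\<bar>N b - N a\<bar> + 1)" using \<open>\<epsilon> > 0\<close> by (intro mult_left_mono) auto
    also have "\<dots> = e" by (simp add: \<epsilon>_def)
    finally show ?thesis by simp
  qed
  then have "norm (D b - D a) \<le> 0" by (rule field_le_epsilon)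
  then show ?thesis by simp
qed

text \<open>
Let \<open>E(r) = exp(4|N(r) - N(s)|)\<close>. On a short interval the largest value of \<open>E\<close> times the increment of \<open>N\<close> is at
most half the increment of \<open>E\<close>, so the growth of \<open>D\<close> telescopes to at most \<open>C/2\<close> times that of \<open>E\<close>. The gained factor
\<open>1/2\<close> is what makes Picard iteration contract and what yields Gronwall's inequality.
\<close>
lemma weighted_growth:
  fixes D x :: "real \<Rightarrow> 'e::real_normed_vector"
  assumes s: "s \<in> {a..b}" and t: "t \<in> {a..b}" and "D s = 0" and "C \<ge> 0"
    and N: "mono N" "continuous_on {a..b} N"
    and lip: "\<And>u v C. a \<le> u \<Longrightarrow> u \<le> v \<Longrightarrow> v \<le> b \<Longrightarrow> (\<And>r. r \<in> {u..v} \<Longrightarrow> norm (x r) \<le> C) \<Longrightarrow>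
               norm (D v - D u) \<le> C * (N v - N u)"
    and bound: "\<And>r. r \<in> {a..b} \<Longrightarrow> norm (x r) \<le> C * exp (4 * \<bar>N r - N s\<bar>)"
  shows "norm (D t) \<le> C / 2 * exp (4 * \<bar>N t - N s\<bar>)"
proof -
  define E where "E r = exp (4 * \<bar>N r - N s\<bar>)" for r
  have growth: "norm (D v - D u) \<le> C / 2 * \<bar>E v - E u\<bar>"
    if "a \<le> u" "u \<le> v" "v \<le> b" "v \<le> s \<or> s \<le> u" "4 * (N v - N u) \<le> ln 2" for u v
  proof -
    define h where "h = 4 * (N v - N u)"
    \<comment> \<open>The bound \<open>exp h \<le> 2\<close> gives \<open>exp h * (h / 4) \<le> h / 2 \<le> (exp h - 1) / 2\<close>, the telescoping estimate.\<close>
    have "h \<ge> 0" using N(1) \<open>u \<le> v\<close> by (simp add: h_def mono_def)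
    have "exp h \<le> 2" using that(5) by (metis h_def exp_le_cancel_iff exp_ln zero_less_numeral)
    have h_le: "h \<le> exp h - 1" by (subst le_diff_eq, subst add.commute, rule exp_ge_add_one_self)
    have small: "z * exp h * (h / 4) \<le> (z * exp h - z) / 2" if "z \<ge> 0" for z :: real
    proof -
      have "exp h * (h / 4) \<le> 2 * (h / 4)" using \<open>exp h \<le> 2\<close> \<open>h \<ge> 0\<close> by (intro mult_right_mono) auto
      also have "\<dots> \<le> (exp h - 1) / 2" using h_le by simp
      finally have "z * (exp h * (h / 4)) \<le> z * ((exp h - 1) / 2)" using that by (rule mult_left_mono)
      then show ?thesis by (simp add: algebra_simps)
    qed
    \<comment> \<open>The weight has its minimum over \<open>[u,v]\<close> at the end closer to \<open>s\<close>.\<close>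
    define y where "y = (if s \<le> u then E u else E v)"
    have "y \<ge> 0" by (simp add: y_def E_def)
    have "norm (x r) \<le> C * (y * exp h)" if "r \<in> {u..v}" for r
    proof -
      have "N u \<le> N r" "N r \<le> N v" using N(1) that by (auto simp: mono_def)
      moreover have "s \<le> u \<Longrightarrow> N s \<le> N u" "v \<le> s \<Longrightarrow> N v \<le> N s" using N(1) by (auto simp: mono_def)
      ultimately have "E r \<le> y * exp h"
        using \<open>v \<le> s \<or> s \<le> u\<close> by (auto simp: E_def y_def h_def simp flip: exp_add)
      then have "C * E r \<le> C * (y * exp h)" using \<open>C \<ge> 0\<close> by (rule mult_left_mono)
      then show ?thesis using bound[of r] that \<open>a \<le> u\<close> \<open>v \<le> b\<close> by (simp add: E_def)
    qed
    with lip[OF that(1-3)] have "norm (D v - D u) \<le> C * (y * exp h) * (N v - N u)" .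
    also have "\<dots> = C * (y * exp h * (h / 4))" by (simp add: h_def)
    also have "\<dots> \<le> C * ((y * exp h - y) / 2)" using small[OF \<open>y \<ge> 0\<close>] \<open>C \<ge> 0\<close> by (rule mult_left_mono)
    also have "y * exp h - y = \<bar>E v - E u\<bar>"
    proof -
      have "s \<le> u \<Longrightarrow> E v = E u * exp h \<and> E u \<le> E v" "v \<le> s \<Longrightarrow> E u = E v * exp h \<and> E v \<le> E u"
        using N(1) \<open>u \<le> v\<close> by (auto simp: E_def h_def mono_def abs_if not_less simp flip: exp_add)
          (smt (verit) order_trans)+
      then show ?thesis using \<open>v \<le> s \<or> s \<le> u\<close> by (auto simp: y_def)
    qed
    finally show ?thesis by simp
  qed
  have local: "\<exists>\<delta>>0. \<forall>u v. p \<le> u \<longrightarrow> u \<le> y \<longrightarrow> y \<le> v \<longrightarrow> v \<le> q \<longrightarrow> v - u < \<delta> \<longrightarrow>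
         norm (D v - D u) \<le> C / 2 * \<bar>E v - E u\<bar>"
    if "a \<le> p" "p \<le> y" "y \<le> q" "q \<le> b" "q \<le> s \<or> s \<le> p" for p q y
  proof -
    have "y \<in> {a..b}" using that by auto
    then obtain \<delta> where \<delta>: "\<delta> > 0" "\<And>r. r \<in> {a..b} \<Longrightarrow> dist r y < \<delta> \<Longrightarrow> dist (N r) (N y) < ln 2 / 8"
      using N(2)[unfolded continuous_on_iff, rule_format, of y "ln 2 / 8"] by auto
    have "norm (D v - D u) \<le> C / 2 * \<bar>E v - E u\<bar>" if "p \<le> u" "u \<le> y" "y \<le> v" "v \<le> q" "v - u < \<delta>" for u v
    proof (rule growth)
      have "\<bar>N u - N y\<bar> < ln 2 / 8" "\<bar>N v - N y\<bar> < ln 2 / 8"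
        using \<delta>(2)[of u] \<delta>(2)[of v] that \<open>a \<le> p\<close> \<open>q \<le> b\<close> by (auto simp: dist_real_def)
      then show "4 * (N v - N u) \<le> ln 2" by argo
    qed (use that \<open>a \<le> p\<close> \<open>q \<le> b\<close> \<open>q \<le> s \<or> s \<le> p\<close> in auto)
    with \<delta>(1) show ?thesis by (intro exI[of _ \<delta>] conjI allI impI)
  qed
  have E1: "E r \<ge> 1" "E s = 1" for r by (auto simp: E_def)
  have glue: "norm (D w - D u) \<le> C / 2 * \<bar>E w - E u\<bar>"
    if "norm (D v - D u) \<le> C / 2 * \<bar>E v - E u\<bar>" "norm (D w - D v) \<le> C / 2 * \<bar>E w - E v\<bar>"
      and E: "\<bar>E w - E u\<bar> = \<bar>E w - E v\<bar> + \<bar>E v - E u\<bar>" for u v w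
    using that norm_triangle_ineq[of "D w - D v" "D v - D u"] unfolding E by (simp add: distrib_left)
  have "norm (D t) \<le> C / 2 * \<bar>E t - E s\<bar>"
  proof (cases "s \<le> t")
    case True
    have E: "\<bar>E v - E u\<bar> = E v - E u" if "s \<le> u" "u \<le> v" for u v
      using monoD[OF N(1) that(1)] monoD[OF N(1) that(2)] by (simp add: E_def)
    have "norm (D t - D s) \<le> C / 2 * \<bar>E t - E s\<bar>"
      using True
    proof (rule interval_bisection[where P = "\<lambda>u v. norm (D v - D u) \<le> C / 2 * \<bar>E v - E u\<bar>"])
      show "norm (D w - D u) \<le> C / 2 * \<bar>E w - E u\<bar>" if "s \<le> u" "u \<le> v" "v \<le> w"
        "norm (D v - D u) \<le> C / 2 * \<bar>E v - E u\<bar>" "norm (D w - D v) \<le> C / 2 * \<bar>E w - E v\<bar>" for u v w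
        by (rule glue[OF that(4,5)]) (use that(1-3) in \<open>simp add: E\<close>)
    qed (rule local, use s t in auto)
    then show ?thesis using \<open>D s = 0\<close> by simp
  next
    case False
    then have "t \<le> s" by simp
    have E: "\<bar>E v - E u\<bar> = E u - E v" if "v \<le> s" "u \<le> v" for u v
      using monoD[OF N(1) that(1)] monoD[OF N(1) that(2)] by (simp add: E_def)
    have "norm (D s - D t) \<le> C / 2 * \<bar>E s - E t\<bar>"
      using \<open>t \<le> s\<close>
    proof (rule interval_bisection[where P = "\<lambda>u v. norm (D v - D u) \<le> C / 2 * \<bar>E v - E u\<bar>"])
      show "norm (D w - D u) \<le> C / 2 * \<bar>E w - E u\<bar>" if "u \<le> v" "v \<le> w" "w \<le> s"
        "norm (D v - D u) \<le> C / 2 * \<bar>E v - E u\<bar>" "norm (D w - D v) \<le> C / 2 * \<bar>E w - E v\<bar>" for u v w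
        by (rule glue[OF that(4,5)]) (use that(1-3) in \<open>simp add: E\<close>)
    qed (rule local, use s t in auto)
    then show ?thesis using \<open>D s = 0\<close> by (simp add: abs_minus_commute)
  qed
  also have "\<dots> \<le> C / 2 * E t" using E1 \<open>C \<ge> 0\<close> by (intro mult_left_mono) auto
  finally show ?thesis by (simp add: E_def)
qed

text \<open>
The contraction principle for a weighted supremum norm that may be infinite: only the first step of the
iteration has to be finite, and \<open>Adm\<close> is any class of functions closed under convergence in this norm.
\<close>
lemma weighted_fixed_point:
  fixes T :: "('i \<Rightarrow> 'e::banach) \<Rightarrow> 'i \<Rightarrow> 'e"
  assumes w: "\<And>i. w i \<ge> 0"
    and T: "\<And>x. Adm x \<Longrightarrow> Adm (T x)"
    and closed: "\<And>X x. (\<And>n::nat. Adm (X n)) \<Longrightarrow>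
        (\<And>\<epsilon>. \<epsilon> > 0 \<Longrightarrow> \<exists>n. \<forall>i. norm (X n i - x i) \<le> \<epsilon> * w i) \<Longrightarrow> Adm x"
    and contr: "\<And>x y C i. Adm x \<Longrightarrow> Adm y \<Longrightarrow> C \<ge> 0 \<Longrightarrow> (\<And>i. norm (x i - y i) \<le> C * w i) \<Longrightarrow>
        norm (T x i - T y i) \<le> C / 2 * w i"
    and start: "Adm z" "C \<ge> 0" "\<And>i. norm (T z i - z i) \<le> C * w i"
  shows "\<exists>x. Adm x \<and> T x = x"
proof -
  define X where "X n = (T ^^ n) z" for n
  have X[simp]: "X 0 = z" "X (Suc n) = T (X n)" for n by (auto simp: X_def)
  have AdmX: "Adm (X n)" for n by (induction n) (auto intro: T start)
  have step: "norm (X (Suc n) i - X n i) \<le> C / 2 ^ n * w i" for n i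
  proof (induction n arbitrary: i)
    case 0 then show ?case using start by simp
  next
    case (Suc n)
    have "norm (T (X (Suc n)) i - T (X n) i) \<le> C / 2 ^ n / 2 * w i"
      by (rule contr[OF AdmX AdmX _ Suc]) (use start in auto)
    then show ?case by (simp add: field_simps)
  qed
  have dist: "norm (X (n + k) i - X n i) \<le> 2 * C / 2 ^ n * w i" for n k i
  proof -
    have "norm (X (n + k) i - X n i) \<le> 2 * C / 2 ^ n * w i - 2 * C / 2 ^ (n + k) * w i"
    proof (induction k)
      case (Suc k)
      have "norm (X (n + Suc k) i - X n i) \<le> norm (X (Suc (n + k)) i - X (n + k) i) + norm (X (n + k) i - X n i)"
        using norm_triangle_ineq[of "X (Suc (n + k)) i - X (n + k) i" "X (n + k) i - X n i"] by simp
      moreover have "2 * C / 2 ^ (n + k) * w i = 2 * (C / 2 ^ (n + k) * w i)"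
          "2 * C / 2 ^ (n + Suc k) * w i = C / 2 ^ (n + k) * w i" by simp_all
      ultimately show ?case using step[of "n + k" i] Suc by linarith
    qed simp
    also have "\<dots> \<le> 2 * C / 2 ^ n * w i" using start(2) w by simp
    finally show ?thesis .
  qed
  have small: "(\<lambda>n. 2 * c / 2 ^ n) \<longlonglongrightarrow> 0" for c :: real
    using tendsto_mult[OF tendsto_const[of "2 * c"] LIMSEQ_power_zero[of "1/2::real"]]
    by (simp add: power_one_over divide_simps)
  have "Cauchy (\<lambda>n. X n i)" for i
  proof (rule metric_CauchyI)
    fix e :: real assume "e > 0"
    then have "\<forall>\<^sub>F n in sequentially. norm (2 * (C * w i) / 2 ^ n) < e / 2"
      using tendstoD[OF small[of "C * w i"], of "e/2"] by (simp add: dist_norm)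
    then obtain n where n: "norm (2 * (C * w i) / 2 ^ n) < e / 2" by (auto simp: eventually_sequentially)
    have "dist (X p i) (X q i) < e" if "p \<ge> n" "q \<ge> n" for p q
    proof -
      have "2 * C / 2 ^ n * w i < e / 2"
        using order_le_less_trans[OF abs_ge_self n[unfolded real_norm_def]] by (simp add: mult_ac)
      then have "norm (X p i - X n i) < e / 2" "norm (X q i - X n i) < e / 2"
        using dist[of n "p - n" i] dist[of n "q - n" i] that by auto
      then show ?thesis using dist_triangle_half_l[of "X p i" "X n i" e "X q i"] by (simp add: dist_norm)
    qed
    then show "\<exists>n. \<forall>p\<ge>n. \<forall>q\<ge>n. dist (X p i) (X q i) < e" by blast
  qed
  then have "\<forall>i. \<exists>l. (\<lambda>n. X n i) \<longlonglongrightarrow> l" using Cauchy_convergent_iff convergent_def by blast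
  then obtain x where x: "\<And>i. (\<lambda>n. X n i) \<longlonglongrightarrow> x i" by metis
  have lim: "norm (x i - X n i) \<le> 2 * C / 2 ^ n * w i" for n i
  proof (rule tendsto_upperbound)
    show "((\<lambda>k. norm (X (n + k) i - X n i)) \<longlongrightarrow> norm (x i - X n i)) sequentially"
      using LIMSEQ_ignore_initial_segment[OF x[of i], of n]
      by (intro tendsto_intros) (simp add: add.commute)
    show "\<forall>\<^sub>F k in sequentially. norm (X (n + k) i - X n i) \<le> 2 * C / 2 ^ n * w i"
      by (intro always_eventually allI dist)
  qed simp
  have "Adm x"
  proof (rule closed[OF AdmX])
    fix \<epsilon> :: real assume "\<epsilon> > 0"
    then obtain n where n: "norm (2 * C / 2 ^ n) < \<epsilon>"
      using tendstoD[OF small[of C], of \<epsilon>] by (auto simp: dist_norm eventually_sequentially)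
    have "norm (X n i - x i) \<le> \<epsilon> * w i" for i
    proof -
      have "2 * C / 2 ^ n * w i \<le> \<epsilon> * w i"
        using order_le_less_trans[OF abs_ge_self n[unfolded real_norm_def]] w by (intro mult_right_mono) auto
      then show ?thesis using lim[of i n] by (simp add: norm_minus_commute)
    qed
    then show "\<exists>n. \<forall>i. norm (X n i - x i) \<le> \<epsilon> * w i" by blast
  qed
  moreover have "T x i = x i" for i
  proof -
    have "norm (T x i - x i) \<le> 2 * (C * w i) / 2 ^ n" for n
    proof -
      have "norm (T x i - T (X n) i) \<le> 2 * C / 2 ^ n / 2 * w i"
        by (rule contr[OF \<open>Adm x\<close> AdmX _ lim]) (use start in auto)
      then have "norm (T x i - T (X n) i) \<le> C * w i / 2 ^ n" by simp
      moreover have "norm (x i - T (X n) i) \<le> C * w i / 2 ^ n" using lim[of i "Suc n"] by simp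
      moreover have "2 * (C * w i) / 2 ^ n = C * w i / 2 ^ n + C * w i / 2 ^ n" by simp
      moreover have "norm (T x i - x i) \<le> norm (T x i - T (X n) i) + norm (x i - T (X n) i)"
        using norm_triangle_ineq4[of "T x i - T (X n) i" "x i - T (X n) i"] by simp
      ultimately show ?thesis by linarith
    qed
    then have "norm (T x i - x i) \<le> 0" by (intro tendsto_lowerbound[OF small[of "C * w i"]] always_eventually allI) auto
    then show ?thesis by simp
  qed
  ultimately show ?thesis by blast
qed

lemma primitive_continuous_on:
  fixes g :: "real \<Rightarrow> 'e::banach"
  assumes g: "g integrable_on {a..b}"
    and G: "\<And>u v. a \<le> u \<Longrightarrow> u \<le> v \<Longrightarrow> v \<le> b \<Longrightarrow> G v - G u = integral {u..v} g"
  shows "continuous_on {a..b} G"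
proof -
  have "continuous_on {a..b} (\<lambda>t. G a + integral {a..t} g)"
    by (intro continuous_intros indefinite_integral_continuous_1 g)
  then show ?thesis
  proof (rule continuous_on_eq)
    show "G a + integral {a..t} g = G t" if "t \<in> {a..b}" for t
      using that by (subst G[symmetric]) auto
  qed
qed

lemma continuous_on_UNIV_if_intervals:
  fixes G :: "real \<Rightarrow> 'e::topological_space"
  assumes "\<And>a b. a < b \<Longrightarrow> continuous_on {a..b} G"
  shows "continuous_on UNIV G"
  unfolding continuous_on_eq_continuous_at[OF open_UNIV]
proof
  fix t show "isCont G t"
    by (rule continuous_on_interior[OF assms[of "t - 1" "t + 1"]]) auto
qed

text \<open>
A function within every \<open>e\<close> of continuous functions is continuous; this gives closedness in the
applications of \<open>weighted_fixed_point\<close>.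
\<close>
lemma continuous_on_approximable:
  fixes x :: "real \<Rightarrow> 'e::metric_space"
  assumes approx: "\<And>e. e > 0 \<Longrightarrow> \<exists>g. continuous_on S g \<and> (\<forall>t\<in>S. dist (g t) (x t) \<le> e)"
  shows "continuous_on S x"
  unfolding continuous_on_iff
proof (intro ballI allI impI)
  fix t and e :: real assume t: "t \<in> S" and "e > 0"
  then have "e / 3 > 0" by simp
  from approx[OF this] obtain g where g: "continuous_on S g" "\<forall>t\<in>S. dist (g t) (x t) \<le> e / 3"
    by (elim exE conjE)
  obtain \<delta> where \<delta>: "\<delta> > 0" "\<And>r. r \<in> S \<Longrightarrow> dist r t < \<delta> \<Longrightarrow> dist (g r) (g t) < e / 3"
    using g(1)[unfolded continuous_on_iff, rule_format, OF t \<open>e / 3 > 0\<close>] by auto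
  have "dist (x r) (x t) < e" if "r \<in> S" "dist r t < \<delta>" for r
  proof -
    have "dist (x r) (x t) \<le> dist (g r) (x r) + dist (g r) (g t) + dist (g t) (x t)"
      using dist_triangle[of "x r" "x t" "g r"] dist_triangle[of "g r" "x t" "g t"] by (simp add: dist_commute)
    then show ?thesis using g(2)[rule_format, OF that(1)] g(2)[rule_format, OF t] \<delta>(2)[OF that] by argo
  qed
  with \<delta>(1) show "\<exists>\<delta>>0. \<forall>r\<in>S. dist r t < \<delta> \<longrightarrow> dist (x r) (x t) < e"
    by (intro exI[of _ \<delta>] conjI ballI impI)
qed

lemma primitive_exists:
  fixes g :: "real \<Rightarrow> 'e::banach"
  assumes g: "\<And>u v. u \<le> v \<Longrightarrow> g integrable_on {u..v}"
  shows "\<exists>G. G s = c \<and> continuous_on UNIV G \<and> (\<forall>u v. u \<le> v \<longrightarrow> G v - G u = integral {u..v} g)"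
proof -
  define G where "G t = c + (if s \<le> t then integral {s..t} g else - integral {t..s} g)" for t
  have G: "G v - G u = integral {u..v} g" if "u \<le> v" for u v
  proof -
    note comb = Henstock_Kurzweil_Integration.integral_combine[OF _ _ g]
    consider "s \<le> u" | "u < s" "s \<le> v" | "v < s" by linarith
    then show ?thesis
    proof cases
      case 1
      then show ?thesis using comb[of s u v] that by (simp add: G_def algebra_simps)
    next
      case 2
      then show ?thesis using comb[of u s v] that by (simp add: G_def add.commute)
    next
      case 3
      then show ?thesis using comb[of u v s] that by (simp add: G_def algebra_simps)
    qed
  qed
  moreover have "continuous_on UNIV G"
    using G g by (intro continuous_on_UNIV_if_intervals primitive_continuous_on) auto
  moreover have "G s = c" by (simp add: G_def)
  ultimately show ?thesis by (intro exI[of _ G] conjI allI impI)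
qed

section \<open>Integral equations with a Lipschitz right-hand side\<close>

text \<open>
The equation \<open>y(v) - y(u) = \<integral>\<^bsub>[u,v]\<^esub> F(r, y(r)) dr\<close>. The Lipschitz condition is imposed on integrals and not pointwise,
since for \<open>F(r,x) = A(r)x\<close> only the integral estimate is available.
\<close>
locale lipschitz_field =
  fixes F :: "real \<Rightarrow> 'e::banach \<Rightarrow> 'e" and N :: "real \<Rightarrow> real"
  assumes mono_N: "mono N" and cont_N: "continuous_on UNIV N"
    and F_integrable: "u \<le> v \<Longrightarrow> continuous_on {u..v} y \<Longrightarrow> (\<lambda>r. F r (y r)) integrable_on {u..v}"
    and F_lipschitz: "u \<le> v \<Longrightarrow> continuous_on {u..v} y \<Longrightarrow> continuous_on {u..v} z \<Longrightarrow>
       (\<And>r. r \<in> {u..v} \<Longrightarrow> norm (y r - z r) \<le> C) \<Longrightarrow>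
       norm (integral {u..v} (\<lambda>r. F r (y r)) - integral {u..v} (\<lambda>r. F r (z r))) \<le> C * (N v - N u)"
    and F_zero: "F r 0 = 0"
begin

text \<open>
Let \<open>C\<close> be the maximum of \<open>\<parallel>y - z\<parallel>\<close> relative to the weight. By \<open>weighted_growth\<close>, \<open>y - z\<close> differs from its value
at \<open>s\<close> by at most \<open>C/2\<close> times the weight, so \<open>C \<le> \<parallel>y(s) - z(s)\<parallel> + C/2\<close>.
\<close>
lemma gronwall:
  assumes s: "s \<in> {a..b}" and t: "t \<in> {a..b}"
    and y: "continuous_on {a..b} y" "\<And>u v. a \<le> u \<Longrightarrow> u \<le> v \<Longrightarrow> v \<le> b \<Longrightarrow> y v - y u = integral {u..v} (\<lambda>r. F r (y r))"
    and z: "continuous_on {a..b} z" "\<And>u v. a \<le> u \<Longrightarrow> u \<le> v \<Longrightarrow> v \<le> b \<Longrightarrow> z v - z u = integral {u..v} (\<lambda>r. F r (z r))"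
  shows "norm (y t - z t) \<le> 2 * exp (4 * \<bar>N t - N s\<bar>) * norm (y s - z s)"
proof -
  define w where "w r = exp (4 * \<bar>N r - N s\<bar>)" for r
  have N: "continuous_on {a..b} N" using cont_N continuous_on_subset by blast
  have w1: "w r \<ge> 1" for r by (simp add: w_def)
  have "continuous_on {a..b} (\<lambda>r. norm (y r - z r) / w r)"
    unfolding w_def by (intro continuous_intros y z N) auto
  then obtain r0 where r0: "r0 \<in> {a..b}" "\<And>r. r \<in> {a..b} \<Longrightarrow> norm (y r - z r) / w r \<le> norm (y r0 - z r0) / w r0"
    using continuous_attains_sup[of "{a..b}" "\<lambda>r. norm (y r - z r) / w r"] s by auto
  define C where "C = norm (y r0 - z r0) / w r0"
  have "C \<ge> 0" using w1[of r0] by (simp add: C_def)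
  have C: "norm (y r - z r) \<le> C * w r" if "r \<in> {a..b}" for r
  proof -
    have "norm (y r - z r) / w r \<le> C" using r0(2)[OF that] by (simp add: C_def)
    then show ?thesis using w1[of r] by (simp add: pos_divide_le_eq)
  qed
  define D where "D r = (y r - z r) - (y s - z s)" for r
  have D: "norm (D r) \<le> C / 2 * w r" if "r \<in> {a..b}" for r
    unfolding w_def
  proof (rule weighted_growth[OF s that _ \<open>C \<ge> 0\<close> mono_N N])
    show "D s = 0" by (simp add: D_def)
    show "norm (y r - z r) \<le> C * exp (4 * \<bar>N r - N s\<bar>)" if "r \<in> {a..b}" for r
      using C[OF that] by (simp add: w_def)
    show "norm (D v - D u) \<le> C' * (N v - N u)"
      if uv: "a \<le> u" "u \<le> v" "v \<le> b" and C': "\<And>r. r \<in> {u..v} \<Longrightarrow> norm (y r - z r) \<le> C'" for u v C'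
    proof -
      have sub: "{u..v} \<subseteq> {a..b}" using uv by auto
      have "D v - D u = (y v - y u) - (z v - z u)" by (simp add: D_def)
      then show ?thesis
        using F_lipschitz[OF uv(2) continuous_on_subset[OF y(1) sub] continuous_on_subset[OF z(1) sub] C']
          y(2)[OF uv] z(2)[OF uv] by simp
    qed
  qed
  have "norm (y r - z r) \<le> norm (y s - z s) + norm (D r)" for r
    using norm_triangle_ineq[of "y s - z s" "D r"] by (simp add: D_def)
  from order_trans[OF this[of r0] add_left_mono[OF D[OF r0(1)]]]
  have "C * w r0 \<le> 2 * norm (y s - z s)" using w1[of r0] by (simp add: C_def)
  moreover have "C * 1 \<le> C * w r0" using \<open>C \<ge> 0\<close> w1 by (intro mult_left_mono) auto
  ultimately have "C \<le> 2 * norm (y s - z s)" by simp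
  then have "C * w t \<le> 2 * norm (y s - z s) * w t" using w1[of t] by (intro mult_right_mono) auto
  from order_trans[OF C[OF t] this] show ?thesis by (simp add: w_def mult_ac)
qed

lemma solution_unique:
  assumes "s \<in> {a..b}" "t \<in> {a..b}" "y s = z s"
    and "continuous_on {a..b} y" "\<And>u v. a \<le> u \<Longrightarrow> u \<le> v \<Longrightarrow> v \<le> b \<Longrightarrow> y v - y u = integral {u..v} (\<lambda>r. F r (y r))"
    and "continuous_on {a..b} z" "\<And>u v. a \<le> u \<Longrightarrow> u \<le> v \<Longrightarrow> v \<le> b \<Longrightarrow> z v - z u = integral {u..v} (\<lambda>r. F r (z r))"
  shows "y t = z t"
  using gronwall[OF assms(1,2,4-7)] assms(3) by simp

lemma solution_exists:
  "\<exists>y. y s = \<xi> \<and> continuous_on UNIV y \<and> (\<forall>u v. u \<le> v \<longrightarrow> y v - y u = integral {u..v} (\<lambda>r. F r (y r)))"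
proof -
  define w where "w r = exp (4 * \<bar>N r - N s\<bar>)" for r
  have w1: "w r \<ge> 1" for r by (simp add: w_def)
  have N: "continuous_on S N" for S using cont_N continuous_on_subset by blast
  have int: "(\<lambda>r. F r (y r)) integrable_on {u..v}" if "continuous_on UNIV y" "u \<le> v" for y u v
    using F_integrable that continuous_on_subset by blast
  have "\<forall>y. \<exists>G. continuous_on UNIV y \<longrightarrow> G s = \<xi> \<and> continuous_on UNIV G \<and>
      (\<forall>u v. u \<le> v \<longrightarrow> G v - G u = integral {u..v} (\<lambda>r. F r (y r)))"
    using primitive_exists[OF int] by blast
  then obtain T where T: "\<And>y. continuous_on UNIV y \<Longrightarrow> T y s = \<xi>"
      "\<And>y. continuous_on UNIV y \<Longrightarrow> continuous_on UNIV (T y)"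
      "\<And>y u v. continuous_on UNIV y \<Longrightarrow> u \<le> v \<Longrightarrow> T y v - T y u = integral {u..v} (\<lambda>r. F r (y r))"
    by metis
  have contr: "norm (T y t - T z t) \<le> C / 2 * w t"
    if y: "continuous_on UNIV y" and z: "continuous_on UNIV z" and "C \<ge> 0"
      and C: "\<And>r. norm (y r - z r) \<le> C * w r" for y z C t
    unfolding w_def
  proof (rule weighted_growth[where D = "\<lambda>t. T y t - T z t" and x = "\<lambda>r. y r - z r"
          and a = "min s t" and b = "max s t"])
    show "norm (T y v - T z v - (T y u - T z u)) \<le> C' * (N v - N u)"
      if uv: "u \<le> v" and C': "\<And>r. r \<in> {u..v} \<Longrightarrow> norm (y r - z r) \<le> C'" for u v C'
    proof -
      have "T y v - T z v - (T y u - T z u) = (T y v - T y u) - (T z v - T z u)" by simp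
      then show ?thesis
        using F_lipschitz[OF uv continuous_on_subset[OF y] continuous_on_subset[OF z] C']
          T(3)[OF y uv] T(3)[OF z uv] by simp
    qed
  qed (use T(1)[OF y] T(1)[OF z] \<open>C \<ge> 0\<close> mono_N N C[unfolded w_def] in auto)
  have "\<exists>y. continuous_on UNIV y \<and> T y = y"
  proof (rule weighted_fixed_point[where z = "\<lambda>_. \<xi>" and C = "norm \<xi>" and w = w])
    show "continuous_on UNIV x"
      if X: "\<And>n::nat. continuous_on UNIV (X n)"
        and lim: "\<And>\<epsilon>. \<epsilon> > 0 \<Longrightarrow> \<exists>n. \<forall>i. norm (X n i - x i) \<le> \<epsilon> * w i" for X and x :: "real \<Rightarrow> 'e"
    proof (intro continuous_on_UNIV_if_intervals continuous_on_approximable)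
      fix a b e :: real assume "a < b" "e > 0"
      have "continuous_on {a..b} w" unfolding w_def by (intro continuous_intros N)
      then obtain r0 where r0: "\<forall>r\<in>{a..b}. w r \<le> w r0"
        using continuous_attains_sup[of "{a..b}" w] \<open>a < b\<close> by auto
      obtain n where n: "\<And>i. norm (X n i - x i) \<le> e / w r0 * w i"
        using lim[of "e / w r0"] w1[of r0] \<open>e > 0\<close> by auto
      have "dist (X n i) (x i) \<le> e" if "i \<in> {a..b}" for i
      proof -
        have "e / w r0 * w i \<le> e / w r0 * w r0"
          using r0 that \<open>e > 0\<close> w1[of r0] by (intro mult_left_mono) auto
        also have "\<dots> = e" using w1[of r0] by simp
        finally have "e / w r0 * w i \<le> e" .
        from order_trans[OF n[of i] this] show ?thesis by (simp only: dist_norm)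
      qed
      moreover have "continuous_on {a..b} (X n)" using X[of n] by (rule continuous_on_subset) simp
      ultimately show "\<exists>g. continuous_on {a..b} g \<and> (\<forall>t\<in>{a..b}. dist (g t) (x t) \<le> e)"
        by (intro exI[of _ "X n"] conjI ballI)
    qed
    show "norm (T (\<lambda>_. \<xi>) t - \<xi>) \<le> norm \<xi> * w t" for t
    proof -
      let ?c = "\<lambda>_::real. \<xi>" and ?z = "\<lambda>_::real. 0 :: 'e"
      have "norm (T ?c t - T ?z t) \<le> norm \<xi> / 2 * w t"
        using mult_left_mono[OF w1 norm_ge_zero[of \<xi>]] by (intro contr) simp_all
      moreover have "T ?z t = \<xi>"
        using T(3)[of ?z s t] T(3)[of ?z t s] T(1)[of ?z] by (cases "s \<le> t") (auto simp: F_zero)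
      moreover have "norm \<xi> / 2 * w t \<le> norm \<xi> * w t"
        using w1[of t] by (intro mult_right_mono) auto
      ultimately show ?thesis by simp
    qed
    show "w i \<ge> 0" for i using w1[of i] by simp
    show "continuous_on UNIV (T x)" if "continuous_on UNIV x" for x by (rule T(2)[OF that])
    show "norm (T x i - T y i) \<le> C / 2 * w i" if "continuous_on UNIV x" "continuous_on UNIV y" "0 \<le> C"
      "\<And>i. norm (x i - y i) \<le> C * w i" for x y C i by (rule contr[OF that])
  qed simp_all
  then obtain y where y: "continuous_on UNIV y" "T y = y" by (elim exE conjE)
  have "y s = \<xi>" using T(1)[OF y(1)] by (simp only: y(2))
  moreover have "y v - y u = integral {u..v} (\<lambda>r. F r (y r))" if "u \<le> v" for u v
    using T(3)[OF y(1) that] by (simp only: y(2))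
  ultimately show ?thesis using y(1) by (intro exI[of _ y] conjI allI impI)
qed

end

section \<open>The evolution operators without impulses\<close>

lemma lipschitz_field_product:
  fixes A :: "real \<Rightarrow> 'p::banach" and prod :: "'p \<Rightarrow> 'q::banach \<Rightarrow> 'q"
  assumes bilinear: "bounded_bilinear prod"
    and contractive: "\<And>p q. norm (prod p q) \<le> norm p * norm q"
    and A: "\<And>u v. u \<le> v \<Longrightarrow> A integrable_on {u..v}"
    and N: "mono N" "continuous_on UNIV N" "\<And>u v. u \<le> v \<Longrightarrow> norm (integral {u..v} A) \<le> N v - N u"
  shows "lipschitz_field (\<lambda>r. prod (A r)) N"
proof
  interpret bounded_bilinear prod by (rule bilinear)
  show int: "(\<lambda>r. prod (A r) (y r)) integrable_on {u..v}" if "u \<le> v" "continuous_on {u..v} y" for u v y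
    by (rule product_integral(1)[OF bilinear contractive A[OF that(1)] that(1) N(3) that(2)])
  show "norm (integral {u..v} (\<lambda>r. prod (A r) (y r)) - integral {u..v} (\<lambda>r. prod (A r) (z r))) \<le> C * (N v - N u)"
    if "u \<le> v" "continuous_on {u..v} y" "continuous_on {u..v} z" "\<And>r. r \<in> {u..v} \<Longrightarrow> norm (y r - z r) \<le> C" for u v y z C
  proof -
    have "integral {u..v} (\<lambda>r. prod (A r) (y r)) - integral {u..v} (\<lambda>r. prod (A r) (z r))
        = integral {u..v} (\<lambda>r. prod (A r) (y r - z r))"
      using integral_diff[OF int[OF that(1,2)] int[OF that(1,3)]] by (simp add: diff_right)
    then show ?thesis
      using product_integral(2)[OF bilinear contractive A[OF that(1)] that(1) N(3), of "\<lambda>r. y r - z r" C]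
      by (simp add: that continuous_on_diff)
  qed
qed (use N in \<open>auto simp: bounded_bilinear.zero_right[OF bilinear]\<close>)

text \<open>
The data of the linear equation. The parameter \<open>N\<close> stands for a primitive of the scalar majorant of \<open>A\<close>.
\<close>
locale impulsive_system =
  fixes A :: "real \<Rightarrow> 'a::banach \<Rightarrow>\<^sub>L 'a" and B :: "int \<Rightarrow> 'a \<Rightarrow>\<^sub>L 'a" and \<tau> :: "int \<Rightarrow> real" and N :: "real \<Rightarrow> real"
  assumes times: "impulse_times \<tau>"
    and A_integrable: "u \<le> v \<Longrightarrow> A integrable_on {u..v}"
    and mono_N: "mono N" and cont_N: "continuous_on UNIV N"
    and A_bound: "u \<le> v \<Longrightarrow> norm (integral {u..v} A) \<le> N v - N u"
    and jump_invertible: "\<exists>R. R o\<^sub>L (id_blinfun + B i) = id_blinfun \<and> (id_blinfun + B i) o\<^sub>L R = id_blinfun"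
begin

sublocale vec: lipschitz_field "\<lambda>r. blinfun_apply (A r)" N
  by (rule lipschitz_field_product[OF bounded_bilinear_blinfun_apply norm_blinfun A_integrable mono_N cont_N A_bound])

sublocale op: lipschitz_field "\<lambda>r. (o\<^sub>L) (A r)" N
  by (rule lipschitz_field_product[OF bounded_bilinear_blinfun_compose norm_blinfun_compose A_integrable mono_N cont_N A_bound])

text \<open>
\<open>U s t\<close> is the evolution operator from \<open>s\<close> to \<open>t\<close> of the equation without impulses; it is constructed as an
operator-valued solution of \<open>Y' = AY\<close>, which gives linearity and norm continuity at once.
\<close>
definition U :: "real \<Rightarrow> real \<Rightarrow> 'a \<Rightarrow>\<^sub>L 'a" where
  "U s = (SOME Y. Y s = id_blinfun \<and> continuous_on UNIV Y \<and>
     (\<forall>u v. u \<le> v \<longrightarrow> Y v - Y u = integral {u..v} (\<lambda>r. A r o\<^sub>L Y r)))"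

lemma U: "U s s = id_blinfun" "continuous_on UNIV (U s)"
    "u \<le> v \<Longrightarrow> U s v - U s u = integral {u..v} (\<lambda>r. A r o\<^sub>L U s r)"
  using someI_ex[OF op.solution_exists[of s id_blinfun]] unfolding U_def[symmetric] by simp_all

lemma U_continuous_on: "continuous_on S (U s)"
  using U(2) continuous_on_subset by blast

text \<open>
Both sides solve the operator equation in \<open>t\<close> and agree at \<open>t = s\<close>. In particular each \<open>U s t\<close> is invertible.
\<close>
lemma U_cocycle: "U s t o\<^sub>L U p s = U p t"
proof (rule op.solution_unique[of s "min s t" "max s t" t])
  show "U s s o\<^sub>L U p s = U p s" by (simp add: U(1) blinfun_eqI)
  show "continuous_on {min s t..max s t} (\<lambda>r. U s r o\<^sub>L U p s)"
    by (intro bounded_bilinear.continuous_on[OF bounded_bilinear_blinfun_compose] U_continuous_on continuous_on_const)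
  show "(U s v o\<^sub>L U p s) - (U s u o\<^sub>L U p s) = integral {u..v} (\<lambda>r. A r o\<^sub>L (U s r o\<^sub>L U p s))" if "u \<le> v" for u v
  proof -
    have lin: "bounded_linear (\<lambda>X. X o\<^sub>L U p s)"
      by (rule bounded_bilinear.bounded_linear_left[OF bounded_bilinear_blinfun_compose])
    have "(U s v o\<^sub>L U p s) - (U s u o\<^sub>L U p s) = (U s v - U s u) o\<^sub>L U p s"
      by (rule blinfun_eqI) (simp add: blinfun.diff_left)
    also have "\<dots> = integral {u..v} ((\<lambda>X. X o\<^sub>L U p s) \<circ> (\<lambda>r. A r o\<^sub>L U s r))"
      unfolding U(3)[OF that]
      by (rule integral_linear[symmetric, OF op.F_integrable[OF that U_continuous_on] lin])
    also have "\<dots> = integral {u..v} (\<lambda>r. A r o\<^sub>L (U s r o\<^sub>L U p s))"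
      by (intro integral_cong blinfun_eqI) simp
    finally show ?thesis .
  qed
qed (use U U_continuous_on in auto)

abbreviation "flow t \<equiv> U 0 t"
abbreviation "flowinv t \<equiv> U t 0"

lemma flow_inverse: "flow t o\<^sub>L flowinv t = id_blinfun" "flowinv t o\<^sub>L flow t = id_blinfun"
  by (simp_all add: U_cocycle U(1))

lemma flow_inverse_apply[simp]: "flow t (flowinv t x) = x" "flowinv t (flow t x) = x"
  using flow_inverse[of t] by (metis blinfun_apply_blinfun_compose blinfun_apply_id_blinfun id_apply)+

lemma norm_U: "norm (U s t) \<le> 2 * exp (4 * \<bar>N t - N s\<bar>)"
proof -
  have "norm (U s t - 0) \<le> 2 * exp (4 * \<bar>N t - N s\<bar>) * norm (U s s - 0)"
    by (rule op.gronwall[of s "min s t" "max s t"]) (auto simp: U_continuous_on U(3))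
  also have "\<dots> \<le> 2 * exp (4 * \<bar>N t - N s\<bar>) * 1"
    using norm_blinfun_id_le by (intro mult_left_mono) (auto simp: U(1))
  finally show ?thesis by simp
qed

lemma flow_increment:
  assumes "u \<le> v" shows "flow v x - flow u x = integral {u..v} (\<lambda>r. A r (flow r x))"
proof -
  have lin: "bounded_linear (\<lambda>X. blinfun_apply X x)"
    by (rule bounded_bilinear.bounded_linear_left[OF bounded_bilinear_blinfun_apply])
  have "flow v x - flow u x = (flow v - flow u) x" by (simp add: blinfun.diff_left)
  also have "\<dots> = integral {u..v} ((\<lambda>X. blinfun_apply X x) \<circ> (\<lambda>r. A r o\<^sub>L flow r))"
    unfolding U(3)[OF assms]
    by (rule integral_linear[symmetric, OF op.F_integrable[OF assms U_continuous_on] lin])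
  finally show ?thesis by (simp add: o_def)
qed

lemma flow_bounded: "\<exists>c\<ge>1. \<forall>t\<in>{a..b}. norm (flow t) \<le> c \<and> norm (flowinv t) \<le> c"
proof (cases "a \<le> b")
  case True
  define c where "c = 2 * exp (4 * (\<bar>N a - N 0\<bar> + \<bar>N b - N 0\<bar>))"
  have "2 * exp (4 * \<bar>N t - N 0\<bar>) \<le> c" if "t \<in> {a..b}" for t
  proof -
    have "\<bar>N t - N 0\<bar> \<le> \<bar>N a - N 0\<bar> + \<bar>N b - N 0\<bar>"
      using monoD[OF mono_N, of a t] monoD[OF mono_N, of t b] that by force
    then show ?thesis by (simp add: c_def)
  qed
  then have "\<forall>t\<in>{a..b}. norm (flow t) \<le> c \<and> norm (flowinv t) \<le> c"
    using norm_U[of 0] norm_U[of _ 0] by (metis abs_minus_commute order_trans)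
  moreover have "c \<ge> 1"
  proof -
    have "1 \<le> exp (4 * (\<bar>N a - N 0\<bar> + \<bar>N b - N 0\<bar>))" by simp
    then show ?thesis unfolding c_def by linarith
  qed
  ultimately show ?thesis by blast
qed auto

text \<open>
The inverses are continuous by \<open>X\<^sup>-\<^sup>1 - Y\<^sup>-\<^sup>1 = X\<^sup>-\<^sup>1(Y - X)Y\<^sup>-\<^sup>1\<close> and their local boundedness.
\<close>
lemma flowinv_continuous: "continuous_on {a..b} flowinv"
proof -
  obtain c where c: "c \<ge> 1" "\<And>t. t \<in> {a..b} \<Longrightarrow> norm (flowinv t) \<le> c"
    using flow_bounded[of a b] by blast
  have eq: "flowinv r - flowinv t = flowinv r o\<^sub>L (flow t - flow r) o\<^sub>L flowinv t" for r t
    by (rule blinfun_eqI) (simp add: blinfun.diff_left blinfun.diff_right)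
  have le: "norm (flowinv r - flowinv t) \<le> c * norm (flow t - flow r) * c" if "r \<in> {a..b}" "t \<in> {a..b}" for r t
  proof -
    have "norm (flowinv r - flowinv t) \<le> norm (flowinv r) * norm (flow t - flow r) * norm (flowinv t)"
      unfolding eq using norm_blinfun_compose[of "flowinv r o\<^sub>L (flow t - flow r)" "flowinv t"]
        mult_right_mono[OF norm_blinfun_compose[of "flowinv r" "flow t - flow r"] norm_ge_zero[of "flowinv t"]]
      by (rule order_trans)
    also have "\<dots> \<le> c * norm (flow t - flow r) * c"
      using c that by (intro mult_mono) auto
    finally show ?thesis .
  qed
  show ?thesis
    unfolding continuous_on_iff
  proof (intro ballI allI impI)
    fix t e :: real assume t: "t \<in> {a..b}" and "e > 0"
    then have "e / (c * c) > 0" using c(1) by simp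
    then obtain \<delta> where \<delta>: "\<delta> > 0" "\<And>r. r \<in> {a..b} \<Longrightarrow> dist r t < \<delta> \<Longrightarrow> dist (flow r) (flow t) < e / (c * c)"
      using U_continuous_on[of "{a..b}" 0, unfolded continuous_on_iff] t by blast
    have "dist (flowinv r) (flowinv t) < e" if "r \<in> {a..b}" "dist r t < \<delta>" for r
    proof -
      have "dist (flowinv r) (flowinv t) \<le> dist (flow r) (flow t) * (c * c)"
        using le[OF that(1) t] by (simp add: dist_norm norm_minus_commute mult_ac)
      also have "\<dots> < e / (c * c) * (c * c)"
        using \<delta>(2)[OF that] c(1) by (intro mult_strict_right_mono) auto
      also have "\<dots> = e" using c(1) by simp
      finally show ?thesis .
    qed
    with \<delta>(1) show "\<exists>\<delta>>0. \<forall>r\<in>{a..b}. dist r t < \<delta> \<longrightarrow> dist (flowinv r) (flowinv t) < e"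
      by (intro exI[of _ \<delta>] conjI ballI impI)
  qed
qed

end

lemma integrable_operator_times:
  fixes R :: "real \<Rightarrow> 'b::banach \<Rightarrow>\<^sub>L 'c::banach" and \<phi> :: "real \<Rightarrow> 'b" and \<gamma> :: "real \<Rightarrow> real"
  assumes "a \<le> b" and R: "continuous_on {a..b} R"
    and \<phi>: "\<phi> integrable_on {a..b}" "\<And>r. norm (\<phi> r) \<le> \<gamma> r" and \<gamma>: "\<gamma> integrable_on {a..b}"
  shows "(\<lambda>r. R r (\<phi> r)) integrable_on {a..b}"
proof (rule integrable_lipschitz_superposition[where F = "\<lambda>r X. blinfun_apply X (\<phi> r)" and \<gamma> = \<gamma>])
  show "norm (blinfun_apply X (\<phi> r) - blinfun_apply Y (\<phi> r)) \<le> \<gamma> r * norm (X - Y)" for X Y :: "'b \<Rightarrow>\<^sub>L 'c" and r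
  proof -
    have "norm ((X - Y) (\<phi> r)) \<le> norm (X - Y) * norm (\<phi> r)" by (rule norm_blinfun)
    also have "\<dots> \<le> norm (X - Y) * \<gamma> r" using \<phi>(2) by (intro mult_left_mono) auto
    finally show ?thesis by (simp add: blinfun.diff_left mult.commute)
  qed
  show "\<gamma> r \<ge> 0" for r using order_trans[OF norm_ge_zero \<phi>(2)] .
  show "(\<lambda>r. z (\<phi> r)) integrable_on {a..b}" for z :: "'b \<Rightarrow>\<^sub>L 'c"
    using integrable_linear[OF \<phi>(1) blinfun.bounded_linear_right[of z]] by (simp add: o_def)
qed (use assms in auto)

section \<open>Variation of constants without impulses\<close>

context impulsive_system begin

text \<open>
The product rule for \<open>flow \<sqdot> y\<close> without derivatives. Both \<open>flow\<close> and \<open>y\<close> are continuous with increments of order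
\<open>dN\<close> and \<open>\<gamma> dt\<close>, so the defect of the product rule on \<open>[u,v]\<close> is \<open>o(dN + \<gamma> dt)\<close>, and
\<open>constant_if_small_increments\<close> applies.
\<close>
lemma flow_variation_of_constants:
  assumes "a \<le> b" and \<phi>: "\<phi> integrable_on {a..b}" "\<And>r. norm (\<phi> r) \<le> \<gamma> r"
    and \<gamma>: "\<gamma> integrable_on {a..b}"
    and y: "\<And>u v. a \<le> u \<Longrightarrow> u \<le> v \<Longrightarrow> v \<le> b \<Longrightarrow> y v - y u = integral {u..v} (\<lambda>r. flowinv r (\<phi> r))"
  shows "(\<lambda>r. A r (flow r (y r)) + \<phi> r) integrable_on {a..b}" (is "?h integrable_on _")
    and "flow b (y b) - flow a (y a) = integral {a..b} (\<lambda>r. A r (flow r (y r)) + \<phi> r)"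
proof -
  note sub = integrable_subinterval_real
  have int_g: "(\<lambda>r. flowinv r (\<phi> r)) integrable_on {a..b}"
    by (rule integrable_operator_times[OF \<open>a \<le> b\<close> flowinv_continuous \<phi> \<gamma>])
  have cont_y: "continuous_on {a..b} y" by (rule primitive_continuous_on[OF int_g y])
  have cont_fy: "continuous_on {a..b} (\<lambda>r. flow r (y r))"
    by (intro bounded_bilinear.continuous_on[OF bounded_bilinear_blinfun_apply] U_continuous_on cont_y)
  have int_A: "(\<lambda>r. A r (flow r (y r))) integrable_on {a..b}"
    by (rule vec.F_integrable[OF \<open>a \<le> b\<close> cont_fy])
  show int_h: "?h integrable_on {a..b}" by (rule integrable_add[OF int_A \<phi>(1)])
  define D where "D t = flow t (y t) - integral {a..t} ?h" for t
  define N' where "N' t = N t + integral {a..t} \<gamma>" for t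
  obtain c where c: "c \<ge> 1" "\<And>t. t \<in> {a..b} \<Longrightarrow> norm (flow t) \<le> c \<and> norm (flowinv t) \<le> c"
    using flow_bounded[of a b] by blast
  have increment: "norm (D v - D u) \<le> \<epsilon> * (N' v - N' u)"
    if uv: "a \<le> u" "u \<le> v" "v \<le> b" and "\<epsilon> > 0"
      and flow: "\<And>r. r \<in> {u..v} \<Longrightarrow> norm (flow v - flow r) \<le> \<epsilon> / c"
      and yy: "\<And>r. r \<in> {u..v} \<Longrightarrow> norm (y u - y r) \<le> \<epsilon> / c" for u v \<epsilon>
  proof -
    have le: "{u..v} \<subseteq> {a..b}" using uv by auto
    have fv: "(\<lambda>r. flow v (flowinv r (\<phi> r))) integrable_on {u..v}"
      using integrable_linear[OF sub[OF int_g le] blinfun.bounded_linear_right[of "flow v"]] by (simp add: o_def)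
    have "flow v (y v) - flow v (y u) = flow v (integral {u..v} (\<lambda>r. flowinv r (\<phi> r)))"
      using y[OF uv] by (simp flip: blinfun.diff_right)
    also have "\<dots> = integral {u..v} (\<lambda>r. flow v (flowinv r (\<phi> r)))"
      using integral_linear[OF sub[OF int_g le] blinfun.bounded_linear_right[of "flow v"]] by (simp add: o_def)
    finally have "flow v (y v) - flow v (y u) - integral {u..v} \<phi>
        = integral {u..v} (\<lambda>r. flow v (flowinv r (\<phi> r)) - \<phi> r)"
      using integral_diff[OF fv sub[OF \<phi>(1) le]] by simp
    moreover have "norm (integral {u..v} (\<lambda>r. flow v (flowinv r (\<phi> r)) - \<phi> r)) \<le> integral {u..v} (\<lambda>r. \<epsilon> * \<gamma> r)"
    proof (rule integral_norm_bound_integral)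
      show "(\<lambda>r. flow v (flowinv r (\<phi> r)) - \<phi> r) integrable_on {u..v}"
        by (rule integrable_diff[OF fv sub[OF \<phi>(1) le]])
      show "(\<lambda>r. \<epsilon> * \<gamma> r) integrable_on {u..v}" by (intro integrable_on_mult_right sub[OF \<gamma> le])
      fix r assume r: "r \<in> {u..v}"
      have "flow v (flowinv r (\<phi> r)) - \<phi> r = (flow v - flow r) (flowinv r (\<phi> r))"
        by (simp add: blinfun.diff_left)
      also have "norm \<dots> \<le> norm (flow v - flow r) * norm (flowinv r (\<phi> r))" by (rule norm_blinfun)
      also have "\<dots> \<le> norm (flow v - flow r) * (norm (flowinv r) * norm (\<phi> r))"
        by (intro mult_left_mono norm_blinfun) auto
      also have "\<dots> \<le> \<epsilon> / c * (c * \<gamma> r)"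
        using flow[OF r] c(2)[of r] c(1) \<phi>(2)[of r] r le \<open>\<epsilon> > 0\<close> by (intro mult_mono) auto
      also have "\<dots> = \<epsilon> * \<gamma> r" using c(1) by simp
      finally show "norm (flow v (flowinv r (\<phi> r)) - \<phi> r) \<le> \<epsilon> * \<gamma> r" .
    qed
    ultimately have 1: "norm (flow v (y v) - flow v (y u) - integral {u..v} \<phi>) \<le> \<epsilon> * integral {u..v} \<gamma>"
      by simp
    have "norm (integral {u..v} (\<lambda>r. A r (flow r (y u))) - integral {u..v} (\<lambda>r. A r (flow r (y r)))) \<le> \<epsilon> * (N v - N u)"
    proof (rule vec.F_lipschitz[OF uv(2)])
      show "continuous_on {u..v} (\<lambda>r. flow r (y u))"
        by (intro bounded_bilinear.continuous_on[OF bounded_bilinear_blinfun_apply] U_continuous_on continuous_on_const)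
      show "continuous_on {u..v} (\<lambda>r. flow r (y r))" by (rule continuous_on_subset[OF cont_fy le])
      fix r assume r: "r \<in> {u..v}"
      have "flow r (y u) - flow r (y r) = flow r (y u - y r)" by (simp add: blinfun.diff_right)
      also have "norm \<dots> \<le> norm (flow r) * norm (y u - y r)" by (rule norm_blinfun)
      also have "\<dots> \<le> c * (\<epsilon> / c)" using yy[OF r] c(2)[of r] c(1) r le by (intro mult_mono) auto
      also have "\<dots> = \<epsilon>" using c(1) by simp
      finally show "norm (flow r (y u) - flow r (y r)) \<le> \<epsilon>" .
    qed
    then have 2: "norm (flow v (y u) - flow u (y u) - integral {u..v} (\<lambda>r. A r (flow r (y r)))) \<le> \<epsilon> * (N v - N u)"
      by (simp add: flow_increment[OF uv(2)])
    have ints: "integral {a..v} ?h - integral {a..u} ?h = integral {u..v} ?h"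
        "integral {a..v} \<gamma> - integral {a..u} \<gamma> = integral {u..v} \<gamma>"
      using Henstock_Kurzweil_Integration.integral_combine[OF uv(1,2) sub[OF int_h, of a v]]
        Henstock_Kurzweil_Integration.integral_combine[OF uv(1,2) sub[OF \<gamma>, of a v]] uv by (auto simp: algebra_simps)
    have "integral {u..v} ?h = integral {u..v} (\<lambda>r. A r (flow r (y r))) + integral {u..v} \<phi>"
      by (rule integral_add[OF sub[OF int_A le] sub[OF \<phi>(1) le]])
    then have "D v - D u = (flow v (y v) - flow v (y u) - integral {u..v} \<phi>)
        + (flow v (y u) - flow u (y u) - integral {u..v} (\<lambda>r. A r (flow r (y r))))"
      using ints(1) by (simp add: D_def algebra_simps)
    also have "norm \<dots> \<le> \<epsilon> * integral {u..v} \<gamma> + \<epsilon> * (N v - N u)"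
      by (rule norm_triangle_mono[OF 1 2])
    also have "\<dots> = \<epsilon> * (N' v - N' u)" by (simp add: N'_def flip: ints(2) distrib_left)
    finally show ?thesis .
  qed
  have "D b = D a"
  proof (rule constant_if_small_increments[OF \<open>a \<le> b\<close>, where N = N'])
    fix \<epsilon> x :: real assume "\<epsilon> > 0" and x: "a \<le> x" "x \<le> b"
    then have e: "\<epsilon> / (2 * c) > 0" and x': "x \<in> {a..b}" using c(1) by auto
    obtain \<delta>1 where \<delta>1: "\<delta>1 > 0" "\<And>r. r \<in> {a..b} \<Longrightarrow> dist r x < \<delta>1 \<Longrightarrow> dist (flow r) (flow x) < \<epsilon> / (2 * c)"
      using U_continuous_on[of "{a..b}" 0, unfolded continuous_on_iff, rule_format, OF x' e] by auto
    obtain \<delta>2 where \<delta>2: "\<delta>2 > 0" "\<And>r. r \<in> {a..b} \<Longrightarrow> dist r x < \<delta>2 \<Longrightarrow> dist (y r) (y x) < \<epsilon> / (2 * c)"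
      using cont_y[unfolded continuous_on_iff, rule_format, OF x' e] by auto
    have half: "norm (p - q) \<le> \<epsilon> / c" if "dist p z < \<epsilon> / (2 * c)" "dist q z < \<epsilon> / (2 * c)"
      for p q z :: "'z::real_normed_vector"
      using dist_triangle_half_l[of p z "\<epsilon> / c" q] that by (simp add: dist_norm)
    show "\<exists>\<delta>>0. \<forall>u v. a \<le> u \<longrightarrow> u \<le> x \<longrightarrow> x \<le> v \<longrightarrow> v \<le> b \<longrightarrow> v - u < \<delta> \<longrightarrow> norm (D v - D u) \<le> \<epsilon> * (N' v - N' u)"
    proof (intro exI[of _ "min \<delta>1 \<delta>2"] conjI allI impI)
      fix u v assume uv: "a \<le> u" "u \<le> x" "x \<le> v" "v \<le> b" "v - u < min \<delta>1 \<delta>2"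
      have near: "r \<in> {a..b} \<and> dist r x < \<delta>1 \<and> dist r x < \<delta>2" if "r \<in> {u..v}" for r
        using that uv by (auto simp: dist_real_def)
      show "norm (D v - D u) \<le> \<epsilon> * (N' v - N' u)"
      proof (rule increment)
        show "norm (flow v - flow r) \<le> \<epsilon> / c" if "r \<in> {u..v}" for r
          using near[of v] near[OF that] uv by (intro half[of _ "flow x"] \<delta>1) auto
        show "norm (y u - y r) \<le> \<epsilon> / c" if "r \<in> {u..v}" for r
          using near[of u] near[OF that] uv by (intro half[of _ "y x"] \<delta>2) auto
      qed (use uv \<open>\<epsilon> > 0\<close> in auto)
    qed (use \<delta>1 \<delta>2 in auto)
  qed
  then show "flow b (y b) - flow a (y a) = integral {a..b} ?h"
    by (simp add: D_def algebra_simps)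
qed

section \<open>Pieces between consecutive impulses\<close>

lemma \<tau>_zero: "\<tau> 0 = 0" and \<tau>_less_iff: "\<tau> i < \<tau> j \<longleftrightarrow> i < j" and \<tau>_le_iff: "\<tau> i \<le> \<tau> j \<longleftrightarrow> i \<le> j"
  using times by (auto simp: impulse_times_def strict_mono_less strict_mono_less_eq)

lemma exists_\<tau>_less: "\<exists>i. \<tau> i < t" and exists_\<tau>_greater: "\<exists>i. t < \<tau> i"
proof -
  have "\<forall>\<^sub>F i in at_bot. \<tau> i < t" "\<forall>\<^sub>F i in at_top. t < \<tau> i"
    using times by (auto simp: impulse_times_def filterlim_at_bot_dense filterlim_at_top_dense)
  then show "\<exists>i. \<tau> i < t" "\<exists>i. t < \<tau> i"
    by (auto simp: eventually_at_bot_linorder eventually_at_top_linorder)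
qed

text \<open>
With \<open>P x\<close> being \<open>x < t\<close> or \<open>x \<le> t\<close> this locates \<open>t\<close> between consecutive impulse times.
\<close>
lemma piece_exists:
  fixes P :: "real \<Rightarrow> bool"
  assumes "\<And>i j. i \<le> j \<Longrightarrow> P (\<tau> j) \<Longrightarrow> P (\<tau> i)" "\<exists>i. P (\<tau> i)" "\<exists>j. \<not> P (\<tau> j)"
  shows "\<exists>i. P (\<tau> i) \<and> \<not> P (\<tau> (i + 1))"
proof -
  obtain i j where "P (\<tau> i)" "\<not> P (\<tau> j)" using assms by blast
  have "\<exists>k. P (\<tau> k) \<and> \<not> P (\<tau> (k + 1))" if "P (\<tau> i)" "\<not> P (\<tau> (i + int n))" for i n
    using that
  proof (induction n arbitrary: i)
    case (Suc n)
    then show ?case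
      by (cases "P (\<tau> (i + 1))") (auto simp: algebra_simps)
  qed simp
  moreover have "i < j" using assms(1)[of j i] \<open>P (\<tau> i)\<close> \<open>\<not> P (\<tau> j)\<close> by force
  then have "\<not> P (\<tau> (i + int (nat (j - i))))" using \<open>\<not> P (\<tau> j)\<close> by simp
  ultimately show ?thesis using \<open>P (\<tau> i)\<close> by blast
qed

text \<open>
The pieces are \<open>(\<tau>\<^sub>i, \<tau>\<^sub>i\<^sub>+\<^sub>1]\<close>, since solutions are left continuous.
\<close>
definition piece_of :: "real \<Rightarrow> int" where "piece_of t = (THE i. \<tau> i < t \<and> t \<le> \<tau> (i + 1))"

lemma piece_of_eq: "\<tau> i < t \<Longrightarrow> t \<le> \<tau> (i + 1) \<Longrightarrow> piece_of t = i"
proof -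
  assume t: "\<tau> i < t" "t \<le> \<tau> (i + 1)"
  show ?thesis unfolding piece_of_def
  proof (rule the_equality)
    fix j assume "\<tau> j < t \<and> t \<le> \<tau> (j + 1)"
    then have "\<tau> j < \<tau> (i + 1)" "\<tau> i < \<tau> (j + 1)" using t by auto
    then show "j = i" by (simp add: \<tau>_less_iff)
  qed (use t in simp)
qed

lemma piece_of: "\<tau> (piece_of t) < t" "t \<le> \<tau> (piece_of t + 1)"
proof -
  have "\<exists>i. \<tau> i < t \<and> \<not> \<tau> (i + 1) < t"
  proof (rule piece_exists)
    show "\<exists>j. \<not> \<tau> j < t" using exists_\<tau>_greater[of t] by (meson less_asym)
    show "\<exists>i. \<tau> i < t" by (rule exists_\<tau>_less)
    show "\<tau> i < t" if "i \<le> j" "\<tau> j < t" for i j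
      using that(2) \<tau>_le_iff[of i j] that(1) by simp
  qed
  then show "\<tau> (piece_of t) < t" "t \<le> \<tau> (piece_of t + 1)" using piece_of_eq by force+
qed

lemma piece_from: "\<exists>i. \<tau> i \<le> t \<and> t < \<tau> (i + 1)"
proof -
  have "\<exists>i. \<tau> i \<le> t \<and> \<not> \<tau> (i + 1) \<le> t"
  proof (rule piece_exists)
    show "\<exists>i. \<tau> i \<le> t" "\<exists>j. \<not> \<tau> j \<le> t"
      using exists_\<tau>_greater[of t] exists_\<tau>_less[of t] by (meson less_imp_le not_le)+
    show "\<tau> i \<le> t" if "i \<le> j" "\<tau> j \<le> t" for i j
      using that(2) \<tau>_le_iff[of i j] that(1) by simp
  qed
  then show ?thesis by force
qed

lemma impulses_in_piece:
  assumes "\<tau> i \<le> s" "t \<le> \<tau> (i + 1)" "s < t"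
  shows "{j. s \<le> \<tau> j \<and> \<tau> j < t} = (if s = \<tau> i then {i} else {})"
proof -
  have "j = i" if "s \<le> \<tau> j" "\<tau> j < t" for j
  proof -
    have "\<tau> i \<le> \<tau> j" "\<tau> j < \<tau> (i + 1)" using that assms by auto
    then show ?thesis by (simp add: \<tau>_less_iff \<tau>_le_iff)
  qed
  then show ?thesis using assms by auto
qed

lemma integrable_if_pieces:
  fixes g :: "real \<Rightarrow> 'c::banach"
  assumes "\<And>i. g integrable_on {\<tau> i..\<tau> (i + 1)}"
  shows "g integrable_on {s..t}"
proof -
  obtain i where i: "\<tau> i < s" using exists_\<tau>_less by blast
  obtain j where j: "t < \<tau> j" using exists_\<tau>_greater by blast
  have "g integrable_on {\<tau> i..\<tau> (i + int n)}" for n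
  proof (induction n)
    case (Suc n)
    have "g integrable_on {\<tau> i..\<tau> (i + int n + 1)}"
      by (rule Henstock_Kurzweil_Integration.integrable_combine[OF _ _ Suc assms]) (simp_all add: \<tau>_le_iff)
    then show ?case by (simp add: algebra_simps)
  qed (use integrable_on_refl[of g "\<tau> i"] in simp)
  from this[of "nat (j - i)"] have int: "g integrable_on {\<tau> i..\<tau> j}" if "i \<le> j" using that by simp
  show ?thesis
  proof (cases "s \<le> t")
    case True
    then have "\<tau> i < \<tau> j" using i j by simp
    then have "i \<le> j" by (simp add: \<tau>_less_iff)
    then show ?thesis by (rule integrable_subinterval_real[OF int]) (use i j in auto)
  qed (use integrable_on_empty in simp)
qed

end

section \<open>The evolution operators with impulses\<close>

definition mutual_inverse :: "'a::real_normed_vector \<Rightarrow>\<^sub>L 'a \<Rightarrow> 'a \<Rightarrow>\<^sub>L 'a \<Rightarrow> bool" where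
  "mutual_inverse X Y \<longleftrightarrow> X o\<^sub>L Y = id_blinfun \<and> Y o\<^sub>L X = id_blinfun"

lemma mutual_inverse_iff: "mutual_inverse X Y \<longleftrightarrow> (\<forall>x. X (Y x) = x) \<and> (\<forall>x. Y (X x) = x)"
  unfolding mutual_inverse_def by (metis blinfun_apply_blinfun_compose blinfun_apply_id_blinfun blinfun_eqI id_apply)

lemma mutual_inverse_sym: "mutual_inverse X Y \<Longrightarrow> mutual_inverse Y X"
  by (simp add: mutual_inverse_def)

lemma mutual_inverse_compose:
  "mutual_inverse X Y \<Longrightarrow> mutual_inverse Z V \<Longrightarrow> mutual_inverse (X o\<^sub>L Z) (V o\<^sub>L Y)"
  by (simp add: mutual_inverse_iff)

text \<open>
A recursion over all integers exists only because its steps can be undone.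
\<close>
lemma two_sided_recursion:
  fixes C D :: "int \<Rightarrow> 'a::real_normed_vector \<Rightarrow>\<^sub>L 'a"
  assumes CD: "\<And>i. mutual_inverse (C i) (D i)"
  shows "\<exists>Q. Q (-1) = id_blinfun \<and> (\<forall>i. Q i = C i o\<^sub>L Q (i - 1)) \<and> (\<forall>i. \<exists>R. mutual_inverse (Q i) R)"
proof -
  define p where "p = rec_nat id_blinfun (\<lambda>n X. C (int n) o\<^sub>L X)"
  define m where "m = rec_nat id_blinfun (\<lambda>n X. D (- 1 - int n) o\<^sub>L X)"
  have p: "p 0 = id_blinfun" "p (Suc n) = C (int n) o\<^sub>L p n" for n by (auto simp: p_def)
  have m: "m 0 = id_blinfun" "m (Suc n) = D (- 1 - int n) o\<^sub>L m n" for n by (auto simp: m_def)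
  have inv_id: "mutual_inverse id_blinfun (id_blinfun :: 'a \<Rightarrow>\<^sub>L 'a)" by (simp add: mutual_inverse_iff)
  have comp: "\<exists>R. mutual_inverse (X o\<^sub>L Z) R" if "mutual_inverse X Y" "\<exists>V. mutual_inverse Z V" for X Y Z :: "'a \<Rightarrow>\<^sub>L 'a"
    using mutual_inverse_compose[OF that(1)] that(2) by blast
  have p_inv: "\<exists>R. mutual_inverse (p n) R" for n
  proof (induction n)
    case 0
    show ?case unfolding p by (rule exI, rule inv_id)
  next
    case (Suc n)
    show ?case unfolding p by (rule comp[OF CD Suc])
  qed
  have m_inv: "\<exists>R. mutual_inverse (m n) R" for n
  proof (induction n)
    case 0
    show ?case unfolding m by (rule exI, rule inv_id)
  next
    case (Suc n)
    show ?case unfolding m by (rule comp[OF mutual_inverse_sym[OF CD] Suc])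
  qed
  define Q where "Q i = (if i \<ge> -1 then p (nat (i + 1)) else m (nat (-1 - i)))" for i
  have Q_neg: "Q (-1 - int n) = m n" for n by (cases n) (auto simp: Q_def p m nat_add_distrib)
  have "Q i = C i o\<^sub>L Q (i - 1)" for i
  proof (cases "i \<ge> 0")
    case True
    then obtain n where "i = int n" using nonneg_int_cases by blast
    then show ?thesis using p(2)[of n] by (simp add: Q_def nat_add_distrib)
  next
    case False
    then have i: "i = -1 - int (nat (-1 - i))" by simp
    define n where "n = nat (-1 - i)"
    have "Q (i - 1) = D i o\<^sub>L Q i"
      using Q_neg[of n] Q_neg[of "Suc n"] m(2)[of n] i by (simp add: n_def[symmetric])
    then show ?thesis using CD[of i] by (auto intro!: blinfun_eqI simp: mutual_inverse_iff)
  qed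
  moreover have "Q (-1) = id_blinfun" by (simp add: Q_def p)
  moreover have "\<exists>R. mutual_inverse (Q i) R" for i using p_inv m_inv by (simp add: Q_def)
  ultimately show ?thesis by blast
qed

context impulsive_system begin

text \<open>
With \<open>W(t) = flow(t) Q\<^sub>i\<close> on the \<open>i\<close>-th piece, the jump condition \<open>x(\<tau>\<^sub>i+) = (I + B\<^sub>i)x(\<tau>\<^sub>i)\<close> becomes this
recursion. It starts at \<open>-1\<close>, because \<open>\<tau>\<^sub>0 = 0\<close> is the right end of the piece with index \<open>-1\<close>.
\<close>
definition Q :: "int \<Rightarrow> 'a \<Rightarrow>\<^sub>L 'a" where
  "Q = (SOME Q. Q (-1) = id_blinfun \<and>
     (\<forall>i. Q i = (flowinv (\<tau> i) o\<^sub>L (id_blinfun + B i) o\<^sub>L flow (\<tau> i)) o\<^sub>L Q (i - 1)) \<and> (\<forall>i. \<exists>R. mutual_inverse (Q i) R))"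

definition R :: "int \<Rightarrow> 'a \<Rightarrow>\<^sub>L 'a" where "R i = (SOME R. mutual_inverse (Q i) R)"

lemma Q: "Q (-1) = id_blinfun"
    "Q i = (flowinv (\<tau> i) o\<^sub>L (id_blinfun + B i) o\<^sub>L flow (\<tau> i)) o\<^sub>L Q (i - 1)"
    "mutual_inverse (Q i) (R i)"
proof -
  have fi: "mutual_inverse (flow t) (flowinv t)" for t
    by (simp add: mutual_inverse_iff)
  have "\<forall>i. \<exists>S. mutual_inverse (id_blinfun + B i) S"
    using jump_invertible by (auto simp: mutual_inverse_def)
  from choice[OF this] obtain S where S: "\<And>i. mutual_inverse (id_blinfun + B i) (S i)" by blast
  have ex: "mutual_inverse (flowinv (\<tau> i) o\<^sub>L (id_blinfun + B i) o\<^sub>L flow (\<tau> i)) (flowinv (\<tau> i) o\<^sub>L (S i o\<^sub>L flow (\<tau> i)))" for i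
    by (intro mutual_inverse_compose S fi mutual_inverse_sym[OF fi])
  note * = someI_ex[OF two_sided_recursion[where C = "\<lambda>i. flowinv (\<tau> i) o\<^sub>L (id_blinfun + B i) o\<^sub>L flow (\<tau> i)", OF ex],
      folded Q_def]
  show "Q (-1) = id_blinfun" using * by (elim conjE)
  show "Q i = (flowinv (\<tau> i) o\<^sub>L (id_blinfun + B i) o\<^sub>L flow (\<tau> i)) o\<^sub>L Q (i - 1)"
    using * by (elim conjE allE[of _ i])
  show "mutual_inverse (Q i) (R i)"
    unfolding R_def using * by (elim conjE) (rule someI_ex, erule allE)
qed

lemma QR[simp]: "Q i (R i x) = x" "R i (Q i x) = x"
  using Q(3)[of i] by (simp_all add: mutual_inverse_iff)

definition W :: "real \<Rightarrow> 'a \<Rightarrow>\<^sub>L 'a" where "W t = flow t o\<^sub>L Q (piece_of t)"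
definition Winv :: "real \<Rightarrow> 'a \<Rightarrow>\<^sub>L 'a" where "Winv t = R (piece_of t) o\<^sub>L flowinv t"

lemma W_inverse[simp]: "W t (Winv t x) = x" "Winv t (W t x) = x"
  by (simp_all add: W_def Winv_def)

lemma W_0: "W 0 = id_blinfun" "Winv 0 = id_blinfun"
proof -
  have "piece_of 0 = -1" using \<tau>_zero \<tau>_less_iff[of "-1" 0] by (intro piece_of_eq) auto
  then show "W 0 = id_blinfun" by (intro blinfun_eqI) (simp add: W_def Q(1) U(1))
  then show "Winv 0 = id_blinfun" using W_inverse[of 0] by (intro blinfun_eqI) simp
qed

lemma W_on_piece:
  assumes "\<tau> i < t" "t \<le> \<tau> (i + 1)"
  shows "W t x = flow t (Q i x)" "Winv t x = R i (flowinv t x)"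
  using piece_of_eq[OF assms] by (simp_all add: W_def Winv_def)

lemma W_after_jump: "flow (\<tau> i) (Q i x) = W (\<tau> i) x + B i (W (\<tau> i) x)"
proof -
  have "piece_of (\<tau> i) = i - 1" by (rule piece_of_eq) (simp_all add: \<tau>_less_iff)
  then show ?thesis by (simp add: W_def Q(2)[of i] blinfun.add_left)
qed

lemma W_bounded: "\<exists>c\<ge>1. \<forall>t\<in>{a..b}. norm (W t) \<le> c \<and> norm (Winv t) \<le> c"
proof -
  obtain c where c: "c \<ge> 1" "\<And>t. t \<in> {a..b} \<Longrightarrow> norm (flow t) \<le> c \<and> norm (flowinv t) \<le> c"
    using flow_bounded[of a b] by blast
  define d where "d = 1 + (\<Sum>i\<in>{piece_of a..piece_of b}. norm (Q i) + norm (R i))"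
  have "d \<ge> 1" by (auto simp: d_def intro!: sum_nonneg)
  have "norm (W t) \<le> c * d \<and> norm (Winv t) \<le> c * d" if t: "t \<in> {a..b}" for t
  proof -
    have "\<tau> (piece_of a) < \<tau> (piece_of t + 1)" "\<tau> (piece_of t) < \<tau> (piece_of b + 1)"
      using piece_of[of t] piece_of[of a] piece_of[of b] t by auto
    then have "piece_of t \<in> {piece_of a..piece_of b}" by (simp add: \<tau>_less_iff)
    then have "norm (Q (piece_of t)) + norm (R (piece_of t)) \<le> (\<Sum>i\<in>{piece_of a..piece_of b}. norm (Q i) + norm (R i))"
      by (intro member_le_sum) auto
    then have "norm (Q (piece_of t)) \<le> d" "norm (R (piece_of t)) \<le> d"
      using norm_ge_zero[of "Q (piece_of t)"] norm_ge_zero[of "R (piece_of t)"] unfolding d_def by linarith+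
    then have "norm (flow t) * norm (Q (piece_of t)) \<le> c * d" "norm (R (piece_of t)) * norm (flowinv t) \<le> d * c"
      using c t \<open>d \<ge> 1\<close> by (auto intro!: mult_mono)
    then show ?thesis
      unfolding W_def Winv_def
      using order_trans[OF norm_blinfun_compose] by (metis mult.commute)
  qed
  moreover have "c * d \<ge> 1" using mult_mono[of 1 c 1 d] c(1) \<open>d \<ge> 1\<close> by simp
  ultimately show ?thesis by blast
qed

text \<open>
Solutions on the line are glued from solutions on single pieces, where at most one impulse is counted, namely
when the interval starts at an impulse time.
\<close>
lemma impulsive_solution_iff_pieces:
  "impulsive_solution A B \<tau> f x \<longleftrightarrow> (\<forall>i s t. \<tau> i \<le> s \<longrightarrow> s < t \<longrightarrow> t \<le> \<tau> (i + 1) \<longrightarrow>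
     (\<lambda>r. A r (x r) + f r (x r)) integrable_on {s..t} \<and>
     x t = (if s = \<tau> i then x s + B i (x s) else x s) + integral {s..t} (\<lambda>r. A r (x r) + f r (x r)))"
  (is "_ \<longleftrightarrow> ?pieces")
proof -
  define g where "g = (\<lambda>r. A r (x r) + f r (x r))"
  define S where "S s t \<longleftrightarrow> g integrable_on {s..t} \<and>
     x t = x s + integral {s..t} g + (\<Sum>i | s \<le> \<tau> i \<and> \<tau> i < t. B i (x (\<tau> i)))" for s t
  have piece: "S s t \<longleftrightarrow> g integrable_on {s..t} \<and> x t = (if s = \<tau> i then x s + B i (x s) else x s) + integral {s..t} g"
    if "\<tau> i \<le> s" "s < t" "t \<le> \<tau> (i + 1)" for i s t
    unfolding S_def impulses_in_piece[OF that(1,3,2)] by (auto simp: algebra_simps)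
  have S_trans: "S s u" if st: "S s t" and tu: "S t u" and "s < t" "t < u" and fin: "finite {i. s \<le> \<tau> i \<and> \<tau> i < u}" for s t u
  proof -
    have "g integrable_on {s..u}"
      by (rule Henstock_Kurzweil_Integration.integrable_combine[of s t u]) (use st tu \<open>s < t\<close> \<open>t < u\<close> in \<open>auto simp: S_def\<close>)
    moreover have "integral {s..t} g + integral {t..u} g = integral {s..u} g"
      by (rule Henstock_Kurzweil_Integration.integral_combine) (use calculation \<open>s < t\<close> \<open>t < u\<close> in auto)
    moreover have "(\<Sum>i | s \<le> \<tau> i \<and> \<tau> i < u. B i (x (\<tau> i)))
        = (\<Sum>i | s \<le> \<tau> i \<and> \<tau> i < t. B i (x (\<tau> i))) + (\<Sum>i | t \<le> \<tau> i \<and> \<tau> i < u. B i (x (\<tau> i)))"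
      using \<open>s < t\<close> \<open>t < u\<close>
      by (subst sum.union_disjoint[symmetric]) (auto intro!: sum.cong finite_subset[OF _ fin])
    ultimately show ?thesis using st tu by (simp add: S_def)
  qed
  have "impulsive_solution A B \<tau> f x \<longleftrightarrow> (\<forall>s t. s < t \<longrightarrow> S s t)"
    unfolding impulsive_solution_def S_def g_def ..
  also have "\<dots> \<longleftrightarrow> (\<forall>i s t. \<tau> i \<le> s \<longrightarrow> s < t \<longrightarrow> t \<le> \<tau> (i + 1) \<longrightarrow> S s t)"
  proof (intro iffI allI impI)
    fix s t :: real
    assume pieces: "\<forall>i s t. \<tau> i \<le> s \<longrightarrow> s < t \<longrightarrow> t \<le> \<tau> (i + 1) \<longrightarrow> S s t" and "s < t"
    obtain k where k: "\<tau> k \<le> s" "s < \<tau> (k + 1)" using piece_from by blast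
    have fin: "finite {i. s \<le> \<tau> i \<and> \<tau> i < u}" for u
    proof (rule finite_subset)
      show "{i. s \<le> \<tau> i \<and> \<tau> i < u} \<subseteq> {k..piece_of u}"
      proof
        fix i assume "i \<in> {i. s \<le> \<tau> i \<and> \<tau> i < u}"
        then have "\<tau> k \<le> \<tau> i" "\<tau> i < \<tau> (piece_of u + 1)" using k piece_of[of u] by auto
        then show "i \<in> {k..piece_of u}" by (simp add: \<tau>_less_iff \<tau>_le_iff)
      qed
    qed simp
    have reach: "S s t" if "s < t" "t \<le> \<tau> (k + 1 + int n)" for n t
      using that
    proof (induction n arbitrary: t)
      case 0
      then show ?case using pieces k by simp
    next
      case (Suc n)
      define p where "p = \<tau> (k + 1 + int n)"
      have "s < p" using k(2) \<tau>_le_iff[of "k + 1" "k + 1 + int n"] by (simp add: p_def)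
      show ?case
      proof (cases "t \<le> p")
        case True
        then show ?thesis using Suc p_def by simp
      next
        case False
        have "S s p" using Suc.IH[of p] \<open>s < p\<close> by (simp add: p_def)
        have "S p t"
          using pieces[rule_format, of "k + 1 + int n" p t] False Suc.prems(2) by (simp add: p_def algebra_simps)
        show ?thesis by (rule S_trans[OF \<open>S s p\<close> \<open>S p t\<close> \<open>s < p\<close> _ fin]) (use False in simp)
      qed
    qed
    obtain j where j: "t < \<tau> j" using exists_\<tau>_greater by blast
    then have "\<tau> k < \<tau> j" using k \<open>s < t\<close> by simp
    then have "k + 1 + int (nat (j - (k + 1))) = j" by (simp add: \<tau>_less_iff)
    then show "S s t" using reach[OF \<open>s < t\<close>, of "nat (j - (k + 1))"] j by simp
  qed auto
  also have "\<dots> \<longleftrightarrow> ?pieces"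
    unfolding g_def[symmetric] by (intro iff_allI imp_cong refl piece)
  finally show ?thesis .
qed

text \<open>
The function \<open>x\<close> on the closed \<open>i\<close>-th piece with its value at the left end replaced by the value after the jump;
for a solution this is continuous.
\<close>
definition after_jump :: "(real \<Rightarrow> 'a) \<Rightarrow> int \<Rightarrow> real \<Rightarrow> 'a" where
  "after_jump x i t = (if t = \<tau> i then x t + B i (x t) else x t)"

definition piecewise_continuous :: "(real \<Rightarrow> 'a) \<Rightarrow> bool" where
  "piecewise_continuous x \<longleftrightarrow>
     (\<forall>i. \<exists>X. continuous_on {\<tau> i..\<tau> (i + 1)} X \<and> (\<forall>t. \<tau> i < t \<longrightarrow> t \<le> \<tau> (i + 1) \<longrightarrow> x t = X t))"

lemma solution_on_piece:
  assumes x: "impulsive_solution A B \<tau> f x" and uv: "\<tau> i \<le> u" "u \<le> v" "v \<le> \<tau> (i + 1)"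
  shows "after_jump x i v - after_jump x i u = integral {u..v} (\<lambda>r. A r (x r) + f r (x r))"
proof (cases "u = v")
  case False
  then show ?thesis
    using x[unfolded impulsive_solution_iff_pieces, rule_format, OF uv(1) _ uv(3)] uv
    by (auto simp: after_jump_def)
qed simp

lemma \<tau>_step: "\<tau> i < \<tau> (i + 1)" by (simp add: \<tau>_less_iff)

lemma after_jump_continuous:
  assumes x: "impulsive_solution A B \<tau> f x"
  shows "continuous_on {\<tau> i..\<tau> (i + 1)} (after_jump x i)"
proof (rule primitive_continuous_on)
  show "(\<lambda>r. A r (x r) + f r (x r)) integrable_on {\<tau> i..\<tau> (i + 1)}"
    using x[unfolded impulsive_solution_iff_pieces, rule_format, of i "\<tau> i" "\<tau> (i + 1)"] \<tau>_step by simp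
qed (rule solution_on_piece[OF x])

lemma solution_piecewise_continuous:
  assumes "impulsive_solution A B \<tau> f x" shows "piecewise_continuous x"
  unfolding piecewise_continuous_def
proof
  fix i show "\<exists>X. continuous_on {\<tau> i..\<tau> (i + 1)} X \<and> (\<forall>t. \<tau> i < t \<longrightarrow> t \<le> \<tau> (i + 1) \<longrightarrow> x t = X t)"
    by (intro exI[of _ "after_jump x i"] conjI after_jump_continuous[OF assms]) (auto simp: after_jump_def)
qed

lemma W_piecewise_continuous:
  assumes "continuous_on UNIV y" shows "piecewise_continuous (\<lambda>t. W t (y t))"
  unfolding piecewise_continuous_def
proof
  fix i
  have "continuous_on {\<tau> i..\<tau> (i + 1)} (\<lambda>t. flow t (Q i (y t)))"
    by (intro bounded_bilinear.continuous_on[OF bounded_bilinear_blinfun_apply] U_continuous_on continuous_on_const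
        continuous_on_subset[OF assms]) auto
  then show "\<exists>X. continuous_on {\<tau> i..\<tau> (i + 1)} X \<and> (\<forall>t. \<tau> i < t \<longrightarrow> t \<le> \<tau> (i + 1) \<longrightarrow> W t (y t) = X t)"
    by (intro exI[of _ "\<lambda>t. flow t (Q i (y t))"] conjI allI impI) (simp_all add: W_on_piece)
qed

end

section \<open>Variation of constants with impulses\<close>

context impulsive_system begin

lemma Winv_integrable:
  assumes \<phi>: "\<And>u v. \<phi> integrable_on {u..v}" "\<And>r. norm (\<phi> r) \<le> \<gamma> r" and \<gamma>: "\<And>u v. \<gamma> integrable_on {u..v}"
  shows "(\<lambda>r. Winv r (\<phi> r)) integrable_on {s..t}"
proof (rule integrable_if_pieces)
  fix i
  have "(\<lambda>r. flowinv r (\<phi> r)) integrable_on {\<tau> i..\<tau> (i + 1)}"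
    by (rule integrable_operator_times[OF less_imp_le[OF \<tau>_step] flowinv_continuous \<phi> \<gamma>])
  then have "(\<lambda>r. R i (flowinv r (\<phi> r))) integrable_on {\<tau> i..\<tau> (i + 1)}"
    using integrable_linear[OF _ blinfun.bounded_linear_right[of "R i"]] by (simp add: o_def)
  then show "(\<lambda>r. Winv r (\<phi> r)) integrable_on {\<tau> i..\<tau> (i + 1)}"
    by (rule integrable_spike_finite[rotated 2, of _ _ "{\<tau> i}"]) (auto simp: W_on_piece)
qed

text \<open>
On the \<open>i\<close>-th piece \<open>W(t)y(t) = flow(t)(Q\<^sub>i y(t))\<close>, and the operator \<open>Q\<^sub>i\<close> cancels against its inverse in \<open>Winv\<close>, so that
\<open>flow_variation_of_constants\<close> applies to \<open>Q\<^sub>i y\<close>. The jumps are correct by the recursion for \<open>Q\<close>.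
\<close>
lemma variation_of_constants:
  assumes \<phi>: "\<And>u v. \<phi> integrable_on {u..v}" "\<And>r. norm (\<phi> r) \<le> \<gamma> r" and \<gamma>: "\<And>u v. \<gamma> integrable_on {u..v}"
    and y: "\<And>u v. u \<le> v \<Longrightarrow> y v - y u = integral {u..v} (\<lambda>r. Winv r (\<phi> r))"
  shows "impulsive_solution A B \<tau> (\<lambda>r _. \<phi> r) (\<lambda>t. W t (y t))"
  unfolding impulsive_solution_iff_pieces
proof (intro allI impI)
  fix i s t assume st: "\<tau> i \<le> s" "s < t" "t \<le> \<tau> (i + 1)"
  have on_piece: "W r x = flow r (Q i x)" "Winv r x = R i (flowinv r x)" if "r \<in> {s..t}" "r \<noteq> \<tau> i" for r x
    using W_on_piece[of i r] that st by auto
  have z: "Q i (y v) - Q i (y u) = integral {u..v} (\<lambda>r. flowinv r (\<phi> r))" if uv: "s \<le> u" "u \<le> v" "v \<le> t" for u v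
  proof -
    have "Q i (y v) - Q i (y u) = Q i (integral {u..v} (\<lambda>r. Winv r (\<phi> r)))"
      using y[OF uv(2)] by (simp flip: blinfun.diff_right)
    also have "\<dots> = integral {u..v} (\<lambda>r. Q i (Winv r (\<phi> r)))"
      using integral_linear[OF Winv_integrable[OF \<phi> \<gamma>] blinfun.bounded_linear_right[of "Q i"]] by (simp add: o_def)
    also have "\<dots> = integral {u..v} (\<lambda>r. flowinv r (\<phi> r))"
      by (rule integral_spike[of "{\<tau> i}"]) (use uv in \<open>auto simp: on_piece\<close>)
    finally show ?thesis .
  qed
  note voc = flow_variation_of_constants[OF less_imp_le[OF st(2)] \<phi> \<gamma> z]
  have eq: "A r (W r (y r)) + \<phi> r = A r (flow r (Q i (y r))) + \<phi> r" if "r \<in> {s..t} - {\<tau> i}" for r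
    using that by (simp add: on_piece)
  have "(\<lambda>r. A r (W r (y r)) + \<phi> r) integrable_on {s..t}"
    by (rule integrable_spike_finite[OF _ _ voc(1), of "{\<tau> i}"]) (use eq in auto)
  moreover have "integral {s..t} (\<lambda>r. A r (W r (y r)) + \<phi> r) = integral {s..t} (\<lambda>r. A r (flow r (Q i (y r))) + \<phi> r)"
    by (rule integral_spike[of "{\<tau> i}"]) (use eq in auto)
  moreover have "W t (y t) = flow t (Q i (y t))" using st by (simp add: on_piece)
  moreover have "(if s = \<tau> i then W s (y s) + B i (W s (y s)) else W s (y s)) = flow s (Q i (y s))"
    using st by (simp add: on_piece W_after_jump)
  ultimately show "(\<lambda>r. A r (W r (y r)) + \<phi> r) integrable_on {s..t} \<and>
     W t (y t) = (if s = \<tau> i then W s (y s) + B i (W s (y s)) else W s (y s)) + integral {s..t} (\<lambda>r. A r (W r (y r)) + \<phi> r)"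
    using voc(2) by (simp add: algebra_simps)
qed

lemma linear_solution_W: "linear_impulsive_solution A B \<tau> (\<lambda>t. W t c)"
  using variation_of_constants[of "\<lambda>_. 0" "\<lambda>_. 0" "\<lambda>_. c"] by (simp add: integrable_0)

text \<open>
Uniqueness among all functions for which the integral makes sense. A zero spreads over its piece by Gronwall's
inequality, to the next piece through the jump, and to the previous piece since \<open>I + B\<^sub>i\<close> is injective.
\<close>
lemma linear_solution_zero:
  assumes d: "linear_impulsive_solution A B \<tau> d" and "d s = 0"
  shows "d t = 0"
proof -
  have inc: "after_jump d i v - after_jump d i u = integral {u..v} (\<lambda>r. A r (after_jump d i r))"
    if "\<tau> i \<le> u" "u \<le> v" "v \<le> \<tau> (i + 1)" for i u v
    unfolding solution_on_piece[OF d that] by (rule integral_spike[of "{\<tau> i}"]) (auto simp: after_jump_def)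
  have zero: "after_jump d i q = 0"
    if "after_jump d i p = 0" "p \<in> {\<tau> i..\<tau> (i + 1)}" "q \<in> {\<tau> i..\<tau> (i + 1)}" for i p q
    by (rule vec.solution_unique[OF that(2,3) _ after_jump_continuous[OF d] inc, of "\<lambda>_. 0"])
       (use that(1) in simp_all)
  have up: "d (\<tau> (i + 1)) = 0" if "d (\<tau> i) = 0" for i
    using zero[of i "\<tau> i" "\<tau> (i + 1)"] that \<tau>_step[of i] by (simp add: after_jump_def)
  have down: "d (\<tau> i) = 0" if "d (\<tau> (i + 1)) = 0" for i
  proof -
    have "after_jump d i (\<tau> i) = 0"
      using zero[of i "\<tau> (i + 1)" "\<tau> i"] that \<tau>_step[of i] by (simp add: after_jump_def)
    then have "(id_blinfun + B i) (d (\<tau> i)) = 0" by (simp add: after_jump_def blinfun.add_left)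
    moreover obtain S where "S o\<^sub>L (id_blinfun + B i) = id_blinfun" using jump_invertible by blast
    then have "S ((id_blinfun + B i) (d (\<tau> i))) = d (\<tau> i)"
      by (metis blinfun_apply_blinfun_compose blinfun_apply_id_blinfun)
    ultimately show ?thesis by (simp add:)
  qed
  have "d (\<tau> (piece_of s + 1)) = 0"
    using zero[of "piece_of s" s "\<tau> (piece_of s + 1)"] piece_of[of s] \<open>d s = 0\<close> \<tau>_step[of "piece_of s"] by (simp add: after_jump_def)
  then have all: "d (\<tau> i) = 0" for i
  proof (induction i rule: int_induct[of _ "piece_of s + 1"])
    case (step2 i)
    then show ?case using down[of "i - 1"] by simp
  qed (use up in auto)
  show ?thesis
    using zero[of "piece_of t" "\<tau> (piece_of t)" t] piece_of[of t] all[of "piece_of t"] by (simp add: after_jump_def)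
qed

lemma solution_of_forcing: "impulsive_solution A B \<tau> f x \<longleftrightarrow> impulsive_solution A B \<tau> (\<lambda>r _. f r (x r)) x"
  by (simp add: impulsive_solution_def)

lemma forced_solutions_difference:
  assumes x: "impulsive_solution A B \<tau> (\<lambda>r _. \<phi> r) x" and y: "impulsive_solution A B \<tau> (\<lambda>r _. \<phi> r) y"
  shows "linear_impulsive_solution A B \<tau> (\<lambda>t. x t - y t)"
  unfolding impulsive_solution_def
proof (intro allI impI)
  fix s t :: real assume "s < t"
  note x' = x[unfolded impulsive_solution_def, rule_format, OF \<open>s < t\<close>]
  note y' = y[unfolded impulsive_solution_def, rule_format, OF \<open>s < t\<close>]
  have eq: "(\<lambda>r. A r (x r - y r) + 0) = (\<lambda>r. (A r (x r) + \<phi> r) - (A r (y r) + \<phi> r))"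
    by (simp add: blinfun.diff_right)
  show "(\<lambda>r. A r (x r - y r) + 0) integrable_on {s..t} \<and>
      x t - y t = x s - y s + integral {s..t} (\<lambda>r. A r (x r - y r) + 0) + (\<Sum>i | s \<le> \<tau> i \<and> \<tau> i < t. B i (x (\<tau> i) - y (\<tau> i)))"
    unfolding eq using integrable_diff[OF conjunct1[OF x'] conjunct1[OF y']] integral_diff[OF conjunct1[OF x'] conjunct1[OF y']]
      conjunct2[OF x'] conjunct2[OF y'] by (simp add: blinfun.diff_right sum_subtractf)
qed

lemma linear_solution_eq_W:
  assumes "linear_impulsive_solution A B \<tau> x" shows "x t = W t (Winv s (x s))"
proof -
  have "linear_impulsive_solution A B \<tau> (\<lambda>t. x t - W t (Winv s (x s)))"
    by (rule forced_solutions_difference[OF assms linear_solution_W])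
  from linear_solution_zero[OF this, of s t] show ?thesis by simp
qed

text \<open>
Sufficiency is \<open>variation_of_constants\<close>. Necessity is uniqueness: the solution built
from a primitive of \<open>Winv \<phi>\<close> differs from \<open>x\<close> by a linear solution that vanishes at \<open>0\<close>.
\<close>
lemma forced_solution_iff:
  assumes \<phi>: "\<And>u v. \<phi> integrable_on {u..v}" "\<And>r. norm (\<phi> r) \<le> \<gamma> r" and \<gamma>: "\<And>u v. \<gamma> integrable_on {u..v}"
  shows "impulsive_solution A B \<tau> (\<lambda>r _. \<phi> r) x \<longleftrightarrow>
    (\<forall>u v. u \<le> v \<longrightarrow> Winv v (x v) - Winv u (x u) = integral {u..v} (\<lambda>r. Winv r (\<phi> r)))" (is "?S x \<longleftrightarrow> ?I x")
proof
  assume "?I x"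
  then show "?S x" using variation_of_constants[OF \<phi> \<gamma>, of "\<lambda>t. Winv t (x t)"] by simp
next
  assume x: "?S x"
  obtain y where y: "y 0 = x 0" "\<forall>u v. u \<le> v \<longrightarrow> y v - y u = integral {u..v} (\<lambda>r. Winv r (\<phi> r))"
    using primitive_exists[OF Winv_integrable[OF \<phi> \<gamma>], of 0 "x 0"] by (elim exE conjE)
  have "?S (\<lambda>t. W t (y t))" by (rule variation_of_constants[OF \<phi> \<gamma>]) (use y in auto)
  from linear_solution_zero[OF forced_solutions_difference[OF x this], of 0]
  have "x t = W t (y t)" for t using y(1) by (simp add: W_0)
  then show "?I x" using y(2) by simp
qed

text \<open>
The description in the definition is proper because linear solutions exist and are unique, and the
resulting map is bounded and linear because it is \<open>W(t)W(s)\<^sup>-\<^sup>1\<close>.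
\<close>
lemma evolution_operator_eq: "evolution_operator A B \<tau> t s = W t o\<^sub>L Winv s"
proof -
  have "(THE x. linear_impulsive_solution A B \<tau> x \<and> x s = x0) = (\<lambda>t. W t (Winv s x0))" for x0
    by (rule the_equality) (use linear_solution_W linear_solution_eq_W[of _ _ s] in auto)
  then have "(\<lambda>x0. (THE x. linear_impulsive_solution A B \<tau> x \<and> x s = x0) t) = blinfun_apply (W t o\<^sub>L Winv s)"
    by auto
  then show ?thesis by (simp only: evolution_operator_def blinfun_apply_inverse)
qed

text \<open>
Both exponents are nonpositive, so the Green operators are bounded by \<open>K\<close>; the Green integrals will converge because
\<open>\<gamma>\<close> is integrable on the line.
\<close>
lemma dichotomy_bounds:
  assumes "exponential_dichotomy A B \<tau> P K \<alpha>"
  shows "s \<le> t \<Longrightarrow> norm (W t o\<^sub>L P o\<^sub>L Winv s) \<le> K"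
    and "t < s \<Longrightarrow> norm (W t o\<^sub>L (id_blinfun - P) o\<^sub>L Winv s) \<le> K"
proof -
  have "K > 0" "\<alpha> > 0" using assms by (auto simp: exponential_dichotomy_def)
  have eq: "evolution_operator A B \<tau> t (\<tau> 0) o\<^sub>L X o\<^sub>L evolution_operator A B \<tau> (\<tau> 0) s = W t o\<^sub>L X o\<^sub>L Winv s"
    for X :: "'a \<Rightarrow>\<^sub>L 'a"
    by (rule blinfun_eqI) (simp add: evolution_operator_eq \<tau>_zero W_0)
  have le: "K * exp z \<le> K" if "z \<le> 0" for z
    using mult_left_mono[of "exp z" 1 K] that \<open>K > 0\<close> by simp
  show "norm (W t o\<^sub>L P o\<^sub>L Winv s) \<le> K" if "s \<le> t"
  proof -
    have "norm (W t o\<^sub>L P o\<^sub>L Winv s) \<le> K * exp (- \<alpha> * (t - s))"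
      using assms that unfolding exponential_dichotomy_def by (elim conjE) (simp flip: eq)
    also have "\<dots> \<le> K" using that \<open>\<alpha> > 0\<close> by (intro le) simp
    finally show ?thesis .
  qed
  show "norm (W t o\<^sub>L (id_blinfun - P) o\<^sub>L Winv s) \<le> K" if "t < s"
  proof -
    have "norm (W t o\<^sub>L (id_blinfun - P) o\<^sub>L Winv s) \<le> K * exp (\<alpha> * (t - s))"
      using assms that unfolding exponential_dichotomy_def by (elim conjE) (simp flip: eq)
    also have "\<dots> \<le> K" using that \<open>\<alpha> > 0\<close> by (intro le) (simp add: mult_nonneg_nonpos)
    finally show ?thesis .
  qed
qed

end

section \<open>The nonlinear equation in moving coordinates\<close>

locale perturbed_system = impulsive_system A B \<tau> N
  for A :: "real \<Rightarrow> 'a::banach \<Rightarrow>\<^sub>L 'a" and B \<tau> N +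
  fixes f :: "real \<Rightarrow> 'a \<Rightarrow> 'a" and \<gamma> :: "real \<Rightarrow> real"
  assumes f_integrable: "(\<lambda>r. f r x) integrable_on {u..v}"
    and f_zero: "f r 0 = 0"
    and f_bound: "norm (f r x) \<le> \<gamma> r"
    and f_lipschitz: "norm (f r x - f r y) \<le> \<gamma> r * norm (x - y)"
    and \<gamma>_integrable: "\<gamma> integrable_on UNIV"
begin

lemma \<gamma>_nonneg: "\<gamma> r \<ge> 0"
  using order_trans[OF norm_ge_zero f_bound[of r 0]] .

lemma \<gamma>_interval: "\<gamma> integrable_on {u..v}"
  using integrable_on_subcbox[OF \<gamma>_integrable, of u v] by simp

lemma superposition_integrable:
  assumes "piecewise_continuous x" shows "(\<lambda>r. f r (x r)) integrable_on {s..t}"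
proof (rule integrable_if_pieces)
  fix i
  obtain X where X: "continuous_on {\<tau> i..\<tau> (i + 1)} X" "\<forall>t. \<tau> i < t \<longrightarrow> t \<le> \<tau> (i + 1) \<longrightarrow> x t = X t"
    using assms unfolding piecewise_continuous_def by (elim allE[of _ i] exE conjE)
  have "(\<lambda>r. f r (X r)) integrable_on {\<tau> i..\<tau> (i + 1)}"
    by (rule integrable_lipschitz_superposition[OF less_imp_le[OF \<tau>_step] X(1) f_integrable f_lipschitz \<gamma>_interval \<gamma>_nonneg])
  then show "(\<lambda>r. f r (x r)) integrable_on {\<tau> i..\<tau> (i + 1)}"
    by (rule integrable_spike_finite[rotated 2, of _ _ "{\<tau> i}"]) (use X(2) in auto)
qed

text \<open>
The right-hand side of the nonlinear equation in the coordinates \<open>y = W(t)\<^sup>-\<^sup>1 x\<close>.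
\<close>
definition h :: "real \<Rightarrow> 'a \<Rightarrow> 'a" where "h r y = Winv r (f r (W r y))"

lemma h_integrable:
  assumes "u \<le> v" "continuous_on {u..v} y" shows "(\<lambda>r. h r (y r)) integrable_on {u..v}"
proof -
  \<comment> \<open>A continuous extension of \<open>y\<close> to the line.\<close>
  define y' where "y' r = y (max u (min v r))" for r
  have "continuous_on UNIV y'"
    unfolding y'_def
  proof (rule continuous_on_compose2[OF assms(2)])
    show "continuous_on UNIV (\<lambda>r. max u (min v r))" by (intro continuous_intros)
  qed (use \<open>u \<le> v\<close> in auto)
  then have "(\<lambda>r. Winv r (f r (W r (y' r)))) integrable_on {u..v}"
    by (intro Winv_integrable[OF superposition_integrable f_bound \<gamma>_interval] W_piecewise_continuous)
  then show ?thesis by (rule integrable_eq) (auto simp: h_def y'_def)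
qed

text \<open>
A Lipschitz constant for \<open>h r\<close>: \<open>\<gamma>(r)\<close> times explicit bounds for \<open>\<parallel>W(r)\<parallel>\<close> and \<open>\<parallel>W(r)\<^sup>-\<^sup>1\<parallel>\<close>. It is written with the
continuous bound of \<open>norm_U\<close> and with factors constant on each piece, so that local integrability is immediate.
\<close>
definition k :: "real \<Rightarrow> real" where
  "k r = norm (R (piece_of r)) * norm (Q (piece_of r)) * ((2 * exp (4 * \<bar>N r - N 0\<bar>))\<^sup>2 * \<gamma> r)"

lemma k_nonneg: "k r \<ge> 0" by (simp add: k_def \<gamma>_nonneg)

lemma k_integrable: "k integrable_on {s..t}"
proof (rule integrable_if_pieces)
  fix i
  define E where "E r = (2 * exp (4 * \<bar>N r - N 0\<bar>))\<^sup>2" for r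
  have "continuous_on {\<tau> i..\<tau> (i + 1)} E"
    unfolding E_def by (intro continuous_intros continuous_on_subset[OF cont_N]) auto
  then have "(\<lambda>r. E r * \<gamma> r) integrable_on {\<tau> i..\<tau> (i + 1)}"
    by (rule integrable_lipschitz_superposition[OF less_imp_le[OF \<tau>_step], where F = "\<lambda>r z. z * \<gamma> r" and \<gamma> = \<gamma>])
       (auto simp: \<gamma>_interval \<gamma>_nonneg integrable_on_mult_right abs_mult simp flip: left_diff_distrib)
  then have "(\<lambda>r. norm (R i) * norm (Q i) * (E r * \<gamma> r)) integrable_on {\<tau> i..\<tau> (i + 1)}"
    by (rule integrable_on_mult_right)
  then show "k integrable_on {\<tau> i..\<tau> (i + 1)}"
    by (rule integrable_spike_finite[rotated 2, of _ _ "{\<tau> i}"]) (use piece_of_eq[of i] in \<open>auto simp: k_def E_def\<close>)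
qed

lemma h_lipschitz: "norm (h r y - h r z) \<le> k r * norm (y - z)"
proof -
  define e where "e = 2 * exp (4 * \<bar>N r - N 0\<bar>)"
  have W: "norm (W r) \<le> e * norm (Q (piece_of r))"
    unfolding W_def using norm_blinfun_compose[of "flow r" "Q (piece_of r)"] mult_right_mono[OF norm_U[of 0 r] norm_ge_zero]
    by (fastforce simp: e_def intro: order_trans)
  have Winv: "norm (Winv r) \<le> norm (R (piece_of r)) * e"
    unfolding Winv_def using norm_blinfun_compose[of "R (piece_of r)" "flowinv r"] mult_left_mono[OF norm_U[of r 0] norm_ge_zero]
    by (fastforce simp: e_def abs_minus_commute intro: order_trans)
  have "h r y - h r z = Winv r (f r (W r y) - f r (W r z))" by (simp add: h_def blinfun.diff_right)
  also have "norm \<dots> \<le> norm (Winv r) * norm (f r (W r y) - f r (W r z))" by (rule norm_blinfun)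
  also have "\<dots> \<le> norm (Winv r) * (\<gamma> r * (norm (W r) * norm (y - z)))"
  proof (rule mult_left_mono)
    have "norm (f r (W r y) - f r (W r z)) \<le> \<gamma> r * norm (W r (y - z))"
      using f_lipschitz[of r "W r y" "W r z"] by (simp add: blinfun.diff_right)
    also have "\<dots> \<le> \<gamma> r * (norm (W r) * norm (y - z))"
      by (intro mult_left_mono norm_blinfun \<gamma>_nonneg)
    finally show "norm (f r (W r y) - f r (W r z)) \<le> \<gamma> r * (norm (W r) * norm (y - z))" .
  qed simp
  also have "\<dots> \<le> norm (R (piece_of r)) * e * (\<gamma> r * (e * norm (Q (piece_of r)) * norm (y - z)))"
    using W Winv \<gamma>_nonneg by (intro mult_mono) (auto simp: e_def)
  also have "\<dots> = k r * norm (y - z)" by (simp add: k_def e_def power2_eq_square mult_ac)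
  finally show ?thesis .
qed

lemma h_field: "\<exists>M. lipschitz_field h M"
proof -
  obtain M where M: "continuous_on UNIV M" "\<forall>u v. u \<le> v \<longrightarrow> M v - M u = integral {u..v} k"
    using primitive_exists[OF k_integrable, of 0 0] by (elim exE conjE)
  have "lipschitz_field h M"
  proof
    show "mono M"
    proof (rule monoI)
      fix u v :: real assume "u \<le> v"
      then show "M u \<le> M v" using M(2) integral_nonneg[OF k_integrable k_nonneg, of u v] by (metis diff_ge_0_iff_ge)
    qed
    show "norm (integral {u..v} (\<lambda>r. h r (y r)) - integral {u..v} (\<lambda>r. h r (z r))) \<le> C * (M v - M u)"
      if "u \<le> v" "continuous_on {u..v} y" "continuous_on {u..v} z" and C: "\<And>r. r \<in> {u..v} \<Longrightarrow> norm (y r - z r) \<le> C"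
      for u v y z C
    proof -
      note ints = h_integrable[OF that(1,2)] h_integrable[OF that(1,3)]
      have "norm (integral {u..v} (\<lambda>r. h r (y r) - h r (z r))) \<le> integral {u..v} (\<lambda>r. C * k r)"
      proof (rule integral_norm_bound_integral[OF integrable_diff[OF ints] integrable_on_mult_right[OF k_integrable]])
        fix r assume "r \<in> {u..v}"
        then show "norm (h r (y r) - h r (z r)) \<le> C * k r"
          using order_trans[OF h_lipschitz mult_left_mono[OF C k_nonneg]] by (simp add: mult.commute)
      qed
      then show ?thesis using M(2) \<open>u \<le> v\<close> by (simp add: integral_diff[OF ints])
    qed
    show "(\<lambda>r. h r (y r)) integrable_on {u..v}" if "u \<le> v" "continuous_on {u..v} y" for u v y
      by (rule h_integrable[OF that])
  qed (auto simp: M h_def f_zero)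
  then show ?thesis by blast
qed

lemma nonlinear_solution_iff:
  "impulsive_solution A B \<tau> f x \<longleftrightarrow> continuous_on UNIV (\<lambda>t. Winv t (x t)) \<and>
     (\<forall>u v. u \<le> v \<longrightarrow> Winv v (x v) - Winv u (x u) = integral {u..v} (\<lambda>r. Winv r (f r (x r))))"
  (is "?S \<longleftrightarrow> ?C \<and> ?I")
proof
  assume ?S
  note int = superposition_integrable[OF solution_piecewise_continuous[OF \<open>?S\<close>]]
  have ?I
    by (rule forced_solution_iff[OF int f_bound \<gamma>_interval, THEN iffD1, OF solution_of_forcing[THEN iffD1, OF \<open>?S\<close>]])
  moreover have ?C
    using \<open>?I\<close> by (intro continuous_on_UNIV_if_intervals primitive_continuous_on[OF Winv_integrable[OF int f_bound \<gamma>_interval]]) auto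
  ultimately show "?C \<and> ?I" by (intro conjI)
next
  assume "?C \<and> ?I"
  then have "piecewise_continuous x" using W_piecewise_continuous[of "\<lambda>t. Winv t (x t)"] by simp
  from forced_solution_iff[OF superposition_integrable[OF this] f_bound \<gamma>_interval, THEN iffD2, OF conjunct2[OF \<open>?C \<and> ?I\<close>]]
  show ?S by (rule solution_of_forcing[THEN iffD2])
qed

end

section \<open>The Green integral of the dichotomy\<close>

text \<open>
The substitute for evaluating a contraction estimate at a supremum that need not be attained.
\<close>
lemma bound_by_halving:
  fixes n :: "'i \<Rightarrow> real"
  assumes n: "\<And>i. 0 \<le> n i" "\<And>i. n i \<le> S0" and halve: "\<And>S i. 0 \<le> S \<Longrightarrow> (\<And>i. n i \<le> S) \<Longrightarrow> n i \<le> \<eta> + S / 2"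
  shows "n i \<le> 2 * \<eta>"
proof -
  define S where "S = (SUP i. n i)"
  have bdd: "bdd_above (range n)" using n(2) by (intro bdd_aboveI[of _ S0]) auto
  have le: "n i \<le> S" for i unfolding S_def by (rule cSUP_upper[OF _ bdd]) simp
  have "S \<ge> 0" using order_trans[OF n(1) le] .
  have "S \<le> \<eta> + S / 2" unfolding S_def by (rule cSUP_least) (use halve[OF \<open>S \<ge> 0\<close> le] in \<open>auto simp: S_def\<close>)
  then have "S \<le> 2 * \<eta>" by argo
  then show ?thesis using le[of i] by linarith
qed

lemma small_tail:
  fixes \<gamma> :: "real \<Rightarrow> real"
  assumes \<gamma>: "\<gamma> integrable_on UNIV" and "e > 0"
  shows "\<exists>T>0. integral UNIV \<gamma> - integral {-T..T} \<gamma> < e"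
proof -
  have "(\<gamma> has_integral integral UNIV \<gamma>) UNIV" using \<gamma> by (rule integrable_integral)
  from this[unfolded has_integral_alt', THEN conjunct2, rule_format, OF \<open>e > 0\<close>]
  obtain T where T: "T > 0" "\<And>a b. ball 0 T \<subseteq> cbox a b \<Longrightarrow> norm (integral (cbox a b) \<gamma> - integral UNIV \<gamma>) < e"
    by auto
  have "norm (integral (cbox (-T) T) \<gamma> - integral UNIV \<gamma>) < e"
    by (rule T(2)) (auto simp: dist_real_def)
  with T(1) show ?thesis by (intro exI[of _ T]) auto
qed

text \<open>
The bound \<open>1/2\<close> in the last assumption is the contraction factor of \<open>correction_map\<close> below.
\<close>
locale dichotomous_perturbation = perturbed_system A B \<tau> N f \<gamma>
  for A :: "real \<Rightarrow> 'a::banach \<Rightarrow>\<^sub>L 'a" and B \<tau> N f \<gamma> +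
  fixes P :: "'a \<Rightarrow>\<^sub>L 'a" and K :: real
  assumes stable: "s \<le> t \<Longrightarrow> norm (W t o\<^sub>L P o\<^sub>L Winv s) \<le> K"
    and unstable: "t < s \<Longrightarrow> norm (W t o\<^sub>L (id_blinfun - P) o\<^sub>L Winv s) \<le> K"
    and small: "K * integral UNIV \<gamma> \<le> 1 / 2"
begin

definition green :: "real \<Rightarrow> real \<Rightarrow> 'a \<Rightarrow>\<^sub>L 'a" where
  "green t s = (if s \<le> t then W t o\<^sub>L P o\<^sub>L Winv s else - (W t o\<^sub>L (id_blinfun - P) o\<^sub>L Winv s))"

definition admissible :: "(real \<Rightarrow> 'a) \<Rightarrow> bool" where
  "admissible \<phi> \<longleftrightarrow> (\<forall>u v. \<phi> integrable_on {u..v}) \<and> (\<forall>r. norm (\<phi> r) \<le> \<gamma> r)"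

definition green_integral :: "(real \<Rightarrow> 'a) \<Rightarrow> real \<Rightarrow> 'a" where
  "green_integral \<phi> t = integral UNIV (\<lambda>s. green t s (\<phi> s))"

lemma K_nonneg: "K \<ge> 0"
  using order_trans[OF norm_ge_zero stable[of 0 0]] by simp

lemma norm_green: "norm (green t s x) \<le> K * norm x"
proof -
  have "norm (green t s) \<le> K" using stable[of s t] unstable[of t s] by (auto simp: green_def)
  then show ?thesis using order_trans[OF norm_blinfun[of "green t s" x] mult_right_mono] by simp
qed

lemma green_integrable:
  assumes "admissible \<phi>" shows "(\<lambda>s. green t s (\<phi> s)) integrable_on UNIV"
proof (rule integrable_on_all_intervals_UNIV)
  have \<phi>: "\<And>u v. \<phi> integrable_on {u..v}" "\<And>r. norm (\<phi> r) \<le> \<gamma> r" using assms by (auto simp: admissible_def)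
  note int = Winv_integrable[OF \<phi> \<gamma>_interval]
  have lin: "(\<lambda>s. X (Winv s (\<phi> s))) integrable_on {u..v}" for X :: "'a \<Rightarrow>\<^sub>L 'a" and u v
    using integrable_linear[OF int blinfun.bounded_linear_right[of X]] by (simp add: o_def)
  show "(\<lambda>s. green t s (\<phi> s)) integrable_on cbox u v" for u v
  proof -
    have "(\<lambda>s. green t s (\<phi> s)) integrable_on {min u t..max v t}"
    proof (rule Henstock_Kurzweil_Integration.integrable_combine[of _ t])
      show "(\<lambda>s. green t s (\<phi> s)) integrable_on {min u t..t}"
        by (rule integrable_eq[OF lin[of "W t o\<^sub>L P"]]) (auto simp: green_def)
      show "(\<lambda>s. green t s (\<phi> s)) integrable_on {t..max v t}"
        by (rule integrable_spike_finite[OF _ _ lin[of "- (W t o\<^sub>L (id_blinfun - P))"], of "{t}"])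
           (auto simp: green_def blinfun.minus_left)
    qed auto
    then show ?thesis by (simp add: integrable_subinterval_real)
  qed
  show "norm (green t s (\<phi> s)) \<le> K * \<gamma> s" for s
    using order_trans[OF norm_green mult_left_mono[OF \<phi>(2) K_nonneg]] .
  show "(\<lambda>s. K * \<gamma> s) integrable_on UNIV" by (rule integrable_on_mult_right[OF \<gamma>_integrable])
qed

lemma green_integral_diff_bound:
  assumes "admissible \<phi>" "admissible \<psi>" and c: "c integrable_on UNIV" "\<And>s. norm (\<phi> s - \<psi> s) \<le> c s"
  shows "norm (green_integral \<phi> t - green_integral \<psi> t) \<le> K * integral UNIV c"
proof -
  note ints = green_integrable[OF assms(1), of t] green_integrable[OF assms(2), of t]
  have "norm (integral UNIV (\<lambda>s. green t s (\<phi> s) - green t s (\<psi> s))) \<le> integral UNIV (\<lambda>s. K * c s)"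
  proof (rule integral_norm_bound_integral[OF integrable_diff[OF ints] integrable_on_mult_right[OF c(1)]])
    show "norm (green t s (\<phi> s) - green t s (\<psi> s)) \<le> K * c s" for s
      using order_trans[OF norm_green[of t s "\<phi> s - \<psi> s"] mult_left_mono[OF c(2) K_nonneg]] by (simp add: blinfun.diff_right)
  qed
  then show ?thesis by (simp add: green_integral_def integral_diff[OF ints])
qed

lemma green_integral_bound:
  assumes "admissible \<phi>" shows "norm (green_integral \<phi> t) \<le> 1 / 2"
proof -
  have "norm (green_integral \<phi> t - green_integral (\<lambda>_. 0) t) \<le> K * integral UNIV \<gamma>"
    by (rule green_integral_diff_bound[OF assms _ \<gamma>_integrable]) (use assms in \<open>auto simp: admissible_def \<gamma>_nonneg integrable_0\<close>)
  then show ?thesis using small by (simp add: green_integral_def)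
qed

text \<open>
Transported by \<open>W(v)\<^sup>-\<^sup>1\<close> and \<open>W(u)\<^sup>-\<^sup>1\<close>, the Green operators from \<open>s\<close> to \<open>v\<close> and to \<open>u\<close> differ only for \<open>s\<close> between \<open>u\<close> and
\<open>v\<close>, and there by \<open>PW(s)\<^sup>-\<^sup>1 + (I - P)W(s)\<^sup>-\<^sup>1 = W(s)\<^sup>-\<^sup>1\<close>.
\<close>
lemma green_integral_increment:
  assumes "admissible \<phi>" "u \<le> v"
  shows "Winv v (green_integral \<phi> v) - Winv u (green_integral \<phi> u) = integral {u..v} (\<lambda>r. Winv r (\<phi> r))"
proof -
  have lin: "Winv t (green_integral \<phi> t) = integral UNIV (\<lambda>s. Winv t (green t s (\<phi> s)))"
      "(\<lambda>s. Winv t (green t s (\<phi> s))) integrable_on UNIV" for t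
    using integral_linear[OF green_integrable[OF assms(1)] blinfun.bounded_linear_right[of "Winv t"]]
      integrable_linear[OF green_integrable[OF assms(1)] blinfun.bounded_linear_right[of "Winv t"]]
    by (simp_all add: green_integral_def o_def)
  have "Winv v (green_integral \<phi> v) - Winv u (green_integral \<phi> u) = integral UNIV (\<lambda>s. Winv v (green v s (\<phi> s)) - Winv u (green u s (\<phi> s)))"
    by (simp add: lin(1) integral_diff[OF lin(2) lin(2)])
  also have "\<dots> = integral UNIV (\<lambda>s. if s \<in> {u..v} then Winv s (\<phi> s) else 0)"
    by (rule integral_spike[of "{u}"])
       (use \<open>u \<le> v\<close> in \<open>auto simp: green_def blinfun.diff_left blinfun.minus_left blinfun.minus_right blinfun.diff_right\<close>)
  also have "\<dots> = integral {u..v} (\<lambda>s. Winv s (\<phi> s))" by (rule integral_restrict_UNIV)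
  finally show ?thesis .
qed

lemma green_integral_continuous:
  assumes "admissible \<phi>" shows "continuous_on UNIV (\<lambda>t. Winv t (green_integral \<phi> t))"
proof (rule continuous_on_UNIV_if_intervals)
  fix a b :: real
  have \<phi>: "\<And>u v. \<phi> integrable_on {u..v}" "\<And>r. norm (\<phi> r) \<le> \<gamma> r" using assms by (auto simp: admissible_def)
  show "continuous_on {a..b} (\<lambda>t. Winv t (green_integral \<phi> t))"
    by (rule primitive_continuous_on[OF Winv_integrable[OF \<phi> \<gamma>_interval] green_integral_increment[OF assms]])
qed

lemma green_integral_solution:
  assumes "admissible \<phi>" shows "impulsive_solution A B \<tau> (\<lambda>r _. \<phi> r) (\<lambda>t. W t c + green_integral \<phi> t)"
proof -
  have \<phi>: "\<And>u v. \<phi> integrable_on {u..v}" "\<And>r. norm (\<phi> r) \<le> \<gamma> r" using assms by (auto simp: admissible_def)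
  show ?thesis
    unfolding forced_solution_iff[OF \<phi> \<gamma>_interval]
    using green_integral_increment[OF assms] by (simp add: blinfun.add_right)
qed

text \<open>
Forcings that are close on \<open>[-T,T]\<close> have Green integrals that are close uniformly on the line, up to the tail of
\<open>\<integral>\<gamma>\<close>. This is the source of the continuity of \<open>\<Phi>\<close> and \<open>\<Psi>\<close>.
\<close>
lemma green_integral_tail_bound:
  assumes "admissible \<phi>" "admissible \<psi>" "\<delta> \<ge> 0"
    and close: "\<And>s. s \<in> {-T..T} \<Longrightarrow> norm (\<phi> s - \<psi> s) \<le> \<gamma> s * \<delta>"
  shows "norm (green_integral \<phi> t - green_integral \<psi> t) \<le> \<delta> / 2 + 2 * K * (integral UNIV \<gamma> - integral {-T..T} \<gamma>)"
proof -
  define c where "c s = \<delta> * \<gamma> s + 2 * (\<gamma> s - (if s \<in> {-T..T} then \<gamma> s else 0))" for s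
  have in_T: "(\<lambda>s. if s \<in> {-T..T} then \<gamma> s else 0) integrable_on UNIV"
    unfolding integrable_restrict_UNIV by (rule \<gamma>_interval)
  have c: "(c has_integral (\<delta> * integral UNIV \<gamma> + 2 * (integral UNIV \<gamma> - integral {-T..T} \<gamma>))) UNIV"
    unfolding c_def
    by (intro has_integral_add has_integral_mult_right has_integral_diff integrable_integral[OF \<gamma>_integrable]
        integrable_integral[OF in_T, unfolded integral_restrict_UNIV])
  have "norm (\<phi> s - \<psi> s) \<le> c s" for s
  proof (cases "s \<in> {-T..T}")
    case True
    then show ?thesis using close[OF True] by (simp add: c_def mult.commute)
  next
    case False
    have "norm (\<phi> s - \<psi> s) \<le> \<gamma> s + \<gamma> s"
      using norm_triangle_le_diff[OF add_mono, of "\<phi> s" "\<gamma> s" "\<psi> s" "\<gamma> s"] assms(1,2) by (simp add: admissible_def)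
    moreover have "\<delta> * \<gamma> s \<ge> 0" using \<open>\<delta> \<ge> 0\<close> \<gamma>_nonneg by simp
    moreover have "c s = \<delta> * \<gamma> s + 2 * \<gamma> s" using False by (auto simp: c_def)
    ultimately show ?thesis by linarith
  qed
  then have "norm (green_integral \<phi> t - green_integral \<psi> t) \<le> K * (\<delta> * integral UNIV \<gamma> + 2 * (integral UNIV \<gamma> - integral {-T..T} \<gamma>))"
    using green_integral_diff_bound[OF assms(1,2) has_integral_integrable[OF c]] integral_unique[OF c] by simp
  also have "\<dots> = \<delta> * (K * integral UNIV \<gamma>) + 2 * K * (integral UNIV \<gamma> - integral {-T..T} \<gamma>)"
    by (simp add: algebra_simps)
  also have "\<delta> * (K * integral UNIV \<gamma>) \<le> \<delta> * (1 / 2)" using small \<open>\<delta> \<ge> 0\<close> by (rule mult_left_mono)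
  finally show ?thesis by simp
qed

text \<open>
Continuity in the coordinates \<open>W(t)\<^sup>-\<^sup>1 x\<close>, that is, \<open>x\<close> is continuous except for the jumps of the linear equation.
\<close>
definition flow_continuous :: "(real \<Rightarrow> 'a) \<Rightarrow> bool" where "flow_continuous x \<longleftrightarrow> continuous_on UNIV (\<lambda>t. Winv t (x t))"

lemma flow_continuous_admissible: "flow_continuous x \<Longrightarrow> admissible (\<lambda>r. f r (x r))"
  using superposition_integrable[of x] W_piecewise_continuous[of "\<lambda>t. Winv t (x t)"]
  by (simp add: flow_continuous_def admissible_def f_bound)

lemma flow_continuous_W_plus: "flow_continuous z \<Longrightarrow> flow_continuous (\<lambda>t. W t c + z t)"
  unfolding flow_continuous_def blinfun.add_right W_inverse by (intro continuous_on_add continuous_on_const)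

text \<open>
A fixed point \<open>z\<close> is a bounded correction that turns the linear solution \<open>W(t)c\<close> into the nonlinear
solution \<open>W(t)c + z(t)\<close>.
\<close>
definition correction_map :: "'a \<Rightarrow> (real \<Rightarrow> 'a) \<Rightarrow> real \<Rightarrow> 'a" where
  "correction_map c z = green_integral (\<lambda>r. f r (W r c + z r))"

lemma correction_map_fixed_point: "\<exists>z. flow_continuous z \<and> correction_map c z = z"
proof -
  have "\<exists>z. flow_continuous z \<and> correction_map c z = z"
  proof (rule weighted_fixed_point[where z = "\<lambda>_. 0" and C = "1/2" and w = "\<lambda>_. 1"])
    show "flow_continuous (correction_map c x)" if "flow_continuous x" for x
      using green_integral_continuous[OF flow_continuous_admissible[OF flow_continuous_W_plus[OF that]]] by (simp add: flow_continuous_def correction_map_def)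
    show "flow_continuous x" if X: "\<And>n::nat. flow_continuous (X n)" and lim: "\<And>e. e > 0 \<Longrightarrow> \<exists>n. \<forall>t. norm (X n t - x t) \<le> e * 1" for X x
      unfolding flow_continuous_def
    proof (intro continuous_on_UNIV_if_intervals continuous_on_approximable)
      fix a b e :: real assume "e > 0"
      obtain c where c: "c \<ge> 1" "\<And>t. t \<in> {a..b} \<Longrightarrow> norm (Winv t) \<le> c" using W_bounded[of a b] by blast
      obtain n where n: "\<And>t. norm (X n t - x t) \<le> e / c" using lim[of "e / c"] c(1) \<open>e > 0\<close> by auto
      have "dist (Winv t (X n t)) (Winv t (x t)) \<le> e" if "t \<in> {a..b}" for t
      proof -
        have "norm (Winv t (X n t - x t)) \<le> norm (Winv t) * norm (X n t - x t)" by (rule norm_blinfun)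
        also have "\<dots> \<le> c * (e / c)" using c n that by (intro mult_mono) auto
        also have "\<dots> = e" using c(1) by simp
        finally show ?thesis by (simp add: dist_norm blinfun.diff_right)
      qed
      moreover have "continuous_on {a..b} (\<lambda>t. Winv t (X n t))"
        using X[of n] continuous_on_subset by (auto simp: flow_continuous_def)
      ultimately show "\<exists>g. continuous_on {a..b} g \<and> (\<forall>t\<in>{a..b}. dist (g t) (Winv t (x t)) \<le> e)"
        by (intro exI[of _ "\<lambda>t. Winv t (X n t)"] conjI ballI)
    qed
    show "norm (correction_map c x t - correction_map c y t) \<le> C / 2 * 1"
      if "flow_continuous x" "flow_continuous y" "C \<ge> 0" and C: "\<And>t. norm (x t - y t) \<le> C * 1" for x y C t
    proof -
      have "norm (correction_map c x t - correction_map c y t) \<le> K * integral UNIV (\<lambda>s. C * \<gamma> s)"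
        unfolding correction_map_def
      proof (rule green_integral_diff_bound[OF flow_continuous_admissible[OF flow_continuous_W_plus[OF that(1)]] flow_continuous_admissible[OF flow_continuous_W_plus[OF that(2)]]
            integrable_on_mult_right[OF \<gamma>_integrable]])
        show "norm (f s (W s c + x s) - f s (W s c + y s)) \<le> C * \<gamma> s" for s
          using order_trans[OF f_lipschitz[of s "W s c + x s" "W s c + y s"]] mult_left_mono[OF C[of s] \<gamma>_nonneg[of s]]
          by (simp add: mult.commute)
      qed
      also have "\<dots> = C * (K * integral UNIV \<gamma>)" by simp
      also have "\<dots> \<le> C * (1 / 2)" using small \<open>C \<ge> 0\<close> by (rule mult_left_mono)
      finally show ?thesis by simp
    qed
    show "flow_continuous (\<lambda>_. 0)" by (simp add: flow_continuous_def)
    then show "norm (correction_map c (\<lambda>_. 0) t - 0) \<le> 1 / 2 * 1" for t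
      using green_integral_bound[OF flow_continuous_admissible[OF flow_continuous_W_plus[of "\<lambda>_. 0" c]], of t] by (simp add: correction_map_def)
  qed auto
  then show ?thesis .
qed

text \<open>
Feeding a bound \<open>M\<close> for \<open>\<parallel>z - z'\<parallel>\<close> into \<open>green_integral_tail_bound\<close> returns \<open>M/2\<close> plus the contributions of \<open>c - c'\<close> and
of the tail, hence \<open>bound_by_halving\<close>.
\<close>
lemma correction_map_fixed_point_close:
  assumes z: "flow_continuous z" "correction_map c z = z" and z': "flow_continuous z'" "correction_map c' z' = z'"
    and "C \<ge> 0" and C: "\<And>s. s \<in> {-S..S} \<Longrightarrow> norm (W s) \<le> C"
  shows "norm (z t - z' t) \<le> C * norm (c - c') + 4 * K * (integral UNIV \<gamma> - integral {-S..S} \<gamma>)"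
proof -
  let ?tail = "integral UNIV \<gamma> - integral {-S..S} \<gamma>"
  have adm: "admissible (\<lambda>r. f r (W r c + z r))" "admissible (\<lambda>r. f r (W r c' + z' r))"
    by (intro flow_continuous_admissible flow_continuous_W_plus z z')+
  have eq: "z t = green_integral (\<lambda>r. f r (W r c + z r)) t" "z' t = green_integral (\<lambda>r. f r (W r c' + z' r)) t" for t
    using fun_cong[OF z(2), of t] fun_cong[OF z'(2), of t] by (simp_all add: correction_map_def)
  have bound: "norm (z t - z' t) \<le> 1" for t
    using norm_triangle_le_diff[OF add_mono, OF green_integral_bound[OF adm(1), of t, folded eq(1)] green_integral_bound[OF adm(2), of t, folded eq(2)]] by simp
  have "norm (z t - z' t) \<le> 2 * (C * norm (c - c') / 2 + 2 * K * ?tail)"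
  proof (rule bound_by_halving[where n = "\<lambda>t. norm (z t - z' t)" and ?S0.0 = 1])
    fix M t assume M: "0 \<le> M" "\<And>t. norm (z t - z' t) \<le> M"
    have "norm (green_integral (\<lambda>r. f r (W r c + z r)) t - green_integral (\<lambda>r. f r (W r c' + z' r)) t)
        \<le> (C * norm (c - c') + M) / 2 + 2 * K * ?tail"
    proof (rule green_integral_tail_bound[OF adm])
      show "0 \<le> C * norm (c - c') + M" using M(1) \<open>C \<ge> 0\<close> by simp
      fix s assume s: "s \<in> {-S..S}"
      have "norm (W s c + z s - (W s c' + z' s)) \<le> norm (W s (c - c')) + norm (z s - z' s)"
        using norm_triangle_ineq[of "W s (c - c')" "z s - z' s"] by (simp add: blinfun.diff_right algebra_simps)
      also have "norm (W s (c - c')) \<le> C * norm (c - c')"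
        using order_trans[OF norm_blinfun[of "W s" "c - c'"] mult_right_mono[of "norm (W s)" "C"]] C[OF s] by simp
      finally have "norm (W s c + z s - (W s c' + z' s)) \<le> C * norm (c - c') + M" using M(2)[of s] by linarith
      then show "norm (f s (W s c + z s) - f s (W s c' + z' s)) \<le> \<gamma> s * (C * norm (c - c') + M)"
        using order_trans[OF f_lipschitz mult_left_mono[OF _ \<gamma>_nonneg]] by blast
    qed
    then show "norm (z t - z' t) \<le> C * norm (c - c') / 2 + 2 * K * ?tail + M / 2"
      by (simp add: eq[of t, symmetric] add_divide_distrib)
  qed (use bound in auto)
  then show ?thesis by simp
qed

end

section \<open>The conjugacy\<close>

context dichotomous_perturbation begin

lemma tail_vanishes:
  assumes "e > 0" shows "\<exists>S>0. 2 * K * (integral UNIV \<gamma> - integral {-S..S} \<gamma>) < e"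
proof -
  have "e / (2 * K + 1) > 0" using \<open>e > 0\<close> K_nonneg by simp
  from small_tail[OF \<gamma>_integrable this] obtain S where S: "S > 0" "integral UNIV \<gamma> - integral {-S..S} \<gamma> < e / (2 * K + 1)"
    by (elim exE conjE)
  have "2 * K * (integral UNIV \<gamma> - integral {-S..S} \<gamma>) \<le> 2 * K * (e / (2 * K + 1))"
    using S(2) K_nonneg by (intro mult_left_mono) auto
  also have "\<dots> < (2 * K + 1) * (e / (2 * K + 1))"
    using \<open>e / (2 * K + 1) > 0\<close> by (intro mult_strict_right_mono) auto
  also have "\<dots> = e" using K_nonneg by simp
  finally show ?thesis using S(1) by (intro exI[of _ S] conjI)
qed

definition correction :: "'a \<Rightarrow> real \<Rightarrow> 'a" where "correction c = (SOME z. flow_continuous z \<and> correction_map c z = z)"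

lemma correction: "flow_continuous (correction c)" "correction_map c (correction c) = correction c"
  using someI_ex[OF correction_map_fixed_point[of c]] by (simp_all add: correction_def)

text \<open>
Besides continuity in \<open>c\<close> this contains uniqueness of the fixed point, as the case \<open>c = c'\<close> shows.
\<close>
lemma fixed_points_continuous:
  assumes "e > 0"
  shows "\<exists>\<delta>>0. \<forall>c' z' z t. norm (c - c') < \<delta> \<longrightarrow> flow_continuous z \<longrightarrow> correction_map c z = z \<longrightarrow> flow_continuous z' \<longrightarrow> correction_map c' z' = z' \<longrightarrow> norm (z t - z' t) < e"
proof -
  have "e / 4 > 0" using assms by simp
  from tail_vanishes[OF this] obtain S where S: "S > 0" "2 * K * (integral UNIV \<gamma> - integral {-S..S} \<gamma>) < e / 4"
    by (elim exE conjE)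
  obtain C where C: "C \<ge> 1" "\<And>s. s \<in> {-S..S} \<Longrightarrow> norm (W s) \<le> C" using W_bounded[of "-S" S] by blast
  have "norm (z t - z' t) < e"
    if "norm (c - c') < e / 2 / C" "flow_continuous z" "correction_map c z = z" "flow_continuous z'" "correction_map c' z' = z'" for c' z z' t
  proof -
    have "norm (z t - z' t) \<le> C * norm (c - c') + 4 * K * (integral UNIV \<gamma> - integral {-S..S} \<gamma>)"
      by (rule correction_map_fixed_point_close[OF that(2-5)]) (use C in auto)
    moreover have "C * norm (c - c') < C * (e / 2 / C)"
      using that(1) C(1) by (intro mult_strict_left_mono) auto
    moreover have "C * (e / 2 / C) = e / 2" using C(1) by simp
    ultimately show ?thesis using S(2) by argo
  qed
  moreover have "e / 2 / C > 0" using C(1) assms by simp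
  ultimately show ?thesis by (intro exI[of _ "e / 2 / C"] conjI allI impI)
qed

lemma correction_unique:
  assumes "flow_continuous z" "correction_map c z = z" shows "correction c = z"
proof
  fix t
  have "norm (correction c t - z t) < 0 + e" if "e > 0" for e
  proof -
    obtain \<delta> where \<delta>: "\<delta> > 0" "\<forall>c' z' z t. norm (c - c') < \<delta> \<longrightarrow> flow_continuous z \<longrightarrow> correction_map c z = z \<longrightarrow> flow_continuous z' \<longrightarrow> correction_map c' z' = z' \<longrightarrow> norm (z t - z' t) < e"
      using fixed_points_continuous[OF \<open>e > 0\<close>, of c] by (elim exE conjE)
    show ?thesis using \<delta>(2)[rule_format, OF _ correction assms, of t] \<delta>(1) by simp
  qed
  then have "norm (correction c t - z t) \<le> 0" by (rule field_le_epsilon[OF less_imp_le])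
  then show "correction c t = z t" by simp
qed

definition \<Phi> :: "real \<Rightarrow> 'a \<Rightarrow> 'a" where "\<Phi> t \<xi> = \<xi> + correction (Winv t \<xi>) t"

lemma \<Phi>_continuous: "continuous_on UNIV (\<Phi> t)"
proof -
  have "continuous_on UNIV (\<lambda>c. correction c t)"
    unfolding continuous_on_iff
  proof (intro ballI allI impI)
    fix c :: 'a and e :: real assume "e > 0"
    obtain \<delta> where \<delta>: "\<delta> > 0" "\<forall>c' z' z t. norm (c - c') < \<delta> \<longrightarrow> flow_continuous z \<longrightarrow> correction_map c z = z \<longrightarrow> flow_continuous z' \<longrightarrow> correction_map c' z' = z' \<longrightarrow> norm (z t - z' t) < e"
      using fixed_points_continuous[OF \<open>e > 0\<close>, of c] by (elim exE conjE)
    have "dist (correction c' t) (correction c t) < e" if "dist c' c < \<delta>" for c'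
      using \<delta>(2)[rule_format, OF _ correction correction, of c' t] that by (simp add: dist_norm norm_minus_commute)
    with \<delta>(1) show "\<exists>\<delta>>0. \<forall>c'\<in>UNIV. dist c' c < \<delta> \<longrightarrow> dist (correction c' t) (correction c t) < e"
      by (intro exI[of _ \<delta>] conjI ballI impI)
  qed
  from continuous_on_compose2[OF this linear_continuous_on[OF blinfun.bounded_linear_right[of "Winv t"]]]
  have "continuous_on UNIV (\<lambda>\<xi>. correction (Winv t \<xi>) t)" by simp
  then show ?thesis unfolding \<Phi>_def by (rule continuous_on_add[OF continuous_on_id])
qed

lemma solution_W_plus_correction: "impulsive_solution A B \<tau> f (\<lambda>t. W t c + correction c t)"
proof -
  have "green_integral (\<lambda>r. f r (W r c + correction c r)) = correction c" using correction(2)[of c] by (simp add: correction_map_def)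
  with green_integral_solution[OF flow_continuous_admissible[OF flow_continuous_W_plus[OF correction(1)]], of c c c]
  have "impulsive_solution A B \<tau> (\<lambda>r _. f r (W r c + correction c r)) (\<lambda>t. W t c + correction c t)" by simp
  then show ?thesis by (rule solution_of_forcing[THEN iffD2])
qed

abbreviation sol :: "(real \<Rightarrow> 'a) \<Rightarrow> bool" where "sol \<equiv> impulsive_solution A B \<tau> f"

lemma sol_flow_continuous: "sol x \<Longrightarrow> flow_continuous x"
  by (simp add: nonlinear_solution_iff flow_continuous_def)

lemma solution_through: "\<exists>x. sol x \<and> x t = \<xi>"
proof -
  obtain M where "lipschitz_field h M" using h_field by blast
  then interpret nl: lipschitz_field h M .
  obtain y where y: "y t = Winv t \<xi>" "continuous_on UNIV y" "\<forall>u v. u \<le> v \<longrightarrow> y v - y u = integral {u..v} (\<lambda>r. h r (y r))"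
    using nl.solution_exists[of t "Winv t \<xi>"] by (elim exE conjE)
  have "sol (\<lambda>t. W t (y t))"
    unfolding nonlinear_solution_iff using y(2,3) by (simp add: h_def)
  then show ?thesis using y(1) by (intro exI[of _ "\<lambda>t. W t (y t)"]) simp
qed

text \<open>
Gronwall's inequality for the equation \<open>y' = h(r, y)\<close>, translated back by \<open>W\<close>.
\<close>
lemma solutions_close:
  "\<exists>L\<ge>0. \<forall>x x' s. sol x \<longrightarrow> sol x' \<longrightarrow> s \<in> {-S..S} \<longrightarrow> norm (x s - x' s) \<le> L * norm (x t - x' t)"
proof -
  obtain M where "lipschitz_field h M" using h_field by blast
  then interpret nl: lipschitz_field h M .
  define b where "b = max S \<bar>t\<bar>"
  obtain C where C: "C \<ge> 1" "\<And>s. s \<in> {-b..b} \<Longrightarrow> norm (W s) \<le> C \<and> norm (Winv s) \<le> C"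
    using W_bounded[of "-b" b] by blast
  define E where "E = 2 * exp (4 * (M b - M (-b)))"
  have "norm (x s - x' s) \<le> C * (E * C) * norm (x t - x' t)" if x: "sol x" and x': "sol x'" and s: "s \<in> {-S..S}" for x x' s
  proof -
    have s': "s \<in> {-b..b}" and t: "t \<in> {-b..b}" using s by (auto simp: b_def)
    note eqs = x[unfolded nonlinear_solution_iff] x'[unfolded nonlinear_solution_iff]
    have "norm (Winv s (x s) - Winv s (x' s)) \<le> 2 * exp (4 * \<bar>M s - M t\<bar>) * norm (Winv t (x t) - Winv t (x' t))"
      by (rule nl.gronwall[OF t s']) (use eqs in \<open>auto simp: h_def intro: continuous_on_subset\<close>)
    also have "\<dots> \<le> E * (C * norm (x t - x' t))"
    proof (rule mult_mono)
      have "\<bar>M s - M t\<bar> \<le> M b - M (-b)"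
        using monoD[OF nl.mono_N, of "-b" s] monoD[OF nl.mono_N, of s b] monoD[OF nl.mono_N, of "-b" t]
          monoD[OF nl.mono_N, of t b] s' t by (simp add: abs_le_iff)
      then show "2 * exp (4 * \<bar>M s - M t\<bar>) \<le> E" by (simp add: E_def)
      have "norm (Winv t (x t - x' t)) \<le> norm (Winv t) * norm (x t - x' t)" by (rule norm_blinfun)
      also have "\<dots> \<le> C * norm (x t - x' t)" using C(2)[OF t] by (intro mult_right_mono) auto
      finally show "norm (Winv t (x t) - Winv t (x' t)) \<le> C * norm (x t - x' t)" by (simp add: blinfun.diff_right)
    qed (auto simp: E_def)
    finally have le: "norm (Winv s (x s) - Winv s (x' s)) \<le> E * (C * norm (x t - x' t))" .
    have "x s - x' s = W s (Winv s (x s) - Winv s (x' s))" by (simp add: blinfun.diff_right)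
    also have "norm \<dots> \<le> norm (W s) * norm (Winv s (x s) - Winv s (x' s))" by (rule norm_blinfun)
    also have "\<dots> \<le> C * (E * (C * norm (x t - x' t)))"
      using C(1) C(2)[OF s'] le by (intro mult_mono) auto
    finally show ?thesis by (simp add: mult_ac)
  qed
  moreover have "C * (E * C) \<ge> 0" using C(1) by (simp add: E_def)
  ultimately show ?thesis by (intro exI[of _ "C * (E * C)"] conjI allI impI)
qed

lemma solution_unique_through:
  assumes "sol x" "sol x'" "x t = x' t" shows "x = x'"
proof
  fix s
  obtain L where "\<forall>x x' r. sol x \<longrightarrow> sol x' \<longrightarrow> r \<in> {-\<bar>s\<bar>..\<bar>s\<bar>} \<longrightarrow> norm (x r - x' r) \<le> L * norm (x t - x' t)"
    using solutions_close[of "\<bar>s\<bar>" t] by (elim exE conjE)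
  moreover have "s \<in> {-\<bar>s\<bar>..\<bar>s\<bar>}"
    using abs_ge_self[of s] abs_ge_minus_self[of s] by (simp add: minus_le_iff)
  ultimately have "norm (x s - x' s) \<le> L * norm (x t - x' t)" using assms(1,2) by blast
  then show "x s = x' s" using assms(3) by simp
qed

definition solution_at :: "real \<Rightarrow> 'a \<Rightarrow> real \<Rightarrow> 'a" where "solution_at t \<xi> = (SOME x. sol x \<and> x t = \<xi>)"

lemma solution_at: "sol (solution_at t \<xi>)" "solution_at t \<xi> t = \<xi>"
  using someI_ex[OF solution_through[of t \<xi>]] by (simp_all add: solution_at_def)

lemma solution_at_eq: "sol x \<Longrightarrow> solution_at t (x t) = x"
  by (rule solution_unique_through[OF solution_at(1), where t = t]) (simp_all add: solution_at(2))

definition \<Psi> :: "real \<Rightarrow> 'a \<Rightarrow> 'a" where "\<Psi> t \<xi> = \<xi> - green_integral (\<lambda>r. f r (solution_at t \<xi> r)) t"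

lemma \<Psi>_continuous: "continuous_on UNIV (\<Psi> t)"
proof -
  have "continuous_on UNIV (\<lambda>\<xi>. green_integral (\<lambda>r. f r (solution_at t \<xi> r)) t)"
    unfolding continuous_on_iff
  proof (intro ballI allI impI)
    fix \<xi> :: 'a and e :: real assume "e > 0"
    then have "e / 2 > 0" by simp
    from tail_vanishes[OF this] obtain S where S: "2 * K * (integral UNIV \<gamma> - integral {-S..S} \<gamma>) < e / 2"
      by (elim exE conjE)
    obtain L where L: "L \<ge> 0" "\<forall>x x' s. sol x \<longrightarrow> sol x' \<longrightarrow> s \<in> {-S..S} \<longrightarrow> norm (x s - x' s) \<le> L * norm (x t - x' t)"
      using solutions_close[of S t] by (elim exE conjE)
    have "dist (green_integral (\<lambda>r. f r (solution_at t \<xi>' r)) t) (green_integral (\<lambda>r. f r (solution_at t \<xi> r)) t) < e" if "dist \<xi>' \<xi> < e / (L + 1)" for \<xi>'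
    proof -
      have "norm (green_integral (\<lambda>r. f r (solution_at t \<xi>' r)) t - green_integral (\<lambda>r. f r (solution_at t \<xi> r)) t)
          \<le> L * norm (\<xi>' - \<xi>) / 2 + 2 * K * (integral UNIV \<gamma> - integral {-S..S} \<gamma>)"
      proof (rule green_integral_tail_bound[OF flow_continuous_admissible[OF sol_flow_continuous[OF solution_at(1)]] flow_continuous_admissible[OF sol_flow_continuous[OF solution_at(1)]]])
        show "norm (f s (solution_at t \<xi>' s) - f s (solution_at t \<xi> s)) \<le> \<gamma> s * (L * norm (\<xi>' - \<xi>))" if "s \<in> {-S..S}" for s
          using L(2)[rule_format, OF solution_at(1)[of t \<xi>'] solution_at(1)[of t \<xi>] that]
          by (intro order_trans[OF f_lipschitz mult_left_mono[OF _ \<gamma>_nonneg]]) (simp add: solution_at(2))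
      qed (use L(1) in simp)
      moreover have "L * norm (\<xi>' - \<xi>) \<le> e"
      proof -
        have "L * norm (\<xi>' - \<xi>) \<le> (L + 1) * (e / (L + 1))"
          using that L(1) by (intro mult_mono) (auto simp: dist_norm)
        then show ?thesis using L(1) by simp
      qed
      ultimately show ?thesis using S unfolding dist_norm by argo
    qed
    moreover have "e / (L + 1) > 0" using \<open>e > 0\<close> L(1) by simp
    ultimately show "\<exists>\<delta>>0. \<forall>\<xi>'\<in>UNIV. dist \<xi>' \<xi> < \<delta> \<longrightarrow>
        dist (green_integral (\<lambda>r. f r (solution_at t \<xi>' r)) t) (green_integral (\<lambda>r. f r (solution_at t \<xi> r)) t) < e"
      by (intro exI[of _ "e / (L + 1)"] conjI ballI impI)
  qed
  then show ?thesis unfolding \<Psi>_def by (intro continuous_on_diff continuous_on_id)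
qed

lemma \<Psi>_\<Phi>: "\<Psi> t (\<Phi> t \<xi>) = \<xi>"
proof -
  define c where "c = Winv t \<xi>"
  have "\<Phi> t \<xi> = W t c + correction c t" by (simp add: \<Phi>_def c_def)
  then have "solution_at t (\<Phi> t \<xi>) = (\<lambda>t. W t c + correction c t)" using solution_at_eq[OF solution_W_plus_correction[of c], of t] by simp
  then have "\<Psi> t (\<Phi> t \<xi>) = \<Phi> t \<xi> - correction_map c (correction c) t" by (simp add: \<Psi>_def correction_map_def)
  then show ?thesis by (simp add: correction(2)) (simp add: \<Phi>_def c_def)
qed

text \<open>
The Green integral of \<open>f(r, x(r))\<close> and \<open>x\<close> solve the same forced equation, so their difference is some \<open>W(t)c\<close>; then the
Green integral is a fixed point of \<open>correction_map c\<close> by its very definition.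
\<close>
lemma linear_part:
  assumes "sol x"
  shows "linear_impulsive_solution A B \<tau> (\<lambda>t. x t - green_integral (\<lambda>r. f r (x r)) t)"
    and "correction (Winv t (x t - green_integral (\<lambda>r. f r (x r)) t)) = green_integral (\<lambda>r. f r (x r))"
proof -
  let ?z = "green_integral (\<lambda>r. f r (x r))"
  note adm = flow_continuous_admissible[OF sol_flow_continuous[OF assms]]
  have "impulsive_solution A B \<tau> (\<lambda>r _. f r (x r)) ?z" using green_integral_solution[OF adm, of 0] by simp
  from forced_solutions_difference[OF solution_of_forcing[THEN iffD1, OF assms] this]
  show lin: "linear_impulsive_solution A B \<tau> (\<lambda>t. x t - ?z t)" .
  have "W s (Winv t (x t - ?z t)) + ?z s = x s" for s
    using linear_solution_eq_W[OF lin, of s t] by (simp add: algebra_simps)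
  then have "correction_map (Winv t (x t - ?z t)) ?z = ?z" by (simp add: correction_map_def)
  moreover have "flow_continuous ?z" using green_integral_continuous[OF adm] by (simp add: flow_continuous_def)
  ultimately show "correction (Winv t (x t - ?z t)) = ?z" by (intro correction_unique)
qed

lemma \<Phi>_\<Psi>: "\<Phi> t (\<Psi> t \<xi>) = \<xi>"
  using linear_part(2)[OF solution_at(1)[of t \<xi>], of t] by (simp add: \<Phi>_def \<Psi>_def solution_at(2))

theorem perturbation_conjugated: "topologically_conjugated (linear_impulsive_solution A B \<tau>) sol"
  unfolding topologically_conjugated_def
proof (rule exI[of _ \<Phi>], rule exI[of _ \<Psi>], intro conjI allI impI)
  have surj: "g ` UNIV = UNIV" if "\<And>x. g (g' x) = x" for g g' :: "'a \<Rightarrow> 'a" using that by (rule surjI)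
  show "homeomorphism UNIV UNIV (\<Phi> t) (\<Psi> t)" for t
    unfolding homeomorphism_def
    by (intro conjI ballI surj[of "\<Phi> t" "\<Psi> t"] surj[of "\<Psi> t" "\<Phi> t"] \<Phi>_continuous \<Psi>_continuous \<Phi>_\<Psi> \<Psi>_\<Phi>)
  have correction_bound: "norm (correction c t) \<le> 1 / 2" for c t
    using green_integral_bound[OF flow_continuous_admissible[OF flow_continuous_W_plus[OF correction(1)[of c]]], of c t] fun_cong[OF correction(2)[of c], of t]
    by (simp add: correction_map_def)
  then show "bdd_above (range (\<lambda>(t, x). norm (\<Phi> t x - x)))"
    by (intro bdd_aboveI[of _ "1/2"]) (auto simp: \<Phi>_def)
  show "bdd_above (range (\<lambda>(t, x). norm (\<Psi> t x - x)))"
    using green_integral_bound[OF flow_continuous_admissible[OF sol_flow_continuous[OF solution_at(1)]]]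
    by (intro bdd_aboveI[of _ "1/2"]) (auto simp: \<Psi>_def)
  show "sol (\<lambda>t. \<Phi> t (x t))" if x: "linear_impulsive_solution A B \<tau> x" for x
  proof -
    obtain c where "\<And>t. x t = W t c" using linear_solution_eq_W[OF x] by blast
    then have "(\<lambda>t. \<Phi> t (x t)) = (\<lambda>t. W t c + correction c t)" by (simp add: \<Phi>_def)
    then show ?thesis using solution_W_plus_correction[of c] by simp
  qed
  show "linear_impulsive_solution A B \<tau> (\<lambda>t. \<Psi> t (x t))" if x: "sol x" for x
    using linear_part(1)[OF x] by (simp add: \<Psi>_def solution_at_eq[OF x])
qed

end

text \<open>
The primitive of \<open>m\<close>; it increases because its increments dominate norms.
\<close>
lemma integral_majorant_exists:
  fixes A :: "real \<Rightarrow> 'e::banach" and m :: "real \<Rightarrow> real"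
  assumes m: "\<forall>c d. c < d \<longrightarrow> set_integrable lebesgue {c..d} m \<and> norm (integral {c..d} A) \<le> (LINT s:{c..d}|lebesgue. m s)"
  shows "\<exists>N. mono N \<and> continuous_on UNIV N \<and> (\<forall>u v. u \<le> v \<longrightarrow> norm (integral {u..v} A) \<le> N v - N u)"
proof -
  have int: "m integrable_on {u..v}" if "u \<le> v" for u v
  proof (cases "u = v")
    case True
    then show ?thesis using integrable_on_refl[of m u] by simp
  next
    case False
    then have "set_integrable lebesgue {u..v} m" using m[rule_format, of u v] that by simp
    then show ?thesis by (rule set_lebesgue_integral_eq_integral(1))
  qed
  have "\<exists>N. N 0 = 0 \<and> continuous_on UNIV N \<and> (\<forall>u v. u \<le> v \<longrightarrow> N v - N u = integral {u..v} m)"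
    by (rule primitive_exists[OF int])
  then obtain N where N: "continuous_on UNIV N" "\<forall>u v. u \<le> v \<longrightarrow> N v - N u = integral {u..v} m"
    by (elim exE conjE)
  have bound: "norm (integral {u..v} A) \<le> N v - N u" if "u \<le> v" for u v
  proof (cases "u = v")
    case False
    then have "set_integrable lebesgue {u..v} m" using m[rule_format, of u v] that by simp
    then have "(LINT s:{u..v}|lebesgue. m s) = integral {u..v} m" by (rule set_lebesgue_integral_eq_integral(2))
    then show ?thesis using m[rule_format, of u v] N(2) that False by simp
  qed simp
  moreover have "mono N"
  proof (rule monoI)
    fix u v :: real assume "u \<le> v"
    then have "0 \<le> N v - N u" using order_trans[OF norm_ge_zero bound] by blast
    then show "N u \<le> N v" by simp
  qed
  ultimately show ?thesis using N(1) by (intro exI[of _ N] conjI allI impI)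
qed

section \<open>Conjugacy of the impulsive equations\<close>

theorem theorem6p12:
  fixes A :: "real \<Rightarrow> 'a::banach \<Rightarrow>\<^sub>L 'a"
    and B :: "int \<Rightarrow> 'a \<Rightarrow>\<^sub>L 'a"
    and \<tau> :: "int \<Rightarrow> real"
    and P :: "'a \<Rightarrow>\<^sub>L 'a"
    and K \<alpha> C\<^sub>b :: real
  assumes times: "impulse_times \<tau>"
    and B1: "\<And>c d. c < d \<Longrightarrow> A integrable_on {c..d}"
    and B2: "\<exists>m :: real \<Rightarrow> real \<in> borel_measurable lebesgue. \<forall>c d. c < d \<longrightarrow>
               set_integrable lebesgue {c..d} m \<and>
               norm (integral {c..d} A) \<le> (LINT s:{c..d}|lebesgue. m s)"
    and B3: "\<And>i. bij (blinfun_apply (id_blinfun + B i)) \<and>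
                 bounded_linear (inv (blinfun_apply (id_blinfun + B i)))"
    and dichotomy: "exponential_dichotomy A B \<tau> P K \<alpha>"
    and C_pos: "C\<^sub>b > 0"
    and a_sum: "(\<lambda>i. norm (B i)) summable_on UNIV" "(\<Sum>\<^sub>\<infinity>i. norm (B i)) \<le> C\<^sub>b"
    and a_inv: "\<And>i. onorm (inv (blinfun_apply (id_blinfun + B i))) \<le> C\<^sub>b"
    and b: "A integrable_on UNIV"
           "\<exists>m :: real \<Rightarrow> real \<in> borel_measurable lebesgue. integrable lebesgue m \<and>
               norm (integral UNIV A) \<le> (LINT s|lebesgue. m s)"
  shows "\<exists>\<delta>>0. \<forall>(f :: real \<Rightarrow> 'a \<Rightarrow> 'a) (\<gamma> :: real \<Rightarrow> real).
           (\<forall>x c d. c < d \<longrightarrow> (\<lambda>t. f t x) integrable_on {c..d}) \<and>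
           (\<forall>t. f t 0 = 0) \<and>
           \<gamma> \<in> borel_measurable lebesgue \<and> integrable lebesgue \<gamma> \<and>
           (\<forall>t x. norm (f t x) \<le> \<gamma> t) \<and>
           (\<forall>t x y. norm (f t x - f t y) \<le> \<gamma> t * norm (x - y)) \<and>
           (LINT s|lebesgue. \<gamma> s) < \<delta>
           \<longrightarrow> topologically_conjugated (linear_impulsive_solution A B \<tau>)
                                        (impulsive_solution A B \<tau> f)"
proof -
  have on_interval: "g integrable_on {u..v}" if "\<And>c d. c < d \<Longrightarrow> g integrable_on {c..d}"
    for g :: "real \<Rightarrow> 'b::banach" and u v
    using that[of u v] integrable_on_refl[of g u] integrable_on_empty[of g] by (cases u v rule: linorder_cases) auto
  from B2 obtain m :: "real \<Rightarrow> real" where m: "\<forall>c d. c < d \<longrightarrow> set_integrable lebesgue {c..d} m \<and>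
      norm (integral {c..d} A) \<le> (LINT s:{c..d}|lebesgue. m s)"
    by (rule bexE)
  obtain N where N: "mono N" "continuous_on UNIV N" "\<forall>u v. u \<le> v \<longrightarrow> norm (integral {u..v} A) \<le> N v - N u"
    using integral_majorant_exists[OF m] by (elim exE conjE)
  interpret impulsive_system A B \<tau> N
  proof
    fix i
    let ?J = "blinfun_apply (id_blinfun + B i)"
    have J: "bij ?J" "blinfun_apply (Blinfun (inv ?J)) = inv ?J"
      using B3[of i] by (simp_all add: bounded_linear_Blinfun_apply)
    show "\<exists>R. R o\<^sub>L (id_blinfun + B i) = id_blinfun \<and> (id_blinfun + B i) o\<^sub>L R = id_blinfun"
    proof (intro exI[of _ "Blinfun (inv ?J)"] conjI blinfun_eqI)
      show "(Blinfun (inv ?J) o\<^sub>L (id_blinfun + B i)) x = id_blinfun x" for x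
        using inv_f_f[OF bij_is_inj[OF J(1)], of x] by (simp add: J(2))
      show "((id_blinfun + B i) o\<^sub>L Blinfun (inv ?J)) x = id_blinfun x" for x
        using surj_f_inv_f[OF bij_is_surj[OF J(1)], of x] by (simp add: J(2))
    qed
  qed (use times on_interval[OF B1] N in auto)
  have "K > 0" using dichotomy by (simp add: exponential_dichotomy_def)
  \<comment> \<open>The choice \<open>\<delta> = 1/(2K)\<close> makes \<open>K\<integral>\<gamma> \<le> 1/2\<close>.\<close>
  show ?thesis
  proof (intro exI[of _ "1 / (2 * K)"] conjI allI impI, goal_cases)
    case 1
    then show ?case using \<open>K > 0\<close> by simp
  next
    case (2 f \<gamma>)
    then have f: "\<And>x c d. c < d \<Longrightarrow> (\<lambda>t. f t x) integrable_on {c..d}" "\<And>t. f t 0 = 0"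
        "\<And>t x. norm (f t x) \<le> \<gamma> t" "\<And>t x y. norm (f t x - f t y) \<le> \<gamma> t * norm (x - y)"
      and \<gamma>: "integrable lebesgue \<gamma>" "(LINT s|lebesgue. \<gamma> s) < 1 / (2 * K)"
      by (elim conjE; simp)+
    have \<gamma>': "(\<gamma> has_integral (LINT s|lebesgue. \<gamma> s)) UNIV"
      by (rule has_integral_integral_lebesgue[OF \<gamma>(1)])
    interpret dichotomous_perturbation A B \<tau> N f \<gamma> P K
    proof
      show "\<gamma> integrable_on UNIV" using \<gamma>' by (rule has_integral_integrable)
      have "K * (LINT s|lebesgue. \<gamma> s) \<le> K * (1 / (2 * K))"
        using \<gamma>(2) \<open>K > 0\<close> by (intro mult_left_mono) auto
      then show "K * integral UNIV \<gamma> \<le> 1 / 2" using \<open>K > 0\<close> by (simp add: integral_unique[OF \<gamma>'])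
    qed (use f on_interval[OF f(1)] dichotomy_bounds[OF dichotomy] in auto)
    show ?case by (rule perturbation_conjugated)
  qed
qed

end
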